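(* Assume the setting and assumptions in the context, with $|A|=2^{\alpha}$. There is a positive integer $D_0$ (depending only on $d$ and $\alpha$) such that the following holds for every positive integer $m$. Let $\delta\in(0,1)$, $n\ge 1$, and $$\lambda> 72|A|^3\sqrt{2\ln(2d)}+9\ln(|A|/\delta)+18 .$$ For a sample $\mathcal S$ of size $n$ define $$\mathcal J_{\mathcal S,\lambda}(\Theta)=\mathcal R_{\mathcal S}(\Theta)+\frac{\lambda}{\sqrt n}\,\|\Theta\|_{\mathcal P}^2\,\ln\big(4(\|\Theta\|_{\mathcal P}+1)\big),$$ and let $\hat\Theta=\{\hat\theta(a)\}_{a\in A}$ be a minimizer (assumed to exist) of $\mathcal J_{\mathcal S,\lambda}$ over all families $\Theta=\{\theta(a)\}_{a\in A}$ in which each $f(\cdot,\theta(a))$ is a residual network of size $(d,(6^{\alpha}+1)m,D_0,\alpha+1)$. Then with probability at least $1-\delta$ over the i.i.d. sample $\mathcal S$, $$\mathcal R_{\mathcal D}(\hat\Theta)\le \frac{1}{(1-\gamma)^2}\Big(256|A|^5\frac{\|r\|_{\mathcal B}^2}{m}+576\,\gamma^2C_T^2(\Delta t)^2|A|^7\|r\|_{\mathcal B}^2\Big) +\frac{(576\|r\|_{\mathcal B}^2+2)\,|A|^7(\lambda+1)}{(1-\gamma)^2\sqrt n}\Big(72|A|^3\sqrt{2\ln(2d)}+9\ln\Big(4\Big(\tfrac{24}{1-\gamma}|A|^{7/2}\|r\|_{\mathcal B}+1\Big)\Big)+9\ln(|A|/\delta)\Big).$$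
   Context: Residual networks: for positive integers $d,m,D,L$, a residual network of size $(d,m,D,L)$ is a function $f(\cdot,\theta):\mathbb R^d\to\mathbb R$, $f(x,\theta)=u^{\top}h^{[L]}$, where $h^{[0]}=Vx$ and $h^{[l]}=h^{[l-1]}+U^{[l]}\sigma(W^{[l]}h^{[l-1]})$ for $l=1,\dots,L$, with $V\in\mathbb R^{D\times d}$, $W^{[l]}\in\mathbb R^{m\times D}$, $U^{[l]}\in\mathbb R^{D\times m}$, $u\in\mathbb R^D$, $\sigma(z)=\max(z,0)$ applied entrywise, and $\theta=(u,V,\{W^{[l]}\}_{l=1}^L,\{U^{[l]}\}_{l=1}^L)$. Its weighted path norm is $\|\theta\|_{\mathcal P}=\big\||u|^{\top}(I+3|U^{[L]}||W^{[L]}|)\cdots(I+3|U^{[1]}||W^{[1]}|)|V|\big\|_1$, where $|\cdot|$ of a matrix/vector is entrywise absolute value and $I$ is the $D\times D$ identity. For a family $\Theta=\{\theta(a)\}_{a\in A}$ of parameters (one network per action, all of the same size), $f(s,\theta(a))$ denotes the $a$-th network and $\|\Theta\|_{\mathcal P}=\sum_{a\in A}\|\theta(a)\|_{\mathcal P}$. Barron space: for a compact $S\subset\mathbb R^d$, $h:S\to\mathbb R$ is in the Barron space $\mathcal B(S)$ if there is a probability measure $\rho$ on $\mathbb R\times\mathbb R^d$ with $h(x)=\mathbb E_{(u,w)\sim\rho}[u\,\sigma(w^{\top}x)]$ for all $x\in S$; its Barron norm is $\|h\|_{\mathcal B}=\inf_\rho(\mathbb E_{\rho}[u^2\|w\|_1^2])^{1/2}$,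 the infimum over all such $\rho$. For $r:S\times A\to\mathbb R$ with each $r(\cdot,a)\in\mathcal B(S)$, $\|r\|_{\mathcal B}=(\sum_{a\in A}\|r(\cdot,a)\|_{\mathcal B}^2)^{1/2}$. Setting: $S\subseteq[0,1]^d$ is compact with positive Lebesgue measure (state space); $A$ is a finite action set with $|A|=2^{\alpha}$, $\alpha\ge 0$ an integer, identified with $\{1,\dots,2^\alpha\}$; $\gamma\in(0,1)$. The reward $r:S\times A\to\mathbb R$ satisfies: each $r(\cdot,a)$ is continuous and lies in $\mathcal B(S)$, and $|r(s,a)|\le 1$ for all $(s,a)$. The transition $\tilde g:S\times A\times[0,\infty)\to S$ satisfies $\tilde g(s,a,0)=s$, $\tilde g(\tilde g(s,a,t),a,t')=\tilde g(s,a,t+t')$ for $t,t'\ge0$, and there is $C_T>0$ with $\|\tilde g(s,a,t)-\tilde g(s,a,t+\Delta)\|_\infty\le C_T\Delta$ for all $s\in S,a\in A,t\ge0,\Delta\in(0,1)$. A time step $\Delta t\in(0,1)$ is fixed. $\mathcal D$ is the uniform distribution on $S$ and $\mathcal U$ the uniform distribution on $A$. Losses: the Bellman optimal loss is $\mathcal R_{\mathcal D}(\Theta)=\frac12\mathbb E_{s\sim\mathcal D,a\sim\mathcal U}\big(f(s,\theta(a))-r(s,a)-\gamma\max_{a'\in A}f(s',\theta(a'))\big)^2$ with $s'=\tilde g(s,a,\Delta t)$. A sample $\mathcal S=\{(s_i,a_i,s_i')\}_{i=1}^n$ consists of i.i.d. pairs $s_i\sim\mathcal D$, $a_i\sim\mathcal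 U$ (independent) with $s_i'=\tilde g(s_i,a_i,\Delta t)$; the empirical loss is $\mathcal R_{\mathcal S}(\Theta)=\frac1{2n}\sum_{i=1}^n\big(f(s_i,\theta(a_i))-r(s_i,a_i)-\gamma\max_{a'\in A}f(s_i',\theta(a'))\big)^2$. *)

theory Defs
  imports "HOL-Probability.Probability"
begin

text \<open>Parameters of a residual network of size (d,m,D,L).  Input dimension d is CARD('d).
  Only the entries with indices in range are used:
  u j (j<D), V j i (j<D), W l k q (1<=l<=L, k<m, q<D), U l j k (1<=l<=L, j<D, k<m).\<close>
record 'd rnparam =
  pu :: "nat \<Rightarrow> real"
  pV :: "nat \<Rightarrow> 'd \<Rightarrow> real"
  pW :: "nat \<Rightarrow> nat \<Rightarrow> nat \<Rightarrow> real"
  pU :: "nat \<Rightarrow> nat \<Rightarrow> nat \<Rightarrow> real"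

definition relu :: "real \<Rightarrow> real" where
  "relu z = max z 0"

primrec rn_hidden :: "nat \<Rightarrow> nat \<Rightarrow> ('d::finite) rnparam \<Rightarrow> real^'d \<Rightarrow> nat \<Rightarrow> nat \<Rightarrow> real" where
  "rn_hidden m D \<theta> x 0 = (\<lambda>j. \<Sum>i\<in>UNIV. pV \<theta> j i * x $ i)"
| "rn_hidden m D \<theta> x (Suc l) =
     (\<lambda>j. rn_hidden m D \<theta> x l j
          + (\<Sum>k<m. pU \<theta> (Suc l) j k * relu (\<Sum>q<D. pW \<theta> (Suc l) k q * rn_hidden m D \<theta> x l q)))"

definition resnet :: "nat \<Rightarrow> nat \<Rightarrow> nat \<Rightarrow> ('d::finite) rnparam \<Rightarrow> real^'d \<Rightarrow> real" where
  "resnet m D L \<theta> x = (\<Sum>j<D. pu \<theta> j * rn_hidden m D \<theta> x L j)"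

primrec rn_path :: "nat \<Rightarrow> nat \<Rightarrow> ('d::finite) rnparam \<Rightarrow> nat \<Rightarrow> nat \<Rightarrow> 'd \<Rightarrow> real" where
  "rn_path m D \<theta> 0 = (\<lambda>j i. \<bar>pV \<theta> j i\<bar>)"
| "rn_path m D \<theta> (Suc l) =
     (\<lambda>j i. rn_path m D \<theta> l j i
        + 3 * (\<Sum>k<m. \<bar>pU \<theta> (Suc l) j k\<bar> * (\<Sum>q<D. \<bar>pW \<theta> (Suc l) k q\<bar> * rn_path m D \<theta> l q i)))"

text \<open>Weighted path norm || |u|^T (I+3|U^L||W^L|)...(I+3|U^1||W^1|)|V| ||_1.\<close>
definition path_norm :: "nat \<Rightarrow> nat \<Rightarrow> nat \<Rightarrow> ('d::finite) rnparam \<Rightarrow> real" where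
  "path_norm m D L \<theta> = (\<Sum>i\<in>UNIV. \<bar>\<Sum>j<D. \<bar>pu \<theta> j\<bar> * rn_path m D \<theta> L j i\<bar>)"

definition family_path_norm :: "nat set \<Rightarrow> nat \<Rightarrow> nat \<Rightarrow> nat \<Rightarrow> (nat \<Rightarrow> ('d::finite) rnparam) \<Rightarrow> real" where
  "family_path_norm A m D L \<Theta> = (\<Sum>a\<in>A. path_norm m D L (\<Theta> a))"

definition l1norm :: "real^('d::finite) \<Rightarrow> real" where
  "l1norm w = (\<Sum>i\<in>UNIV. \<bar>w $ i\<bar>)"

definition barron_rep :: "(real^('d::finite)) set \<Rightarrow> (real^'d \<Rightarrow> real) \<Rightarrow> (real \<times> (real^'d)) measure \<Rightarrow> bool" where
  "barron_rep S h \<rho> \<longleftrightarrow> prob_space \<rho> \<and> sets \<rho> = sets borel \<and>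
     (\<forall>x\<in>S. integrable \<rho> (\<lambda>(u,w). u * relu (w \<bullet> x)) \<and>
            h x = integral\<^sup>L \<rho> (\<lambda>(u,w). u * relu (w \<bullet> x)))"

definition in_barron :: "(real^('d::finite)) set \<Rightarrow> (real^'d \<Rightarrow> real) \<Rightarrow> bool" where
  "in_barron S h \<longleftrightarrow> (\<exists>\<rho>. barron_rep S h \<rho>)"

definition barron_norm_sq :: "(real^('d::finite)) set \<Rightarrow> (real^'d \<Rightarrow> real) \<Rightarrow> ennreal" where
  "barron_norm_sq S h = (INF \<rho>\<in>{\<rho>. barron_rep S h \<rho>}. \<integral>\<^sup>+ p. ennreal ((fst p)\<^sup>2 * (l1norm (snd p))\<^sup>2) \<partial>\<rho>)"

text \<open>Barron norm (meaningful when barron_norm_sq is finite).\<close>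
definition barron_norm :: "(real^('d::finite)) set \<Rightarrow> (real^'d \<Rightarrow> real) \<Rightarrow> real" where
  "barron_norm S h = sqrt (enn2real (barron_norm_sq S h))"

definition reward_barron_norm :: "(real^('d::finite)) set \<Rightarrow> nat set \<Rightarrow> (real^'d \<Rightarrow> nat \<Rightarrow> real) \<Rightarrow> real" where
  "reward_barron_norm S A r = sqrt (\<Sum>a\<in>A. (barron_norm S (\<lambda>s. r s a))\<^sup>2)"

definition state_dist :: "(real^('d::finite)) set \<Rightarrow> (real^'d) measure" where
  "state_dist S = uniform_measure (restrict_space lborel S) S"

definition sa_dist :: "(real^('d::finite)) set \<Rightarrow> nat set \<Rightarrow> ((real^'d) \<times> nat) measure" where
  "sa_dist S A = state_dist S \<Otimes>\<^sub>M measure_pmf (pmf_of_set A)"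

definition sample_dist :: "(real^('d::finite)) set \<Rightarrow> nat set \<Rightarrow> nat \<Rightarrow> (nat \<Rightarrow> (real^'d) \<times> nat) measure" where
  "sample_dist S A n = PiM {..<n} (\<lambda>_. sa_dist S A)"

definition bellman_res ::
  "nat set \<Rightarrow> nat \<Rightarrow> nat \<Rightarrow> nat \<Rightarrow> (real^('d::finite) \<Rightarrow> nat \<Rightarrow> real) \<Rightarrow> (real^'d \<Rightarrow> nat \<Rightarrow> real \<Rightarrow> real^'d)
   \<Rightarrow> real \<Rightarrow> real \<Rightarrow> (nat \<Rightarrow> 'd rnparam) \<Rightarrow> real^'d \<Rightarrow> nat \<Rightarrow> real" where
  "bellman_res A m D L r g \<gamma> dt \<Theta> s a =
     resnet m D L (\<Theta> a) s - r s a - \<gamma> * Max ((\<lambda>a'. resnet m D L (\<Theta> a') (g s a dt)) ` A)"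

definition pop_loss ::
  "(real^('d::finite)) set \<Rightarrow> nat set \<Rightarrow> nat \<Rightarrow> nat \<Rightarrow> nat \<Rightarrow> (real^'d \<Rightarrow> nat \<Rightarrow> real) \<Rightarrow> (real^'d \<Rightarrow> nat \<Rightarrow> real \<Rightarrow> real^'d)
   \<Rightarrow> real \<Rightarrow> real \<Rightarrow> (nat \<Rightarrow> 'd rnparam) \<Rightarrow> real" where
  "pop_loss S A m D L r g \<gamma> dt \<Theta> =
     1/2 * integral\<^sup>L (sa_dist S A) (\<lambda>p. (bellman_res A m D L r g \<gamma> dt \<Theta> (fst p) (snd p))\<^sup>2)"

definition emp_loss ::
  "nat set \<Rightarrow> nat \<Rightarrow> nat \<Rightarrow> nat \<Rightarrow> (real^('d::finite) \<Rightarrow> nat \<Rightarrow> real) \<Rightarrow> (real^'d \<Rightarrow> nat \<Rightarrow> real \<Rightarrow> real^'d)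
   \<Rightarrow> real \<Rightarrow> real \<Rightarrow> nat \<Rightarrow> (nat \<Rightarrow> (real^'d) \<times> nat) \<Rightarrow> (nat \<Rightarrow> 'd rnparam) \<Rightarrow> real" where
  "emp_loss A m D L r g \<gamma> dt n smp \<Theta> =
     1 / (2 * real n) * (\<Sum>i<n. (bellman_res A m D L r g \<gamma> dt \<Theta> (fst (smp i)) (snd (smp i)))\<^sup>2)"

definition reg_objective ::
  "nat set \<Rightarrow> nat \<Rightarrow> nat \<Rightarrow> nat \<Rightarrow> (real^('d::finite) \<Rightarrow> nat \<Rightarrow> real) \<Rightarrow> (real^'d \<Rightarrow> nat \<Rightarrow> real \<Rightarrow> real^'d)
   \<Rightarrow> real \<Rightarrow> real \<Rightarrow> real \<Rightarrow> nat \<Rightarrow> (nat \<Rightarrow> (real^'d) \<times> nat) \<Rightarrow> (nat \<Rightarrow> 'd rnparam) \<Rightarrow> real" where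
  "reg_objective A m D L r g \<gamma> dt lam n smp \<Theta> =
     emp_loss A m D L r g \<gamma> dt n smp \<Theta>
     + lam / sqrt (real n) * (family_path_norm A m D L \<Theta>)\<^sup>2 * ln (4 * (family_path_norm A m D L \<Theta> + 1))"

end

theory Submission
  imports Defs "HOL-Real_Asymp.Real_Asymp"
begin

text \<open>
  The function \<open>f a = r\<^sub>m a + \<gamma> / (1 - \<gamma>) max r\<^sub>m\<close>, where \<open>r\<^sub>m\<close> approximates the reward by two-layer
  networks with \<open>m\<close> neurons, nearly solves the Bellman equation and is a residual network whose last
  \<open>\<alpha>\<close> layers play a knockout tournament. The minimizer is compared with it by means of a deviation bound
  that holds simultaneously for all networks, with \<open>\<parallel>\<Theta>\<parallel>\<close> peeled at the integers.

  For the deviation bound all Rademacher averages are taken of \<open>exp (sup \<dots>)\<close> instead of \<open>sup \<dots>\<close>: the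
  contraction principle holds for these as well, each residual layer then costs a factor 3 outside the
  exponent, and the exponential Markov inequality gives the tail without a bounded difference inequality.
  The class is replaced by a finite net in the supremum norm (the networks with bounded path norm are
  uniformly Lipschitz), so that no measurability problem arises.
\<close>

section \<open>Contraction for exponential Rademacher averages\<close>

text \<open>The squared loss is not globally Lipschitz. On the ball of path norm \<open>Q\<close>,
  however, predictions are bounded by \<open>2 * Q\<close> and the loss has slope at most
  \<open>2 * Q + 1\<close>, so that the deviation there grows like \<open>Q\<^sup>2 / sqrt n\<close>
  up to logarithms. This is the shape of the penalty; its logarithm pays for the union over the
  integer levels.

  Two kinds of constants have to be kept apart. A factor in front of an exponential moment (the
  input dimension, \<open>3 ^ L\<close>, the number of actions) enters the deviation only through
  \<open>sqrt (2 * ln ...)\<close>, and \<open>3 ^ \<alpha> \<le> N\<^sup>2\<close> with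
  \<open>N = 2 ^ \<alpha>\<close> reduces the depth to a multiple of \<open>ln N\<close>. A factor
  in the scale, in the end \<open>4 * N * (2 * Q + 1) * Q\<close>, is paid in full. Hence the care
  with which sums, maxima and layers are split.

  Two properties of networks without biases are exploited throughout: they vanish at
  \<open>0\<close>, which gives sup bounds and allows a network to be switched off by the input
  \<open>0\<close>, and they are homogeneous in the output vector, which lets a bound for a ball be
  used on single functions.\<close>

lemma exp_diff_mono:
  fixes p q x y :: real
  assumes "p \<le> q" "0 \<le> x" "x \<le> y"
  shows "exp (p + x) - exp p \<le> exp (q + y) - exp q"
proof -
  have "exp p * (exp x - 1) \<le> exp q * (exp y - 1)"
    using assms by (intro mult_mono) auto
  then show ?thesis by (simp add: exp_add algebra_simps)
qed

lemma exp_pair_mono: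
  fixes a b c :: real
  assumes "\<bar>c\<bar> \<le> \<bar>b\<bar>"
  shows "exp (a + c) + exp (a - c) \<le> exp (a + b) + exp (a - b)"
proof -
  have abs: "exp (a + z) + exp (a - z) = exp (a + \<bar>z\<bar>) + exp (a - \<bar>z\<bar>)" for z
    by (cases "z \<ge> 0") auto
  have "exp ((a - \<bar>b\<bar>) + (\<bar>b\<bar> - \<bar>c\<bar>)) - exp (a - \<bar>b\<bar>) \<le> exp ((a + \<bar>c\<bar>) + (\<bar>b\<bar> - \<bar>c\<bar>)) - exp (a + \<bar>c\<bar>)"
    using assms by (intro exp_diff_mono) auto
  then show ?thesis unfolding abs[of b] abs[of c] by (simp add: algebra_simps)
qed

text \<open>The suprema for the signs \<open>+1\<close> and \<open>-1\<close> may be attained at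
  different functions, so the comparison is made for a pair of points, with \<open>U\<close> and
  \<open>V\<close> in the place of the suprema on the right. Convexity and monotonicity of
  \<open>exp\<close> suffice: a larger increment from a higher starting point gains more.\<close>

lemma exp_contraction_two_point:
  fixes a1 a2 b1 b2 c1 c2 U V :: real
  assumes c1: "\<bar>c1\<bar> \<le> \<bar>b1\<bar>" and c2: "\<bar>c2\<bar> \<le> \<bar>b2\<bar>" and c12: "\<bar>c1 - c2\<bar> \<le> \<bar>b1 - b2\<bar>"
    and U1: "exp (a1 + b1) \<le> U" and U2: "exp (a2 + b2) \<le> U"
    and V1: "exp (a1 - b1) \<le> V" and V2: "exp (a2 - b2) \<le> V"
  shows "exp (a1 + c1) + exp (a2 - c2) \<le> U + V"
proof -
  consider (lt1) "a1 + c1 < a2 + c2" | (lt2) "a2 - c2 < a1 - c1"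
    | (main) "a2 + c2 \<le> a1 + c1" "a1 - c1 \<le> a2 - c2" by linarith
  then show ?thesis
  proof cases
    \<comment> \<open>Here point 2 beats point 1 for the sign \<open>+1\<close> and can serve for
      both signs, so the one-point inequality \<open>exp_pair_mono\<close> applies. The next case is
      its mirror image.\<close>
    case lt1
    then have "exp (a1 + c1) \<le> exp (a2 + c2)" by simp
    with exp_pair_mono[OF c2, of a2] U2 V2 show ?thesis by linarith
  next
    case lt2
    then have "exp (a2 - c2) \<le> exp (a1 - c1)" by simp
    with exp_pair_mono[OF c1, of a1] U1 V1 show ?thesis by linarith
  next
    case main
    \<comment> \<open>For equal signs, the point with the larger absolute value of \<open>b\<close>
      takes the gain and the other one the loss; \<open>c12\<close> compares the increments.
      Opposite signs need only monotonicity.\<close>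
    consider (A) "b1 \<ge> 0" "b2 \<ge> 0" "b1 \<ge> b2" | (B) "b1 \<ge> 0" "b2 \<ge> 0" "b2 \<ge> b1"
      | (C) "b1 \<le> 0" "b2 \<le> 0" "b1 \<ge> b2" | (D) "b1 \<le> 0" "b2 \<le> 0" "b2 \<ge> b1"
      | (E) "b1 \<ge> 0" "b2 \<le> 0" | (F) "b1 \<le> 0" "b2 \<ge> 0" by linarith
    then show ?thesis
    proof cases
      case A
      have "exp ((a2 - b2) + (b2 - c2)) - exp (a2 - b2) \<le> exp ((a1 + c1) + (b1 - c1)) - exp (a1 + c1)"
        using A main c1 c2 c12 by (intro exp_diff_mono) linarith+
      then show ?thesis using U1 V2 by simp
    next
      case B
      have "exp ((a1 - b1) + (b1 + c1)) - exp (a1 - b1) \<le> exp ((a2 - c2) + (b2 + c2)) - exp (a2 - c2)"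
        using B main c1 c2 c12 by (intro exp_diff_mono) linarith+
      then show ?thesis using U2 V1 by simp
    next
      case C
      have "exp ((a1 + b1) + (c1 - b1)) - exp (a1 + b1) \<le> exp ((a2 - c2) + (c2 - b2)) - exp (a2 - c2)"
        using C main c1 c2 c12 by (intro exp_diff_mono) linarith+
      then show ?thesis using U1 V2 by simp
    next
      case D
      have "exp ((a2 + b2) + (- b2 - c2)) - exp (a2 + b2) \<le> exp ((a1 + c1) + (- b1 - c1)) - exp (a1 + c1)"
        using D main c1 c2 c12 by (intro exp_diff_mono) linarith+
      then show ?thesis using U2 V1 by simp
    next
      case E
      then have "exp (a1 + c1) \<le> exp (a1 + b1)" "exp (a2 - c2) \<le> exp (a2 - b2)"
        using c1 c2 by auto
      then show ?thesis using U1 V2 by linarith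
    next
      case F
      then have "exp (a1 + c1) \<le> exp (a1 - b1)" "exp (a2 - c2) \<le> exp (a2 + b2)"
        using c1 c2 by auto
      then show ?thesis using U2 V1 by linarith
    qed
  qed
qed

lemma SUP_add_SUP_le_ennreal:
  fixes f g :: "'a \<Rightarrow> ennreal"
  assumes "\<And>x y. x \<in> H \<Longrightarrow> y \<in> H \<Longrightarrow> f x + g y \<le> R"
  shows "(SUP x\<in>H. f x) + (SUP y\<in>H. g y) \<le> R"
proof (cases "H = {}")
  case False
  have "(SUP x\<in>H. f x) + (SUP y\<in>H. g y) = (SUP x\<in>H. f x + (SUP y\<in>H. g y))"
    using False by (rule ennreal_SUP_add_left[symmetric])
  also have "\<dots> \<le> R"
  proof (rule SUP_least)
    fix x assume x: "x \<in> H"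
    have "f x + (SUP y\<in>H. g y) = (SUP y\<in>H. f x + g y)"
      by (rule ennreal_SUP_add_right[OF False])
    also have "\<dots> \<le> R" using assms x by (intro SUP_least)
    finally show "f x + (SUP y\<in>H. g y) \<le> R" .
  qed
  finally show ?thesis .
qed simp

lemma SUP_exp_contraction:
  fixes a b c :: "'h \<Rightarrow> real"
  assumes c: "\<And>h. h \<in> H \<Longrightarrow> \<bar>c h\<bar> \<le> \<bar>b h\<bar>"
    and cc: "\<And>h h'. h \<in> H \<Longrightarrow> h' \<in> H \<Longrightarrow> \<bar>c h - c h'\<bar> \<le> \<bar>b h - b h'\<bar>"
  shows "(SUP h\<in>H. ennreal (exp (a h + c h))) + (SUP h\<in>H. ennreal (exp (a h - c h)))
    \<le> (SUP h\<in>H. ennreal (exp (a h + b h))) + (SUP h\<in>H. ennreal (exp (a h - b h)))"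
    (is "_ \<le> ?U + ?V")
proof (cases "?U = \<infinity> \<or> ?V = \<infinity>")
  case False
  define U V where "U = enn2real ?U" and "V = enn2real ?V"
  have UV: "?U = ennreal U" "?V = ennreal V"
    using False unfolding U_def V_def by (metis ennreal_enn2real infinity_ennreal_def less_top)+
  have nn: "U \<ge> 0" "V \<ge> 0" by (simp_all add: U_def V_def)
  have U: "exp (a h + b h) \<le> U" and V: "exp (a h - b h) \<le> V" if "h \<in> H" for h
  proof -
    have "ennreal (exp (a h + b h)) \<le> ennreal U" "ennreal (exp (a h - b h)) \<le> ennreal V"
      unfolding UV[symmetric] using that by (auto intro: SUP_upper)
    then show "exp (a h + b h) \<le> U" "exp (a h - b h) \<le> V"
      using nn by (auto simp: ennreal_le_iff)
  qed
  show ?thesis unfolding UV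
  proof (rule SUP_add_SUP_le_ennreal)
    fix x y assume "x \<in> H" "y \<in> H"
    then have "exp (a x + c x) + exp (a y - c y) \<le> U + V"
      using c cc U V by (intro exp_contraction_two_point[of "c x" "b x" "c y" "b y"]) auto
    then show "ennreal (exp (a x + c x)) + ennreal (exp (a y - c y)) \<le> ennreal U + ennreal V"
      using nn by (simp flip: ennreal_plus add: ennreal_le_iff)
  qed
next
  case True
  then show ?thesis
  proof (elim disjE)
    assume *: "?U = \<infinity>"
    show ?thesis unfolding * by simp
  next
    assume *: "?V = \<infinity>"
    show ?thesis unfolding * by simp
  qed
qed

text \<open>An iterated fair average instead of an integral over signs: no measurability of
  \<open>F\<close>, a supremum over a large class of networks, is required, and induction on the
  number of signs is immediate. Coordinates from \<open>n\<close> on are \<open>0\<close>.\<close>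

primrec rade :: "nat \<Rightarrow> ((nat \<Rightarrow> real) \<Rightarrow> ennreal) \<Rightarrow> ennreal" where
  "rade 0 F = F (\<lambda>_. 0)"
| "rade (Suc n) F = ennreal (1/2) * (rade n (\<lambda>\<epsilon>. F (\<epsilon>(n := 1))) + rade n (\<lambda>\<epsilon>. F (\<epsilon>(n := - 1))))"

lemma rade_mono: "(\<And>\<epsilon>. F \<epsilon> \<le> G \<epsilon>) \<Longrightarrow> rade n F \<le> rade n G"
  by (induction n arbitrary: F G) (auto intro!: mult_left_mono add_mono)

lemma rade_add: "rade n (\<lambda>\<epsilon>. F \<epsilon> + G \<epsilon>) = rade n F + rade n G"
  by (induction n arbitrary: F G) (auto simp: distrib_left algebra_simps)

lemma rade_cmult: "rade n (\<lambda>\<epsilon>. c * F \<epsilon>) = c * rade n F"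
  by (induction n arbitrary: F) (auto simp: distrib_left mult.left_commute)

lemma rade_sum: "finite I \<Longrightarrow> rade n (\<lambda>\<epsilon>. \<Sum>i\<in>I. F i \<epsilon>) = (\<Sum>i\<in>I. rade n (F i))"
proof (induction I rule: finite_induct)
  case empty
  show ?case using rade_cmult[of n 0 "\<lambda>_. 0"] by simp
qed (simp add: rade_add)

lemma rade_minus: "rade n (\<lambda>\<epsilon>. F (\<lambda>i. - \<epsilon> i)) = rade n F"
proof (induction n arbitrary: F)
  case (Suc n)
  have "(\<lambda>i. - (\<epsilon>(n := x)) i) = (\<lambda>i. - \<epsilon> i)(n := - x)" for \<epsilon> :: "nat \<Rightarrow> real" and x
    by auto
  then have "rade n (\<lambda>\<epsilon>. F (\<lambda>i. - (\<epsilon>(n := x)) i)) = rade n (\<lambda>\<epsilon>. F (\<epsilon>(n := - x)))" for x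
    using Suc[of "\<lambda>\<epsilon>. F (\<epsilon>(n := - x))"] by simp
  then show ?case by (simp add: add.commute)
qed simp

lemma sum_upd_sign: "(\<Sum>i<Suc n. (\<epsilon>(n := (x::real))) i * v i) = (\<Sum>i<n. \<epsilon> i * v i) + x * v n"
  by simp

text \<open>The exponential moment of a Rademacher supremum. Scale parameters are carried inside
  \<open>v\<close>, and values in \<open>ennreal\<close> make finiteness of the supremum no
  concern.\<close>

definition rmgf :: "nat \<Rightarrow> 'h set \<Rightarrow> ('h \<Rightarrow> nat \<Rightarrow> real) \<Rightarrow> ennreal" where
  "rmgf n H v = rade n (\<lambda>\<epsilon>. SUP h\<in>H. ennreal (exp (\<Sum>i<n. \<epsilon> i * v h i)))"

text \<open>The offset \<open>a\<close> collects the contributions of signs that are already fixed.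
  Fixing the last sign moves \<open>x * w h n\<close> into it, so that induction exchanges the first
  \<open>n\<close> coordinates; the last one is exchanged afterwards by
  \<open>SUP_exp_contraction\<close>, averaged over its two signs.\<close>

lemma rmgf_contraction_aux:
  fixes a :: "'h \<Rightarrow> real"
  assumes "\<And>h i. h \<in> H \<Longrightarrow> i < n \<Longrightarrow> \<bar>w h i\<bar> \<le> \<bar>v h i\<bar>"
    and "\<And>h h' i. h \<in> H \<Longrightarrow> h' \<in> H \<Longrightarrow> i < n \<Longrightarrow> \<bar>w h i - w h' i\<bar> \<le> \<bar>v h i - v h' i\<bar>"
  shows "rade n (\<lambda>\<epsilon>. SUP h\<in>H. ennreal (exp (a h + (\<Sum>i<n. \<epsilon> i * w h i))))
    \<le> rade n (\<lambda>\<epsilon>. SUP h\<in>H. ennreal (exp (a h + (\<Sum>i<n. \<epsilon> i * v h i))))"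
  using assms
proof (induction n arbitrary: a)
  case (Suc n)
  have step: "rade n (\<lambda>\<epsilon>. SUP h\<in>H. ennreal (exp (a h + (\<Sum>i<Suc n. (\<epsilon>(n := x)) i * w h i))))
    \<le> rade n (\<lambda>\<epsilon>. SUP h\<in>H. ennreal (exp ((a h + x * w h n) + (\<Sum>i<n. \<epsilon> i * v h i))))" for x
    using Suc.IH[of "\<lambda>h. a h + x * w h n"] Suc.prems
    unfolding sum_upd_sign by (simp add: algebra_simps)
  have "rade n (\<lambda>\<epsilon>. SUP h\<in>H. ennreal (exp ((a h + 1 * w h n) + (\<Sum>i<n. \<epsilon> i * v h i))))
     + rade n (\<lambda>\<epsilon>. SUP h\<in>H. ennreal (exp ((a h + (-1) * w h n) + (\<Sum>i<n. \<epsilon> i * v h i))))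
    \<le> rade n (\<lambda>\<epsilon>. SUP h\<in>H. ennreal (exp (a h + (\<Sum>i<Suc n. (\<epsilon>(n := 1)) i * v h i))))
     + rade n (\<lambda>\<epsilon>. SUP h\<in>H. ennreal (exp (a h + (\<Sum>i<Suc n. (\<epsilon>(n := -1)) i * v h i))))"
    unfolding rade_add[symmetric] sum_upd_sign
  proof (rule rade_mono)
    fix \<epsilon> :: "nat \<Rightarrow> real"
    show "(SUP h\<in>H. ennreal (exp ((a h + 1 * w h n) + (\<Sum>i<n. \<epsilon> i * v h i))))
      + (SUP h\<in>H. ennreal (exp ((a h + (-1) * w h n) + (\<Sum>i<n. \<epsilon> i * v h i))))
      \<le> (SUP h\<in>H. ennreal (exp (a h + ((\<Sum>i<n. \<epsilon> i * v h i) + 1 * v h n))))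
       + (SUP h\<in>H. ennreal (exp (a h + ((\<Sum>i<n. \<epsilon> i * v h i) + (-1) * v h n))))"
      using SUP_exp_contraction[of H "\<lambda>h. w h n" "\<lambda>h. v h n" "\<lambda>h. a h + (\<Sum>i<n. \<epsilon> i * v h i)"] Suc.prems
      by (simp add: algebra_simps)
  qed
  then show ?case
    by (simp only: rade.simps) (intro mult_left_mono order.trans[OF add_mono[OF step step]], auto)
qed simp

lemma rmgf_contraction:
  assumes "\<And>h i. h \<in> H \<Longrightarrow> i < n \<Longrightarrow> \<bar>w h i\<bar> \<le> \<bar>v h i\<bar>"
    and "\<And>h h' i. h \<in> H \<Longrightarrow> h' \<in> H \<Longrightarrow> i < n \<Longrightarrow> \<bar>w h i - w h' i\<bar> \<le> \<bar>v h i - v h' i\<bar>"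
  shows "rmgf n H w \<le> rmgf n H v"
  using rmgf_contraction_aux[of H n w v "\<lambda>_. 0"] assms by (simp add: rmgf_def)

lemma rmgf_image_le:
  assumes "\<And>h. h \<in> H \<Longrightarrow> f h \<in> H'" "\<And>h i. h \<in> H \<Longrightarrow> i < n \<Longrightarrow> v h i = w (f h) i"
  shows "rmgf n H v \<le> rmgf n H' w"
  unfolding rmgf_def using assms by (intro rade_mono SUP_mono) auto

lemma rmgf_cong: "(\<And>h i. h \<in> H \<Longrightarrow> i < n \<Longrightarrow> v h i = w h i) \<Longrightarrow> rmgf n H v = rmgf n H w"
  unfolding rmgf_def by (intro arg_cong[where f = "rade n"] ext SUP_cong) auto

lemma rmgf_minus: "rmgf n H (\<lambda>h i. - v h i) = rmgf n H v"
  using rade_minus[of n "\<lambda>\<epsilon>. SUP h\<in>H. ennreal (exp (\<Sum>i<n. \<epsilon> i * v h i))"]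
  by (simp add: rmgf_def)

text \<open>Takes the place of subadditivity of Rademacher averages: a sum costs nothing in front,
  only the larger scales \<open>1 / p\<close> and \<open>1 / q\<close>, to be balanced by the choice
  of the weights.\<close>

lemma rmgf_convex:
  fixes v w :: "'h \<Rightarrow> nat \<Rightarrow> real"
  assumes p: "0 < p" "0 < q" "p + q = 1"
  shows "rmgf n H (\<lambda>h i. v h i + w h i)
    \<le> ennreal p * rmgf n H (\<lambda>h i. v h i / p) + ennreal q * rmgf n H (\<lambda>h i. w h i / q)"
  unfolding rmgf_def rade_cmult[symmetric] rade_add[symmetric]
proof (intro rade_mono SUP_least)
  fix \<epsilon> :: "nat \<Rightarrow> real" and h assume h: "h \<in> H"
  let ?A = "\<Sum>i<n. \<epsilon> i * (v h i / p)" and ?B = "\<Sum>i<n. \<epsilon> i * (w h i / q)"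
  have "(\<Sum>i<n. \<epsilon> i * (v h i + w h i)) = p * ?A + q * ?B"
    using p by (simp add: sum_distrib_left algebra_simps sum.distrib)
  also have "exp \<dots> \<le> p * exp ?A + q * exp ?B"
    using convex_onD[OF exp_convex, of q ?A ?B] p
    by (simp add: eq_diff_eq[symmetric, of p q 1])
  finally have "ennreal (exp (\<Sum>i<n. \<epsilon> i * (v h i + w h i))) \<le> ennreal (p * exp ?A + q * exp ?B)"
    by (rule ennreal_leI)
  also have "\<dots> = ennreal p * ennreal (exp ?A) + ennreal q * ennreal (exp ?B)"
    using p by (simp add: ennreal_mult)
  also have "\<dots> \<le> ennreal p * (SUP h\<in>H. ennreal (exp (\<Sum>i<n. \<epsilon> i * (v h i / p))))
      + ennreal q * (SUP h\<in>H. ennreal (exp (\<Sum>i<n. \<epsilon> i * (w h i / q))))"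
    using h by (intro add_mono mult_left_mono SUP_upper) auto
  finally show "ennreal (exp (\<Sum>i<n. \<epsilon> i * (v h i + w h i))) \<le> \<dots>" .
qed

section \<open>Sub-Gaussian bound for a fixed coefficient vector\<close>

lemma sinh_le_mult_cosh:
  fixes x :: real
  assumes "0 \<le> x"
  shows "sinh x \<le> x * cosh x"
proof -
  have "0 * cosh 0 - sinh 0 \<le> x * cosh x - sinh x"
    using assms
    by (rule DERIV_nonneg_imp_nondecreasing)
       (auto intro!: exI derivative_eq_intros)
  then show ?thesis by simp
qed

text \<open>On the nonnegative axis \<open>cosh x * exp (- (x\<^sup>2 / 2))\<close> does not
  increase, as its derivative has the sign of \<open>sinh x - x * cosh x\<close>. The rest is
  symmetry.\<close>

lemma cosh_le_exp_sq:
  fixes x :: real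
  shows "cosh x \<le> exp (x\<^sup>2 / 2)"
proof -
  have pos: "cosh x \<le> exp (x\<^sup>2 / 2)" if x: "0 \<le> x" for x :: real
  proof -
    have "cosh x * exp (- (x\<^sup>2 / 2)) \<le> cosh 0 * exp (- (0\<^sup>2 / 2))"
      using x
    proof (rule DERIV_nonpos_imp_nonincreasing)
      fix y :: real assume y: "0 \<le> y" "y \<le> x"
      have "((\<lambda>x. cosh x * exp (- (x\<^sup>2 / 2))) has_real_derivative (sinh y - y * cosh y) * exp (- (y\<^sup>2 / 2))) (at y)"
        by (auto intro!: derivative_eq_intros simp: algebra_simps)
      moreover have "(sinh y - y * cosh y) * exp (- (y\<^sup>2 / 2)) \<le> 0"
        using sinh_le_mult_cosh[OF y(1)] by (simp add: mult_nonpos_nonneg)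
      ultimately show "\<exists>z. ((\<lambda>x. cosh x * exp (- (x\<^sup>2 / 2))) has_real_derivative z) (at y) \<and> z \<le> 0"
        by blast
    qed
    then show ?thesis by (simp add: exp_minus field_simps)
  qed
  show ?thesis
    using pos[of x] pos[of "- x"] by (cases "0 \<le> x") auto
qed

lemma rade_exp_linear:
  assumes "\<And>i. i < n \<Longrightarrow> \<bar>c i\<bar> \<le> b"
  shows "rade n (\<lambda>\<epsilon>. ennreal (exp (\<Sum>i<n. \<epsilon> i * c i))) \<le> ennreal (exp (real n * b\<^sup>2 / 2))"
  using assms
proof (induction n)
  case (Suc n)
  have split: "rade n (\<lambda>\<epsilon>. ennreal (exp (\<Sum>i<Suc n. (\<epsilon>(n := x)) i * c i)))
      = ennreal (exp (x * c n)) * rade n (\<lambda>\<epsilon>. ennreal (exp (\<Sum>i<n. \<epsilon> i * c i)))" for x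
    unfolding sum_upd_sign rade_cmult[symmetric] exp_add
    by (simp add: ennreal_mult mult.commute)
  have "rade (Suc n) (\<lambda>\<epsilon>. ennreal (exp (\<Sum>i<Suc n. \<epsilon> i * c i)))
     = ennreal (cosh (c n)) * rade n (\<lambda>\<epsilon>. ennreal (exp (\<Sum>i<n. \<epsilon> i * c i)))"
    unfolding rade.simps split distrib_right[symmetric] mult.assoc[symmetric]
    by (subst ennreal_plus[symmetric], simp, simp)
      (simp only: ennreal_mult''[symmetric] exp_ge_zero add_nonneg_nonneg, simp add: cosh_field_def)
  also have "\<dots> \<le> ennreal (exp (b\<^sup>2 / 2)) * ennreal (exp (real n * b\<^sup>2 / 2))"
  proof (intro mult_mono ennreal_leI Suc.IH)
    have "(c n)\<^sup>2 \<le> b\<^sup>2" using Suc.prems[of n] power_mono[of "\<bar>c n\<bar>" b 2] by simp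
    then show "cosh (c n) \<le> exp (b\<^sup>2 / 2)"
      using cosh_le_exp_sq[of "c n"] by (auto intro: order.trans)
  qed (use Suc.prems in auto)
  also have "\<dots> = ennreal (exp (real (Suc n) * b\<^sup>2 / 2))"
    by (simp add: ennreal_mult[symmetric] exp_add[symmetric] algebra_simps add_divide_distrib)
  finally show ?case .
qed simp

section \<open>Rademacher averages of residual networks\<close>

text \<open>The output vector is kept apart from the parameters because induction over the layers
  also needs the rows of the next \<open>W\<close> as output vectors of the current layer.\<close>

definition rn_comb :: "nat \<Rightarrow> nat \<Rightarrow> nat \<Rightarrow> ('d::finite) rnparam \<Rightarrow> (nat \<Rightarrow> real) \<Rightarrow> real^'d \<Rightarrow> real" where
  "rn_comb m D l \<theta> v x = (\<Sum>j<D. v j * rn_hidden m D \<theta> x l j)"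

definition comb_norm :: "nat \<Rightarrow> nat \<Rightarrow> nat \<Rightarrow> ('d::finite) rnparam \<Rightarrow> (nat \<Rightarrow> real) \<Rightarrow> real" where
  "comb_norm m D l \<theta> v = (\<Sum>i\<in>UNIV. \<Sum>j<D. \<bar>v j\<bar> * rn_path m D \<theta> l j i)"

lemma rn_path_nonneg: "0 \<le> rn_path m D \<theta> l j i"
  by (induction l arbitrary: j) (auto intro!: add_nonneg_nonneg sum_nonneg mult_nonneg_nonneg)

lemma comb_norm_nonneg: "0 \<le> comb_norm m D l \<theta> v"
  unfolding comb_norm_def by (intro sum_nonneg mult_nonneg_nonneg rn_path_nonneg) auto

lemma path_norm_eq_comb_norm: "path_norm m D L \<theta> = comb_norm m D L \<theta> (pu \<theta>)"
  unfolding path_norm_def comb_norm_def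
  by (intro sum.cong refl abs_of_nonneg sum_nonneg mult_nonneg_nonneg rn_path_nonneg) auto

lemma path_norm_nonneg: "0 \<le> path_norm m D L \<theta>"
  by (simp add: path_norm_eq_comb_norm comb_norm_nonneg)

lemma resnet_eq_rn_comb: "resnet m D L \<theta> x = rn_comb m D L \<theta> (pu \<theta>) x"
  by (simp add: resnet_def rn_comb_def)

lemma rn_comb_scale: "rn_comb m D l \<theta> (\<lambda>j. c * v j) x = c * rn_comb m D l \<theta> v x"
  by (simp add: rn_comb_def sum_distrib_left mult.assoc)

lemma comb_norm_scale: "comb_norm m D l \<theta> (\<lambda>j. c * v j) = \<bar>c\<bar> * comb_norm m D l \<theta> v"
  by (simp add: comb_norm_def sum_distrib_left mult.assoc abs_mult)

lemma rn_comb_Suc: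
  "rn_comb m D (Suc l) \<theta> v x = rn_comb m D l \<theta> v x
     + (\<Sum>k<m. (\<Sum>j<D. v j * pU \<theta> (Suc l) j k) * relu (rn_comb m D l \<theta> (pW \<theta> (Suc l) k) x))"
proof -
  have "(\<Sum>j<D. v j * (\<Sum>k<m. pU \<theta> (Suc l) j k * relu (rn_comb m D l \<theta> (pW \<theta> (Suc l) k) x)))
      = (\<Sum>k<m. (\<Sum>j<D. v j * pU \<theta> (Suc l) j k) * relu (rn_comb m D l \<theta> (pW \<theta> (Suc l) k) x))"
    by (simp add: sum_distrib_left sum_distrib_right mult.assoc) (rule sum.swap)
  then show ?thesis
    by (simp add: rn_comb_def distrib_left sum.distrib)
qed

text \<open>Once the columns of \<open>U\<close> are absorbed into coefficients, a layer adds a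
  linear combination of neurons to the previous layer; the triangle inequality over \<open>j\<close>
  then compares the norms. This inequality carries both inductions over the layers below.\<close>

lemma comb_norm_Suc_ge:
  "comb_norm m D l \<theta> v
     + 3 * (\<Sum>k<m. \<bar>\<Sum>j<D. v j * pU \<theta> (Suc l) j k\<bar> * comb_norm m D l \<theta> (pW \<theta> (Suc l) k))
   \<le> comb_norm m D (Suc l) \<theta> v"
proof -
  let ?W = "\<lambda>k. comb_norm m D l \<theta> (pW \<theta> (Suc l) k)"
  define R where "R k i = (\<Sum>q<D. \<bar>pW \<theta> (Suc l) k q\<bar> * rn_path m D \<theta> l q i)" for k i
  have "(\<Sum>k<m. \<bar>\<Sum>j<D. v j * pU \<theta> (Suc l) j k\<bar> * ?W k)
      \<le> (\<Sum>k<m. (\<Sum>j<D. \<bar>v j\<bar> * \<bar>pU \<theta> (Suc l) j k\<bar>) * ?W k)"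
    by (intro sum_mono mult_right_mono comb_norm_nonneg order.trans[OF sum_abs])
       (simp add: abs_mult)
  also have "\<dots> = (\<Sum>i\<in>UNIV. \<Sum>j<D. \<bar>v j\<bar> * (\<Sum>k<m. \<bar>pU \<theta> (Suc l) j k\<bar> * R k i))"
  proof -
    have W: "?W k = (\<Sum>i\<in>UNIV. R k i)" for k
      by (simp add: comb_norm_def R_def)
    have "(\<Sum>k<m. (\<Sum>j<D. \<bar>v j\<bar> * \<bar>pU \<theta> (Suc l) j k\<bar>) * ?W k)
      = (\<Sum>k<m. \<Sum>i\<in>UNIV. \<Sum>j<D. \<bar>v j\<bar> * (\<bar>pU \<theta> (Suc l) j k\<bar> * R k i))"
      by (simp add: W sum_distrib_right sum_distrib_left mult.assoc)
    also have "\<dots> = (\<Sum>i\<in>UNIV. \<Sum>k<m. \<Sum>j<D. \<bar>v j\<bar> * (\<bar>pU \<theta> (Suc l) j k\<bar> * R k i))"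
      by (rule sum.swap)
    also have "\<dots> = (\<Sum>i\<in>UNIV. \<Sum>j<D. \<Sum>k<m. \<bar>v j\<bar> * (\<bar>pU \<theta> (Suc l) j k\<bar> * R k i))"
      by (intro sum.cong refl sum.swap)
    finally show ?thesis by (simp only: sum_distrib_left)
  qed
  finally have "3 * (\<Sum>k<m. \<bar>\<Sum>j<D. v j * pU \<theta> (Suc l) j k\<bar> * ?W k)
      \<le> (\<Sum>i\<in>UNIV. \<Sum>j<D. \<bar>v j\<bar> * (3 * (\<Sum>k<m. \<bar>pU \<theta> (Suc l) j k\<bar> * R k i)))"
    by (simp add: mult.left_commute[of _ 3] flip: sum_distrib_left[of 3])
  then show ?thesis
    by (simp add: comb_norm_def[of m D "Suc l"] comb_norm_def[of m D l \<theta> v] distrib_left sum.distrib R_def)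
qed

section \<open>Lipschitz and sup bounds by the path norm\<close>

lemma relu_lipschitz: "\<bar>relu a - relu b\<bar> \<le> \<bar>a - b\<bar>"
  by (auto simp: relu_def)

lemma relu_abs_le: "\<bar>relu a\<bar> \<le> \<bar>a\<bar>"
  by (auto simp: relu_def)

lemma sum_mult_le_bound:
  fixes M :: real
  assumes "finite I" "\<And>i. i \<in> I \<Longrightarrow> \<bar>g i\<bar> \<le> M * p i" "\<And>i. i \<in> I \<Longrightarrow> 0 \<le> p i" "0 \<le> M"
  shows "\<bar>\<Sum>i\<in>I. c i * g i\<bar> \<le> M * (\<Sum>i\<in>I. \<bar>c i\<bar> * p i)"
proof -
  have "\<bar>\<Sum>i\<in>I. c i * g i\<bar> \<le> (\<Sum>i\<in>I. \<bar>c i\<bar> * (M * p i))"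
    using assms by (intro order.trans[OF sum_abs] sum_mono) (auto simp: abs_mult intro!: mult_left_mono)
  then show ?thesis by (simp add: sum_distrib_left mult.left_commute)
qed

lemma rn_comb_lipschitz:
  fixes x y :: "real^'d::finite"
  assumes M: "\<And>i. \<bar>x $ i - y $ i\<bar> \<le> M"
  shows "\<bar>rn_comb m D l \<theta> v x - rn_comb m D l \<theta> v y\<bar> \<le> M * comb_norm m D l \<theta> v"
proof (induction l arbitrary: v)
  case 0
  have M0: "0 \<le> M" using M[of undefined] by linarith
  have "rn_comb m D 0 \<theta> v x - rn_comb m D 0 \<theta> v y
      = (\<Sum>j<D. v j * (\<Sum>i\<in>UNIV. pV \<theta> j i * (x $ i - y $ i)))"
    by (simp add: rn_comb_def sum_subtractf right_diff_distrib)
  also have "\<bar>\<dots>\<bar> \<le> M * (\<Sum>j<D. \<bar>v j\<bar> * (\<Sum>i\<in>UNIV. \<bar>pV \<theta> j i\<bar> * 1))"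
    using M M0 by (intro sum_mult_le_bound) (auto intro!: sum_nonneg)
  also have "(\<Sum>j<D. \<bar>v j\<bar> * (\<Sum>i\<in>UNIV. \<bar>pV \<theta> j i\<bar> * 1)) = comb_norm m D 0 \<theta> v"
    by (simp add: comb_norm_def sum_distrib_left) (rule sum.swap)
  finally show ?case .
next
  case (Suc l)
  have M0: "0 \<le> M" using M[of undefined] by linarith
  let ?c = "\<lambda>k. \<Sum>j<D. v j * pU \<theta> (Suc l) j k"
  let ?r = "\<lambda>k x. relu (rn_comb m D l \<theta> (pW \<theta> (Suc l) k) x)"
  have "rn_comb m D (Suc l) \<theta> v x - rn_comb m D (Suc l) \<theta> v y
      = (rn_comb m D l \<theta> v x - rn_comb m D l \<theta> v y) + (\<Sum>k<m. ?c k * (?r k x - ?r k y))"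
    by (simp add: rn_comb_Suc sum_subtractf right_diff_distrib)
  moreover have "\<bar>\<Sum>k<m. ?c k * (?r k x - ?r k y)\<bar>
      \<le> M * (\<Sum>k<m. \<bar>?c k\<bar> * comb_norm m D l \<theta> (pW \<theta> (Suc l) k))"
    using M0 by (intro sum_mult_le_bound order.trans[OF relu_lipschitz Suc] comb_norm_nonneg) auto
  ultimately have "\<bar>rn_comb m D (Suc l) \<theta> v x - rn_comb m D (Suc l) \<theta> v y\<bar>
      \<le> M * (comb_norm m D l \<theta> v + (\<Sum>k<m. \<bar>?c k\<bar> * comb_norm m D l \<theta> (pW \<theta> (Suc l) k)))"
    using Suc[of v] by (simp add: distrib_left)
  also have "\<dots> \<le> M * comb_norm m D (Suc l) \<theta> v"
  proof (intro mult_left_mono M0)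
    have "0 \<le> (\<Sum>k<m. \<bar>?c k\<bar> * comb_norm m D l \<theta> (pW \<theta> (Suc l) k))"
      by (intro sum_nonneg mult_nonneg_nonneg comb_norm_nonneg) auto
    then show "comb_norm m D l \<theta> v + (\<Sum>k<m. \<bar>?c k\<bar> * comb_norm m D l \<theta> (pW \<theta> (Suc l) k))
      \<le> comb_norm m D (Suc l) \<theta> v"
      using comb_norm_Suc_ge[of m D l \<theta> v] by linarith
  qed
  finally show ?case .
qed

lemma rn_comb_zero [simp]: "rn_comb m D l \<theta> v 0 = 0"
  by (induction l arbitrary: v) (simp_all add: rn_comb_Suc relu_def, simp add: rn_comb_def)

text \<open>Without biases the network vanishes at \<open>0\<close>, so the Lipschitz bound against
  the point \<open>0\<close> is a sup bound.\<close>

lemma rn_comb_bound: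
  fixes x :: "real^'d::finite"
  assumes "\<And>i. \<bar>x $ i\<bar> \<le> 1"
  shows "\<bar>rn_comb m D l \<theta> v x\<bar> \<le> comb_norm m D l \<theta> v"
  using rn_comb_lipschitz[of x 0 1 m D l \<theta> v] assms by simp

lemma resnet_lipschitz:
  fixes x y :: "real^'d::finite"
  assumes "\<And>i. \<bar>x $ i - y $ i\<bar> \<le> M"
  shows "\<bar>resnet m D L \<theta> x - resnet m D L \<theta> y\<bar> \<le> M * path_norm m D L \<theta>"
  unfolding resnet_eq_rn_comb path_norm_eq_comb_norm using assms by (rule rn_comb_lipschitz)

lemma resnet_bound:
  fixes x :: "real^'d::finite"
  assumes "\<And>i. \<bar>x $ i\<bar> \<le> 1"
  shows "\<bar>resnet m D L \<theta> x\<bar> \<le> path_norm m D L \<theta>"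
  unfolding resnet_eq_rn_comb path_norm_eq_comb_norm using assms by (rule rn_comb_bound)

lemma resnet_zero [simp]: "resnet m D L \<theta> 0 = 0"
  by (simp add: resnet_eq_rn_comb)

text \<open>Duality of the 1-norm and the maximum norm: linear functions with coefficients of 1-norm
  at most \<open>Q\<close> do no better than \<open>Q\<close> times one signed coordinate. The
  exponential of that maximum is bounded by the sum over all \<open>2 * CARD('d)\<close> signed
  coordinates.\<close>

lemma rade_rn_comb_0:
  fixes x :: "nat \<Rightarrow> real^'d::finite"
  assumes x: "\<And>i q. i < n \<Longrightarrow> \<bar>x i $ q\<bar> \<le> 1" and "0 \<le> Q" "0 \<le> \<tau>"
  shows "rmgf n {(\<theta>, v). comb_norm m D 0 \<theta> v \<le> Q} (\<lambda>(\<theta>, v) i. \<tau> * rn_comb m D 0 \<theta> v (x i))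
    \<le> ennreal (2 * real CARD('d) * exp (real n * (\<tau> * Q)\<^sup>2 / 2))"
proof -
  let ?H = "{(\<theta> :: 'd rnparam, v). comb_norm m D 0 \<theta> v \<le> Q}"
  let ?E = "\<lambda>s q \<epsilon>. ennreal (exp (\<Sum>i<n. \<epsilon> i * (s * (\<tau> * Q * x i $ q))))"
  have "rmgf n ?H (\<lambda>(\<theta>, v) i. \<tau> * rn_comb m D 0 \<theta> v (x i))
      \<le> rade n (\<lambda>\<epsilon>. \<Sum>q\<in>UNIV. ?E 1 q \<epsilon> + ?E (-1) q \<epsilon>)"
    unfolding rmgf_def
  proof (intro rade_mono SUP_least, clarsimp)
    fix \<epsilon> :: "nat \<Rightarrow> real" and \<theta> :: "'d rnparam" and v :: "nat \<Rightarrow> real"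
    assume Q: "comb_norm m D 0 \<theta> v \<le> Q"
    define w where "w q = (\<Sum>j<D. v j * pV \<theta> j q)" for q
    define G where "G q = (\<Sum>i<n. \<epsilon> i * x i $ q)" for q
    have w: "(\<Sum>q\<in>UNIV. \<bar>w q\<bar>) \<le> Q"
    proof -
      have "(\<Sum>q\<in>UNIV. \<bar>w q\<bar>) \<le> (\<Sum>q\<in>UNIV. \<Sum>j<D. \<bar>v j\<bar> * \<bar>pV \<theta> j q\<bar>)"
        unfolding w_def by (intro sum_mono order.trans[OF sum_abs]) (simp add: abs_mult)
      then show ?thesis using Q by (simp add: comb_norm_def)
    qed
    obtain p where p: "\<And>q. \<bar>G q\<bar> \<le> \<bar>G p\<bar>"
    proof -
      have "Max (range (\<lambda>q. \<bar>G q\<bar>)) \<in> range (\<lambda>q. \<bar>G q\<bar>)" by (intro Max_in) auto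
      then obtain p where "\<bar>G p\<bar> = Max (range (\<lambda>q. \<bar>G q\<bar>))" by (metis imageE)
      then show ?thesis by (intro that[of p]) simp
    qed
    have comb: "rn_comb m D 0 \<theta> v y = (\<Sum>q\<in>UNIV. w q * y $ q)" for y
      unfolding rn_comb_def w_def
      by (simp add: sum_distrib_left sum_distrib_right mult.assoc) (rule sum.swap)
    have "(\<Sum>i<n. \<epsilon> i * (\<tau> * rn_comb m D 0 \<theta> v (x i))) = \<tau> * (\<Sum>q\<in>UNIV. w q * G q)"
      unfolding comb G_def
      by (simp add: sum_distrib_left mult_ac) (rule sum.swap)
    also have "\<dots> \<le> \<tau> * (\<bar>G p\<bar> * Q)"
    proof (intro mult_left_mono \<open>0 \<le> \<tau>\<close>)
      have "\<bar>\<Sum>q\<in>UNIV. w q * G q\<bar> \<le> \<bar>G p\<bar> * (\<Sum>q\<in>UNIV. \<bar>w q\<bar> * 1)"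
        using p by (intro sum_mult_le_bound) auto
      also have "\<dots> \<le> \<bar>G p\<bar> * Q" using w by (intro mult_left_mono) auto
      finally show "(\<Sum>q\<in>UNIV. w q * G q) \<le> \<bar>G p\<bar> * Q" by simp
    qed
    also have "\<dots> = \<bar>\<tau> * Q * G p\<bar>" using assms by (simp add: abs_mult)
    finally have "exp (\<Sum>i<n. \<epsilon> i * (\<tau> * rn_comb m D 0 \<theta> v (x i)))
        \<le> exp (\<tau> * Q * G p) + exp (- (\<tau> * Q * G p))"
      by (smt (verit) exp_gt_zero exp_le_cancel_iff)
    also have "\<tau> * Q * G p = (\<Sum>i<n. \<epsilon> i * (1 * (\<tau> * Q * x i $ p)))"
      by (simp add: G_def sum_distrib_left mult_ac)
    also have "- (\<Sum>i<n. \<epsilon> i * (1 * (\<tau> * Q * x i $ p))) = (\<Sum>i<n. \<epsilon> i * ((-1) * (\<tau> * Q * x i $ p)))"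
      by (simp add: sum_negf)
    finally have "ennreal (exp (\<Sum>i<n. \<epsilon> i * (\<tau> * rn_comb m D 0 \<theta> v (x i)))) \<le> ?E 1 p \<epsilon> + ?E (-1) p \<epsilon>"
      by (simp only: ennreal_plus[symmetric] exp_ge_zero ennreal_leI)
    also have "\<dots> \<le> (\<Sum>q\<in>UNIV. ?E 1 q \<epsilon> + ?E (-1) q \<epsilon>)"
      by (rule member_le_sum) auto
    finally show "ennreal (exp (\<Sum>i<n. \<epsilon> i * (\<tau> * rn_comb m D 0 \<theta> v (x i))))
        \<le> (\<Sum>q\<in>UNIV. ennreal (exp (\<Sum>i<n. \<epsilon> i * (\<tau> * Q * x i $ q)))
          + ennreal (exp (\<Sum>i<n. - (\<epsilon> i * (\<tau> * Q * x i $ q)))))" by simp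
  qed
  also have "\<dots> = (\<Sum>q\<in>UNIV. rade n (?E 1 q) + rade n (?E (-1) q))"
    by (simp add: rade_sum rade_add)
  also have "\<dots> \<le> (\<Sum>q\<in>(UNIV :: 'd set). ennreal (exp (real n * (\<tau> * Q)\<^sup>2 / 2)) + ennreal (exp (real n * (\<tau> * Q)\<^sup>2 / 2)))"
  proof (intro sum_mono add_mono rade_exp_linear)
    fix q i assume "i < n"
    then have "\<bar>\<tau> * Q * x i $ q\<bar> \<le> \<tau> * Q"
      using x[of i q] assms by (simp add: abs_mult mult_left_le)
    then show "\<bar>1 * (\<tau> * Q * x i $ q)\<bar> \<le> \<tau> * Q" "\<bar>(-1) * (\<tau> * Q * x i $ q)\<bar> \<le> \<tau> * Q" by auto
  qed
  also have "\<dots> = ennreal (2 * real CARD('d) * exp (real n * (\<tau> * Q)\<^sup>2 / 2))"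
    by (simp add: ennreal_mult' ennreal_of_nat_eq_real_of_nat flip: ennreal_plus)
       (simp add: ennreal_mult'[symmetric] ennreal_mult''[symmetric] mult_ac)
  finally show ?thesis .
qed

text \<open>For fixed signs let \<open>B\<close> be the sum of the three suprema at layer
  \<open>l\<close> over the functions \<open>X\<close>, their rectified versions \<open>Y\<close>,
  and \<open>- Y\<close>. By homogeneity, every one of these functions has a signed sum of at most
  \<open>ln B / Q\<close> times its norm. A function of layer \<open>l + 1\<close> is a linear
  combination of such functions whose weighted norms add up to at most \<open>Q\<close>, so its
  exponential is at most \<open>B\<close>, whatever the width. Contraction and sign symmetry then
  reduce the three suprema to the first, whence the factor 3.\<close>

lemma rade_rn_comb_Suc:
  fixes x :: "nat \<Rightarrow> real^'d::finite"
  assumes x: "\<And>i q. i < n \<Longrightarrow> \<bar>x i $ q\<bar> \<le> 1" and Q: "0 < Q" and \<tau>: "0 \<le> \<tau>"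
  shows "rmgf n {(\<theta>, v). comb_norm m D (Suc l) \<theta> v \<le> Q} (\<lambda>(\<theta>, v) i. \<tau> * rn_comb m D (Suc l) \<theta> v (x i))
    \<le> 3 * rmgf n {(\<theta>, v). comb_norm m D l \<theta> v \<le> Q} (\<lambda>(\<theta>, v) i. \<tau> * rn_comb m D l \<theta> v (x i))"
proof -
  let ?H = "\<lambda>l. {(\<theta> :: 'd rnparam, v). comb_norm m D l \<theta> v \<le> Q}"
  have three: "3 * a = a + a + a" for a :: ennreal
  proof -
    have "(1 + 1 + 1) * a = a + a + a" by (simp only: distrib_right mult_1_left)
    then show ?thesis by simp
  qed
  define X where "X = (\<lambda>(\<theta> :: 'd rnparam, v) i. \<tau> * rn_comb m D l \<theta> v (x i))"
  define Y where "Y = (\<lambda>(\<theta> :: 'd rnparam, v) i. \<tau> * relu (rn_comb m D l \<theta> v (x i)))"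
  define Y' where "Y' = (\<lambda>h i. - Y h i)"
  define S where "S Z \<epsilon> = (SUP h\<in>?H l. ennreal (exp (\<Sum>i<n. \<epsilon> i * Z h i)))"
    for Z :: "'d rnparam \<times> (nat \<Rightarrow> real) \<Rightarrow> nat \<Rightarrow> real" and \<epsilon>
  have S_upper: "ennreal (exp (\<Sum>i<n. \<epsilon> i * Z h i)) \<le> S Z \<epsilon>" if "h \<in> ?H l" for Z h \<epsilon>
    unfolding S_def using that by (rule SUP_upper)
  have "rmgf n (?H (Suc l)) (\<lambda>(\<theta>, v) i. \<tau> * rn_comb m D (Suc l) \<theta> v (x i))
      \<le> rade n (\<lambda>\<epsilon>. S X \<epsilon> + S Y \<epsilon> + S Y' \<epsilon>)"
    unfolding rmgf_def
  proof (intro rade_mono SUP_least, clarify)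
    fix \<epsilon> :: "nat \<Rightarrow> real" and \<theta> :: "'d rnparam" and v :: "nat \<Rightarrow> real"
    assume v: "comb_norm m D (Suc l) \<theta> v \<le> Q"
    show "ennreal (exp (\<Sum>i<n. \<epsilon> i * (\<tau> * rn_comb m D (Suc l) \<theta> v (x i)))) \<le> S X \<epsilon> + S Y \<epsilon> + S Y' \<epsilon>"
    proof (cases "S X \<epsilon> + S Y \<epsilon> + S Y' \<epsilon> = \<top>")
      case False
      define B where "B = enn2real (S X \<epsilon> + S Y \<epsilon> + S Y' \<epsilon>)"
      have B: "S X \<epsilon> + S Y \<epsilon> + S Y' \<epsilon> = ennreal B"
        using False unfolding B_def by (metis ennreal_enn2real less_top)
      have B0: "0 \<le> B" by (simp add: B_def)
      have le: "exp (\<Sum>i<n. \<epsilon> i * Z h i) \<le> B" if "h \<in> ?H l" "Z = X \<or> Z = Y \<or> Z = Y'" for h Z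
      proof -
        have "S Z \<epsilon> \<le> S X \<epsilon> + S Y \<epsilon> + S Y' \<epsilon>"
          using that(2) add_mono[OF order.refl zero_le, of "S X \<epsilon>" "S Y \<epsilon> + S Y' \<epsilon>"]
            add_mono[OF zero_le order.refl, of "S Y \<epsilon>" "S X \<epsilon>"]
            add_mono[OF order.refl zero_le, of "S X \<epsilon> + S Y \<epsilon>" "S Y' \<epsilon>"]
            add_mono[OF zero_le order.refl, of "S Y' \<epsilon>" "S X \<epsilon> + S Y \<epsilon>"]
          by (auto simp: add.assoc intro: order.trans)
        with S_upper[OF that(1), of \<epsilon> Z] have "ennreal (exp (\<Sum>i<n. \<epsilon> i * Z h i)) \<le> ennreal B"
          unfolding B by (rule order.trans)
        then show ?thesis using B0 by (simp add: ennreal_le_iff)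
      qed
      \<comment> \<open>The zero output vector gives \<open>1 \<le> B\<close>; the estimates below
        multiply by \<open>ln B\<close> and need it nonnegative.\<close>
      have "(\<theta>, \<lambda>_. 0) \<in> ?H l" using Q by (simp add: comb_norm_def)
      from le[OF this, of X] have B1: "1 \<le> B" by (simp add: X_def rn_comb_def)
      have scaled: "(\<Sum>i<n. \<epsilon> i * Z (\<theta>, w) i) \<le> ln B / Q * comb_norm m D l \<theta> w"
        if Z: "Z = X \<or> Z = Y \<or> Z = Y'" for Z w
      proof (cases "comb_norm m D l \<theta> w = 0")
        \<comment> \<open>A function of norm \<open>0\<close> cannot be rescaled to norm
          \<open>Q\<close>, but it vanishes on the sample.\<close>
        case True
        then have "rn_comb m D l \<theta> w (x i) = 0" if "i < n" for i
          using rn_comb_bound[of "x i" m D l \<theta> w] x that by simp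
        then have "Z (\<theta>, w) i = 0" if "i < n" for i
          using that Z by (auto simp: X_def Y_def Y'_def relu_def)
        then show ?thesis using True by simp
      next
        case False
        define c where "c = Q / comb_norm m D l \<theta> w"
        have c: "c > 0" using Q False comb_norm_nonneg[of m D l \<theta> w] by (simp add: c_def)
        have mem: "(\<theta>, \<lambda>j. c * w j) \<in> ?H l"
          using c False by (simp add: comb_norm_scale) (simp add: c_def)
        have relu_c: "relu (c * t) = c * relu t" for t
          using c by (simp add: relu_def max_mult_distrib_left)
        have hom: "Z (\<theta>, \<lambda>j. c * w j) i = c * Z (\<theta>, w) i" for i
          using Z by (auto simp: X_def Y_def Y'_def rn_comb_scale relu_c)
        have "exp (c * (\<Sum>i<n. \<epsilon> i * Z (\<theta>, w) i)) \<le> B"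
          using le[OF mem Z] unfolding hom by (simp add: sum_distrib_left mult_ac)
        then have "c * (\<Sum>i<n. \<epsilon> i * Z (\<theta>, w) i) \<le> ln B"
          using B1 by (subst ln_ge_iff) auto
        then have "(\<Sum>i<n. \<epsilon> i * Z (\<theta>, w) i) \<le> ln B / c"
          using c by (simp add: pos_le_divide_eq mult.commute)
        then show ?thesis by (simp add: c_def)
      qed
      define c where "c k = (\<Sum>j<D. v j * pU \<theta> (Suc l) j k)" for k
      let ?g = "\<lambda>k. \<Sum>i<n. \<epsilon> i * Y (\<theta>, pW \<theta> (Suc l) k) i"
      have "(\<Sum>i<n. \<epsilon> i * (\<tau> * rn_comb m D (Suc l) \<theta> v (x i)))
          = (\<Sum>i<n. \<epsilon> i * X (\<theta>, v) i) + (\<Sum>i<n. \<Sum>k<m. c k * (\<epsilon> i * Y (\<theta>, pW \<theta> (Suc l) k) i))"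
        unfolding rn_comb_Suc c_def[symmetric] X_def Y_def
        by (simp add: distrib_left sum.distrib sum_distrib_left mult_ac)
      also have "(\<Sum>i<n. \<Sum>k<m. c k * (\<epsilon> i * Y (\<theta>, pW \<theta> (Suc l) k) i)) = (\<Sum>k<m. c k * ?g k)"
        by (subst sum.swap) (simp only: sum_distrib_left)
      also have "(\<Sum>k<m. c k * ?g k) \<le> ln B / Q * (\<Sum>k<m. \<bar>c k\<bar> * comb_norm m D l \<theta> (pW \<theta> (Suc l) k))"
      proof -
        \<comment> \<open>The coefficients \<open>c k\<close> may have either sign, so both
          \<open>Y\<close> and \<open>Y'\<close> have to be present in \<open>B\<close>.\<close>
        have "\<bar>?g k\<bar> \<le> ln B / Q * comb_norm m D l \<theta> (pW \<theta> (Suc l) k)" for k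
        proof -
          have "- ?g k = (\<Sum>i<n. \<epsilon> i * Y' (\<theta>, pW \<theta> (Suc l) k) i)"
            by (simp add: Y'_def sum_negf)
          then show ?thesis using scaled[of Y "pW \<theta> (Suc l) k"] scaled[of Y' "pW \<theta> (Suc l) k"] by auto
        qed
        then have "\<bar>\<Sum>k<m. c k * ?g k\<bar> \<le> ln B / Q * (\<Sum>k<m. \<bar>c k\<bar> * comb_norm m D l \<theta> (pW \<theta> (Suc l) k))"
          using B1 Q by (intro sum_mult_le_bound comb_norm_nonneg) auto
        then show ?thesis by linarith
      qed
      also have "(\<Sum>i<n. \<epsilon> i * X (\<theta>, v) i) \<le> ln B / Q * comb_norm m D l \<theta> v"
        using scaled[of X v] by auto
      also have "ln B / Q * comb_norm m D l \<theta> v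
          + ln B / Q * (\<Sum>k<m. \<bar>c k\<bar> * comb_norm m D l \<theta> (pW \<theta> (Suc l) k)) \<le> ln B / Q * Q"
        unfolding distrib_left[symmetric]
      proof (intro mult_left_mono)
        have "0 \<le> (\<Sum>k<m. \<bar>c k\<bar> * comb_norm m D l \<theta> (pW \<theta> (Suc l) k))"
          by (intro sum_nonneg mult_nonneg_nonneg comb_norm_nonneg) auto
        then show "comb_norm m D l \<theta> v + (\<Sum>k<m. \<bar>c k\<bar> * comb_norm m D l \<theta> (pW \<theta> (Suc l) k)) \<le> Q"
          using comb_norm_Suc_ge[of m D l \<theta> v] v unfolding c_def by linarith
      qed (use B1 Q in auto)
      finally have "(\<Sum>i<n. \<epsilon> i * (\<tau> * rn_comb m D (Suc l) \<theta> v (x i))) \<le> ln B"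
        using Q by simp
      then have "exp (\<Sum>i<n. \<epsilon> i * (\<tau> * rn_comb m D (Suc l) \<theta> v (x i))) \<le> B"
        using B1 by (subst (asm) ln_ge_iff) auto
      then show ?thesis unfolding B by (rule ennreal_leI)
    next
      case True
      show ?thesis unfolding True by simp
    qed
  qed
  also have "\<dots> = rmgf n (?H l) X + rmgf n (?H l) Y + rmgf n (?H l) Y'"
    by (simp add: rade_add S_def rmgf_def)
  also have "rmgf n (?H l) Y' = rmgf n (?H l) Y"
    unfolding Y'_def by (rule rmgf_minus)
  also have "rmgf n (?H l) Y \<le> rmgf n (?H l) X"
    using \<tau> by (intro rmgf_contraction)
      (auto simp: X_def Y_def abs_mult relu_abs_le relu_lipschitz right_diff_distrib[symmetric]
        intro!: mult_left_mono)
  finally show ?thesis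
    unfolding X_def by (simp add: three add_mono)
qed

lemma rmgf_resnet:
  fixes x :: "nat \<Rightarrow> real^'d::finite"
  assumes x: "\<And>i q. i < n \<Longrightarrow> \<bar>x i $ q\<bar> \<le> 1" and Q: "0 < Q" and \<tau>: "0 \<le> \<tau>"
  shows "rmgf n {\<theta>. path_norm m D L \<theta> \<le> Q} (\<lambda>\<theta> i. \<tau> * resnet m D L \<theta> (x i))
    \<le> ennreal (3 ^ L * (2 * real CARD('d)) * exp (real n * (\<tau> * Q)\<^sup>2 / 2))"
proof -
  have "rmgf n {\<theta>. path_norm m D L \<theta> \<le> Q} (\<lambda>\<theta> i. \<tau> * resnet m D L \<theta> (x i))
      \<le> rmgf n {(\<theta>, v). comb_norm m D L \<theta> v \<le> Q} (\<lambda>(\<theta>, v) i. \<tau> * rn_comb m D L \<theta> v (x i))"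
    by (rule rmgf_image_le[where f = "\<lambda>\<theta>. (\<theta>, pu \<theta>)"])
       (auto simp: path_norm_eq_comb_norm resnet_eq_rn_comb)
  also have "\<dots> \<le> ennreal (3 ^ L * (2 * real CARD('d)) * exp (real n * (\<tau> * Q)\<^sup>2 / 2))"
  proof (induction L)
    case 0
    show ?case using rade_rn_comb_0[OF x] Q \<tau> by simp
  next
    case (Suc L)
    have "3 * ennreal (3 ^ L * (2 * real CARD('d)) * exp (real n * (\<tau> * Q)\<^sup>2 / 2))
        = ennreal (3 * (3 ^ L * (2 * real CARD('d)) * exp (real n * (\<tau> * Q)\<^sup>2 / 2)))"
      by (subst ennreal_mult) auto
    with order.trans[OF rade_rn_comb_Suc[OF x Q \<tau>] mult_left_mono[OF Suc, of 3]] show ?case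
      by (simp add: mult.assoc)
  qed
  finally show ?thesis .
qed

section \<open>Symmetrization and a uniform tail bound\<close>

lemma borel_measurable_rade:
  "(\<And>\<epsilon>. F \<epsilon> \<in> borel_measurable M) \<Longrightarrow> (\<lambda>z. rade n (\<lambda>\<epsilon>. F \<epsilon> z)) \<in> borel_measurable M"
  by (induction n arbitrary: F) auto

lemma nn_integral_rade:
  assumes "\<And>\<epsilon>. F \<epsilon> \<in> borel_measurable M"
  shows "(\<integral>\<^sup>+z. rade n (\<lambda>\<epsilon>. F \<epsilon> z) \<partial>M) = rade n (\<lambda>\<epsilon>. \<integral>\<^sup>+z. F \<epsilon> z \<partial>M)"
  using assms
proof (induction n arbitrary: F)
  case (Suc n)
  have meas: "(\<lambda>z. rade n (\<lambda>\<epsilon>. F (\<epsilon>(n := x)) z)) \<in> borel_measurable M" for x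
    using Suc.prems by (intro borel_measurable_rade)
  show ?case
    unfolding rade.simps
    by (subst nn_integral_cmult, intro borel_measurable_add meas, subst nn_integral_add[OF meas meas])
      (simp only: Suc.IH[OF Suc.prems])
qed simp

context prob_space
begin

text \<open>Jensen's inequality, obtained by integrating the tangent of \<open>exp\<close> at the
  expectation.\<close>

lemma exp_expectation_le:
  assumes X: "X \<in> borel_measurable M" "\<And>z. z \<in> space M \<Longrightarrow> \<bar>X z\<bar> \<le> B"
  shows "ennreal (exp (expectation X)) \<le> (\<integral>\<^sup>+z. ennreal (exp (X z)) \<partial>M)"
proof -
  have int: "integrable M X"
    using X by (intro integrable_const_bound[of _ B]) auto
  have "integrable M (\<lambda>z. exp (X z))"
    using X by (intro integrable_const_bound[of _ "exp B"]) (auto simp: abs_le_iff)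
  moreover have "exp (expectation X) * (1 + (x - expectation X)) \<le> exp x" for x
  proof -
    have "exp (expectation X) * (1 + (x - expectation X)) \<le> exp (expectation X) * exp (x - expectation X)"
      by (intro mult_left_mono exp_ge_add_one_self) auto
    then show ?thesis by (simp add: exp_add[symmetric])
  qed
  ultimately have "expectation (\<lambda>z. exp (expectation X) * (1 + (X z - expectation X))) \<le> expectation (\<lambda>z. exp (X z))"
    using int by (intro integral_mono) auto
  then have "exp (expectation X) \<le> expectation (\<lambda>z. exp (X z))"
    using int by (simp add: prob_space)
  then show ?thesis
    using \<open>integrable M (\<lambda>z. exp (X z))\<close> by (subst nn_integral_eq_integral) (auto intro: ennreal_leI)
qed

text \<open>Introducing an independent copy \<open>z'\<close> and separating it again are done at
  once: \<open>l h z' - l h z\<close> is the midpoint of \<open>2 * l h z'\<close> and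
  \<open>- 2 * l h z\<close>, so convexity of \<open>exp\<close> splits the exponential into a
  function of \<open>z'\<close> and a function of \<open>z\<close>. As both have the same
  distribution, the two halves are the two values of a random sign. The factor 2 on \<open>l\<close>
  originates here.\<close>

lemma symmetrization_step:
  fixes l :: "'h \<Rightarrow> 'a \<Rightarrow> real"
  assumes H: "countable H" and meas: "\<And>h. h \<in> H \<Longrightarrow> l h \<in> borel_measurable M"
    and bd: "\<And>h z. h \<in> H \<Longrightarrow> z \<in> space M \<Longrightarrow> \<bar>l h z\<bar> \<le> B"
  shows "(\<integral>\<^sup>+z. (SUP h\<in>H. ennreal (exp (c h + (expectation (l h) - l h z)))) \<partial>M)
    \<le> (\<integral>\<^sup>+z. ennreal (1/2) * ((SUP h\<in>H. ennreal (exp (c h + 2 * l h z))) + (SUP h\<in>H. ennreal (exp (c h - 2 * l h z)))) \<partial>M)"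
proof -
  let ?P = "\<lambda>z. SUP h\<in>H. ennreal (exp (c h + 2 * l h z))"
  let ?N = "\<lambda>z. SUP h\<in>H. ennreal (exp (c h - 2 * l h z))"
  have [measurable]: "?P \<in> borel_measurable M" "?N \<in> borel_measurable M"
    using H meas by (auto intro!: borel_measurable_SUP)
  have "(\<integral>\<^sup>+z. (SUP h\<in>H. ennreal (exp (c h + (expectation (l h) - l h z)))) \<partial>M)
      \<le> (\<integral>\<^sup>+z. (\<integral>\<^sup>+z'. ennreal (1/2) * ?P z' + ennreal (1/2) * ?N z \<partial>M) \<partial>M)"
  proof (intro nn_integral_mono SUP_least)
    fix z h assume z: "z \<in> space M" and h: "h \<in> H"
    have int: "integrable M (l h)"
      using meas[OF h] bd[OF h] by (intro integrable_const_bound[of _ B]) auto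
    have "ennreal (exp (c h + (expectation (l h) - l h z)))
        = ennreal (exp (expectation (\<lambda>z'. c h + (l h z' - l h z))))"
      using int by (simp add: prob_space)
    also have "\<dots> \<le> (\<integral>\<^sup>+z'. ennreal (exp (c h + (l h z' - l h z))) \<partial>M)"
    proof (rule exp_expectation_le)
      show "\<bar>c h + (l h z' - l h z)\<bar> \<le> \<bar>c h\<bar> + 2 * B" if "z' \<in> space M" for z'
        using bd[OF h that] bd[OF h z] by linarith
    qed (use meas[OF h] in auto)
    also have "\<dots> \<le> (\<integral>\<^sup>+z'. ennreal (1/2) * ?P z' + ennreal (1/2) * ?N z \<partial>M)"
    proof (intro nn_integral_mono)
      fix z' assume "z' \<in> space M"
      have "c h + (l h z' - l h z) = (1 - 1/2) * (c h + 2 * l h z') + 1/2 * (c h - 2 * l h z)"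
        by (simp add: field_simps)
      also have "exp \<dots> \<le> (1 - 1/2) * exp (c h + 2 * l h z') + 1/2 * exp (c h - 2 * l h z)"
        using convex_onD[OF exp_convex, of "1/2" "c h + 2 * l h z'" "c h - 2 * l h z"] by simp
      finally have "ennreal (exp (c h + (l h z' - l h z)))
          \<le> ennreal (1/2 * exp (c h + 2 * l h z') + 1/2 * exp (c h - 2 * l h z))"
        by (intro ennreal_leI) simp
      also have "\<dots> = ennreal (1/2) * ennreal (exp (c h + 2 * l h z')) + ennreal (1/2) * ennreal (exp (c h - 2 * l h z))"
        by (subst ennreal_plus) (auto simp only: ennreal_mult'' exp_ge_zero, auto)
      also have "\<dots> \<le> ennreal (1/2) * ?P z' + ennreal (1/2) * ?N z"
        using h by (intro add_mono mult_left_mono SUP_upper) auto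
      finally show "ennreal (exp (c h + (l h z' - l h z))) \<le> ennreal (1/2) * ?P z' + ennreal (1/2) * ?N z" .
    qed
    finally show "ennreal (exp (c h + (expectation (l h) - l h z)))
      \<le> (\<integral>\<^sup>+z'. ennreal (1/2) * ?P z' + ennreal (1/2) * ?N z \<partial>M)" .
  qed
  also have "\<dots> = ennreal (1/2) * (\<integral>\<^sup>+z. ?P z \<partial>M) + ennreal (1/2) * (\<integral>\<^sup>+z. ?N z \<partial>M)"
    by (simp add: nn_integral_add nn_integral_cmult emeasure_space_1)
  also have "\<dots> = (\<integral>\<^sup>+z. ennreal (1/2) * (?P z + ?N z) \<partial>M)"
    by (simp add: nn_integral_add nn_integral_cmult distrib_left)
  finally show ?thesis .
qed

text \<open>Sample points are exchanged for signs one at a time. While the last point is fixed, its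
  centred loss joins the offset \<open>c\<close> and induction treats the others; then the others
  and their signs are fixed and \<open>symmetrization_step\<close> treats the last point. The free
  offset is what makes both moves possible.\<close>

lemma symmetrization:
  fixes l :: "'h \<Rightarrow> 'a \<Rightarrow> real"
  assumes H: "countable H" and meas: "\<And>h. h \<in> H \<Longrightarrow> l h \<in> borel_measurable M"
    and bd: "\<And>h z. h \<in> H \<Longrightarrow> z \<in> space M \<Longrightarrow> \<bar>l h z\<bar> \<le> B"
  shows "(\<integral>\<^sup>+Z. (SUP h\<in>H. ennreal (exp (c h + (\<Sum>i<n. expectation (l h) - l h (Z i))))) \<partial>PiM {..<n} (\<lambda>_. M))
    \<le> (\<integral>\<^sup>+Z. rade n (\<lambda>\<epsilon>. SUP h\<in>H. ennreal (exp (c h + (\<Sum>i<n. \<epsilon> i * (2 * l h (Z i)))))) \<partial>PiM {..<n} (\<lambda>_. M))"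
proof (induction n arbitrary: c)
  case (Suc n)
  interpret product_sigma_finite "\<lambda>_. M" by standard
  let ?I = "insert n {..<n}"
  have comp: "(\<lambda>Z. l h (Z i)) \<in> borel_measurable (PiM J (\<lambda>_. M))" if "h \<in> H" "i \<in> J" for h i J
    using measurable_compose[OF measurable_component_singleton[OF that(2)] meas[OF that(1)]] .
  define F where "F c Z = (SUP h\<in>H. ennreal (exp (c h + (\<Sum>i<Suc n. expectation (l h) - l h (Z i)))))" for c Z
  define G where "G x \<epsilon> Z = (SUP h\<in>H. ennreal (exp (c h + x h (Z n) + (\<Sum>i<n. \<epsilon> i * (2 * l h (Z i))))))" for x \<epsilon> Z
  let ?E = "\<lambda>h y. expectation (l h) - l h y"
  have F: "F c \<in> borel_measurable (PiM ?I (\<lambda>_. M))" for c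
    unfolding F_def using H by (intro borel_measurable_SUP) (auto intro!: borel_measurable_sum borel_measurable_diff comp
      borel_measurable_add measurable_compose[OF _ borel_measurable_exp] simp del: sum.lessThan_Suc)
  have G: "G x \<epsilon> \<in> borel_measurable (PiM ?I (\<lambda>_. M))" if x: "\<And>h. h \<in> H \<Longrightarrow> x h \<in> borel_measurable M" for x \<epsilon>
  proof -
    have "(\<lambda>Z. x h (Z n)) \<in> borel_measurable (PiM ?I (\<lambda>_. M))" if "h \<in> H" for h
      using measurable_compose[OF measurable_component_singleton[of n] x[OF that]] by simp
    then show ?thesis
      unfolding G_def using H by (intro borel_measurable_SUP) (auto intro!: borel_measurable_sum comp
        borel_measurable_add borel_measurable_times measurable_compose[OF _ borel_measurable_exp])
  qed
  have GE: "G ?E \<epsilon> \<in> borel_measurable (PiM ?I (\<lambda>_. M))" for \<epsilon> by (intro G) (use meas in auto)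
  have GP: "G (\<lambda>h y. 2 * l h y) \<epsilon> \<in> borel_measurable (PiM ?I (\<lambda>_. M))" for \<epsilon> by (intro G) (use meas in auto)
  have GN: "G (\<lambda>h y. - (2 * l h y)) \<epsilon> \<in> borel_measurable (PiM ?I (\<lambda>_. M))" for \<epsilon> by (intro G) (use meas in auto)
  have sec: "(\<lambda>y. f (Z(n := y))) \<in> borel_measurable M"
    if "f \<in> borel_measurable (PiM ?I (\<lambda>_. M))" "Z \<in> space (PiM {..<n} (\<lambda>_. M))" for f :: "_ \<Rightarrow> ennreal" and Z
    using measurable_compose[OF measurable_component_update[of Z "{..<n}" "\<lambda>_. M" n] that(1)] that(2) by simp
  have "(\<integral>\<^sup>+Z. F c Z \<partial>PiM ?I (\<lambda>_. M)) = (\<integral>\<^sup>+y. (\<integral>\<^sup>+Z. F c (Z(n := y)) \<partial>PiM {..<n} (\<lambda>_. M)) \<partial>M)"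
    using F by (intro product_nn_integral_insert_rev) auto
  also have "\<dots> = (\<integral>\<^sup>+y. (\<integral>\<^sup>+Z. (SUP h\<in>H. ennreal (exp ((c h + ?E h y) + (\<Sum>i<n. expectation (l h) - l h (Z i))))) \<partial>PiM {..<n} (\<lambda>_. M)) \<partial>M)"
    unfolding F_def by (intro nn_integral_cong SUP_cong refl) (simp add: algebra_simps)
  also have "\<dots> \<le> (\<integral>\<^sup>+y. (\<integral>\<^sup>+Z. rade n (\<lambda>\<epsilon>. G ?E \<epsilon> (Z(n := y))) \<partial>PiM {..<n} (\<lambda>_. M)) \<partial>M)"
  proof (rule nn_integral_mono)
    fix y
    have "(\<Sum>i<n. \<epsilon> i * (2 * l h ((Z(n := y)) i))) = (\<Sum>i<n. \<epsilon> i * (2 * l h (Z i)))" for h Z and \<epsilon> :: "nat \<Rightarrow> real"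
      by (intro sum.cong) auto
    then show "(\<integral>\<^sup>+Z. (SUP h\<in>H. ennreal (exp ((c h + ?E h y) + (\<Sum>i<n. expectation (l h) - l h (Z i))))) \<partial>PiM {..<n} (\<lambda>_. M))
      \<le> (\<integral>\<^sup>+Z. rade n (\<lambda>\<epsilon>. G ?E \<epsilon> (Z(n := y))) \<partial>PiM {..<n} (\<lambda>_. M))"
      using Suc[of "\<lambda>h. c h + ?E h y"] by (simp add: G_def)
  qed
  also have "\<dots> = (\<integral>\<^sup>+Z. rade n (\<lambda>\<epsilon>. G ?E \<epsilon> Z) \<partial>PiM ?I (\<lambda>_. M))"
    using GE by (intro product_nn_integral_insert_rev[symmetric] borel_measurable_rade) auto
  also have "\<dots> = (\<integral>\<^sup>+Z. (\<integral>\<^sup>+y. rade n (\<lambda>\<epsilon>. G ?E \<epsilon> (Z(n := y))) \<partial>M) \<partial>PiM {..<n} (\<lambda>_. M))"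
    using GE by (intro product_nn_integral_insert borel_measurable_rade) auto
  also have "\<dots> = (\<integral>\<^sup>+Z. rade n (\<lambda>\<epsilon>. \<integral>\<^sup>+y. G ?E \<epsilon> (Z(n := y)) \<partial>M) \<partial>PiM {..<n} (\<lambda>_. M))"
    by (intro nn_integral_cong nn_integral_rade sec GE)
  also have "\<dots> \<le> (\<integral>\<^sup>+Z. rade n (\<lambda>\<epsilon>. \<integral>\<^sup>+y. ennreal (1/2) * (G (\<lambda>h y. 2 * l h y) \<epsilon> (Z(n := y)) + G (\<lambda>h y. - (2 * l h y)) \<epsilon> (Z(n := y))) \<partial>M) \<partial>PiM {..<n} (\<lambda>_. M))"
  proof (rule nn_integral_mono, rule rade_mono)
    fix Z and \<epsilon> :: "nat \<Rightarrow> real"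
    have "(\<Sum>i<n. \<epsilon> i * (2 * l h ((Z(n := y)) i))) = (\<Sum>i<n. \<epsilon> i * (2 * l h (Z i)))" for h y
      by (intro sum.cong) auto
    then show "(\<integral>\<^sup>+y. G ?E \<epsilon> (Z(n := y)) \<partial>M)
      \<le> (\<integral>\<^sup>+y. ennreal (1/2) * (G (\<lambda>h y. 2 * l h y) \<epsilon> (Z(n := y)) + G (\<lambda>h y. - (2 * l h y)) \<epsilon> (Z(n := y))) \<partial>M)"
      using symmetrization_step[OF H meas bd, where c = "\<lambda>h. c h + (\<Sum>i<n. \<epsilon> i * (2 * l h (Z i)))"]
      by (simp add: G_def algebra_simps)
  qed
  also have "\<dots> = (\<integral>\<^sup>+Z. (\<integral>\<^sup>+y. rade n (\<lambda>\<epsilon>. ennreal (1/2) * (G (\<lambda>h y. 2 * l h y) \<epsilon> (Z(n := y)) + G (\<lambda>h y. - (2 * l h y)) \<epsilon> (Z(n := y)))) \<partial>M) \<partial>PiM {..<n} (\<lambda>_. M))"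
    using sec[OF GP] sec[OF GN] by (intro nn_integral_cong nn_integral_rade[symmetric]) auto
  also have "\<dots> = (\<integral>\<^sup>+Z. rade n (\<lambda>\<epsilon>. ennreal (1/2) * (G (\<lambda>h y. 2 * l h y) \<epsilon> Z + G (\<lambda>h y. - (2 * l h y)) \<epsilon> Z)) \<partial>PiM ?I (\<lambda>_. M))"
    using GP GN by (intro product_nn_integral_insert[symmetric] borel_measurable_rade) auto
  also have "\<dots> = (\<integral>\<^sup>+Z. rade (Suc n) (\<lambda>\<epsilon>. SUP h\<in>H. ennreal (exp (c h + (\<Sum>i<Suc n. \<epsilon> i * (2 * l h (Z i)))))) \<partial>PiM ?I (\<lambda>_. M))"
    unfolding rade.simps rade_cmult rade_add sum_upd_sign G_def by (simp add: algebra_simps)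
  finally show ?case unfolding F_def lessThan_Suc .
qed simp

lemma deviation_event_sets:
  fixes l :: "'h \<Rightarrow> 'a \<Rightarrow> real"
  assumes H: "countable H" and meas: "\<And>h. h \<in> H \<Longrightarrow> l h \<in> borel_measurable M"
  shows "{Z \<in> space (PiM {..<n} (\<lambda>_. M)). \<exists>h\<in>H. t \<le> (\<Sum>i<n. expectation (l h) - l h (Z i))}
    \<in> sets (PiM {..<n} (\<lambda>_. M))"
proof (rule sets.sets_Collect_countable_Ex'[OF _ H])
  fix h assume h: "h \<in> H"
  have "(\<lambda>Z. l h (Z i)) \<in> borel_measurable (PiM {..<n} (\<lambda>_. M))" if "i < n" for i
    using measurable_compose[OF measurable_component_singleton[of i] meas[OF h]] that by simp
  then have "(\<lambda>Z. \<Sum>i<n. expectation (l h) - l h (Z i)) \<in> borel_measurable (PiM {..<n} (\<lambda>_. M))"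
    by (intro borel_measurable_sum borel_measurable_diff) auto
  then show "{Z \<in> space (PiM {..<n} (\<lambda>_. M)). t \<le> (\<Sum>i<n. expectation (l h) - l h (Z i))}
    \<in> sets (PiM {..<n} (\<lambda>_. M))"
    by measurable
qed

lemma uniform_deviation_tail:
  fixes l :: "'h \<Rightarrow> 'a \<Rightarrow> real"
  assumes H: "countable H" and meas: "\<And>h. h \<in> H \<Longrightarrow> l h \<in> borel_measurable M"
    and bd: "\<And>h z. h \<in> H \<Longrightarrow> z \<in> space M \<Longrightarrow> \<bar>l h z\<bar> \<le> B"
    and rmgf: "\<And>Z s. Z \<in> space (PiM {..<n} (\<lambda>_. M)) \<Longrightarrow> 0 < s \<Longrightarrow>
       rmgf n H (\<lambda>h i. 2 * s * l h (Z i)) \<le> ennreal (K * exp (real n * (s * c)\<^sup>2 / 2))"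
    and K: "0 \<le> K" and c: "0 < c" and t: "0 < t"
  shows "emeasure (PiM {..<n} (\<lambda>_. M)) {Z \<in> space (PiM {..<n} (\<lambda>_. M)). \<exists>h\<in>H. real n * t \<le> (\<Sum>i<n. expectation (l h) - l h (Z i))}
    \<le> ennreal (K * exp (- (real n * t\<^sup>2 / (2 * c\<^sup>2))))"
proof -
  let ?P = "PiM {..<n} (\<lambda>_. M)"
  interpret P: prob_space ?P by (intro prob_space_PiM) unfold_locales
  \<comment> \<open>The minimizer of \<open>- s * t + (s * c)\<^sup>2 / 2\<close>, that is, the best
    exponent in the Chernoff bound.\<close>
  define s where "s = t / c\<^sup>2"
  have s: "0 < s" using c t by (simp add: s_def)
  define F where "F Z = (SUP h\<in>H. ennreal (exp (\<Sum>i<n. s * expectation (l h) - s * l h (Z i))))" for Z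
  have comp: "(\<lambda>Z. l h (Z i)) \<in> borel_measurable ?P" if "h \<in> H" "i < n" for h i
    using measurable_compose[OF measurable_component_singleton[of i] meas[OF that(1)]] that(2) by simp
  have F: "F \<in> borel_measurable ?P"
    unfolding F_def using H by (intro borel_measurable_SUP) (auto intro!: borel_measurable_sum borel_measurable_diff comp
      borel_measurable_times measurable_compose[OF _ borel_measurable_exp])
  have "(\<integral>\<^sup>+Z. F Z \<partial>?P) \<le> (\<integral>\<^sup>+Z. rmgf n H (\<lambda>h i. 2 * s * l h (Z i)) \<partial>?P)"
    using symmetrization[OF H, where l = "\<lambda>h z. s * l h z" and B = "s * B" and c = "\<lambda>_. 0" and n = n] meas bd s
    by (simp add: F_def rmgf_def abs_mult mult.assoc mult.left_commute[of s 2])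
  also have "\<dots> \<le> (\<integral>\<^sup>+Z. ennreal (K * exp (real n * (s * c)\<^sup>2 / 2)) \<partial>?P)"
    by (intro nn_integral_mono rmgf s)
  also have "\<dots> = ennreal (K * exp (real n * (s * c)\<^sup>2 / 2))"
    by (simp add: P.emeasure_space_1)
  finally have int: "(\<integral>\<^sup>+Z. F Z \<partial>?P) \<le> ennreal (K * exp (real n * (s * c)\<^sup>2 / 2))" .
  let ?u = "ennreal (exp (- (s * (real n * t))))"
  have "emeasure ?P {Z \<in> space ?P. \<exists>h\<in>H. real n * t \<le> (\<Sum>i<n. expectation (l h) - l h (Z i))}
      \<le> emeasure ?P ({Z \<in> space ?P. 1 \<le> ?u * F Z})"
  proof (intro emeasure_mono subsetI)
    fix Z assume "Z \<in> {Z \<in> space ?P. \<exists>h\<in>H. real n * t \<le> (\<Sum>i<n. expectation (l h) - l h (Z i))}"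
    then obtain h where Z: "Z \<in> space ?P" and h: "h \<in> H" and le: "real n * t \<le> (\<Sum>i<n. expectation (l h) - l h (Z i))"
      by auto
    have "s * (real n * t) \<le> s * (\<Sum>i<n. expectation (l h) - l h (Z i))"
      using le s by (intro mult_left_mono) auto
    also have "\<dots> = (\<Sum>i<n. s * expectation (l h) - s * l h (Z i))"
      by (simp add: sum_distrib_left right_diff_distrib)
    finally have "1 \<le> exp (- (s * (real n * t))) * exp (\<Sum>i<n. s * expectation (l h) - s * l h (Z i))"
      by (simp add: exp_add[symmetric])
    then have "1 \<le> ?u * ennreal (exp (\<Sum>i<n. s * expectation (l h) - s * l h (Z i)))"
      by (simp add: ennreal_mult''[symmetric] ennreal_1[symmetric] ennreal_le_iff del: ennreal_1)
    also have "\<dots> \<le> ?u * F Z"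
      unfolding F_def using h by (intro mult_left_mono SUP_upper) auto
    finally show "Z \<in> {Z \<in> space ?P. 1 \<le> ?u * F Z}" using Z by simp
  qed (use F in measurable)
  also have "\<dots> \<le> ?u * (\<integral>\<^sup>+Z. F Z * indicator (space ?P) Z \<partial>?P)"
    using nn_integral_Markov_inequality[of F "space ?P" ?P ?u] F by auto
  also have "(\<integral>\<^sup>+Z. F Z * indicator (space ?P) Z \<partial>?P) = (\<integral>\<^sup>+Z. F Z \<partial>?P)"
    by (intro nn_integral_cong) auto
  also have "?u * \<dots> \<le> ?u * ennreal (K * exp (real n * (s * c)\<^sup>2 / 2))"
    using int by (rule mult_left_mono) auto
  also have "\<dots> = ennreal (K * (exp (- (s * (real n * t))) * exp (real n * (s * c)\<^sup>2 / 2)))"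
    using K by (simp add: ennreal_mult[symmetric] mult_ac)
  also have "exp (- (s * (real n * t))) * exp (real n * (s * c)\<^sup>2 / 2) = exp (- (real n * t\<^sup>2 / (2 * c\<^sup>2)))"
    using c by (simp add: exp_add[symmetric] s_def field_simps power2_eq_square)
  finally show ?thesis .
qed

end

section \<open>The class of Bellman losses\<close>

text \<open>A maximum of two is half their sum plus half the absolute value of their difference, and
  contraction removes the absolute value. Taking maxima thus costs the factor \<open>card A\<close>
  in the scale and nothing in front.\<close>

lemma rmgf_Max:
  fixes f :: "'h \<Rightarrow> 'a \<Rightarrow> nat \<Rightarrow> real" and W :: "real \<Rightarrow> ennreal"
  assumes A: "finite A" "A \<noteq> {}"
    and W: "\<And>a \<tau>. a \<in> A \<Longrightarrow> 0 \<le> \<tau> \<Longrightarrow> rmgf n H (\<lambda>h i. \<tau> * f h a i) \<le> W \<tau>"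
    and \<tau>: "0 \<le> \<tau>"
  shows "rmgf n H (\<lambda>h i. \<tau> * Max ((\<lambda>a. f h a i) ` A)) \<le> W (real (card A) * \<tau>)"
  using A W \<tau>
proof (induction A arbitrary: \<tau> rule: finite_ne_induct)
  case (singleton a)
  then show ?case by simp
next
  case (insert a F)
  define k where "k = real (card F)"
  have k: "k > 0" using insert.hyps by (simp add: k_def card_gt_0_iff)
  \<comment> \<open>With these weights the old maximum at scale \<open>\<tau> / p\<close> and the
    new function at scale \<open>\<tau> / q\<close> both lead to
    \<open>W ((k + 1) * \<tau>)\<close>, so the convex combination has no prefactor.\<close>
  define p q where "p = k / (k + 1)" and "q = 1 / (k + 1)"
  have pq: "0 < p" "0 < q" "p + q = 1" using k by (auto simp: p_def q_def field_simps)
  define M where "M h i = Max ((\<lambda>a. f h a i) ` F)" for h i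
  let ?w = "W ((k + 1) * \<tau>)"
  have M: "rmgf n H (\<lambda>h i. \<tau> * M h i / p) \<le> ?w"
  proof -
    have "rmgf n H (\<lambda>h i. (\<tau> / p) * M h i) \<le> W (real (card F) * (\<tau> / p))"
      unfolding M_def using insert.prems pq by (intro insert.IH) auto
    also have "real (card F) * (\<tau> / p) = (k + 1) * \<tau>"
      using k by (simp add: p_def k_def[symmetric])
    finally show ?thesis by simp
  qed
  have a: "rmgf n H (\<lambda>h i. \<tau> * f h a i / q) \<le> ?w"
    using insert.prems(1)[of a "\<tau> / q"] insert.prems(2) pq k by (simp add: q_def mult_ac)
  have a': "rmgf n H (\<lambda>h i. - (\<tau> * f h a i) / q) \<le> ?w"
    using a rmgf_minus[of n H "\<lambda>h i. \<tau> * f h a i / q"] by simp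
  have split: "rmgf n H (\<lambda>h i. \<tau> * M h i + g h i) \<le> ?w"
    if "rmgf n H (\<lambda>h i. g h i / q) \<le> ?w" for g
  proof -
    have "rmgf n H (\<lambda>h i. \<tau> * M h i + g h i)
        \<le> ennreal p * rmgf n H (\<lambda>h i. \<tau> * M h i / p) + ennreal q * rmgf n H (\<lambda>h i. g h i / q)"
      by (rule rmgf_convex[OF pq])
    also have "\<dots> \<le> ennreal p * ?w + ennreal q * ?w"
      using M that by (intro add_mono mult_left_mono) auto
    also have "\<dots> = ?w"
      using pq by (simp add: distrib_right[symmetric] ennreal_plus[symmetric] del: ennreal_plus)
    finally show ?thesis .
  qed
  have "rmgf n H (\<lambda>h i. \<tau> * Max ((\<lambda>a. f h a i) ` insert a F))
      = rmgf n H (\<lambda>h i. \<tau> * (M h i + f h a i) / 2 + \<tau> * \<bar>M h i - f h a i\<bar> / 2)"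
  proof (rule rmgf_cong)
    fix h i
    have "Max ((\<lambda>a. f h a i) ` insert a F) = max (f h a i) (M h i)"
      unfolding M_def using insert.hyps by simp
    then show "\<tau> * Max ((\<lambda>a. f h a i) ` insert a F)
      = \<tau> * (M h i + f h a i) / 2 + \<tau> * \<bar>M h i - f h a i\<bar> / 2"
      by (simp add: field_simps max_def abs_if)
  qed
  also have "\<dots> \<le> ennreal (1/2) * rmgf n H (\<lambda>h i. \<tau> * (M h i + f h a i) / 2 / (1/2))
      + ennreal (1/2) * rmgf n H (\<lambda>h i. \<tau> * \<bar>M h i - f h a i\<bar> / 2 / (1/2))"
    by (rule rmgf_convex) auto
  also have "\<dots> = ennreal (1/2) * rmgf n H (\<lambda>h i. \<tau> * M h i + \<tau> * f h a i)
      + ennreal (1/2) * rmgf n H (\<lambda>h i. \<tau> * \<bar>M h i - f h a i\<bar>)"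
    by (simp add: distrib_left add_divide_distrib)
  also have "\<dots> \<le> ennreal (1/2) * ?w + ennreal (1/2) * ?w"
  proof (intro add_mono mult_left_mono split[OF a])
    have "rmgf n H (\<lambda>h i. \<tau> * \<bar>M h i - f h a i\<bar>) \<le> rmgf n H (\<lambda>h i. \<tau> * (M h i - f h a i))"
    proof (rule rmgf_contraction)
      fix h h' i
      show "\<bar>\<tau> * \<bar>M h i - f h a i\<bar> - \<tau> * \<bar>M h' i - f h' a i\<bar>\<bar>
        \<le> \<bar>\<tau> * (M h i - f h a i) - \<tau> * (M h' i - f h' a i)\<bar>"
        unfolding right_diff_distrib[symmetric] abs_mult
        by (intro mult_left_mono) (auto simp: abs_triangle_ineq3)
    qed (simp add: abs_mult)
    also have "\<dots> \<le> ?w"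
      using split[OF a'] by (simp add: right_diff_distrib)
    finally show "rmgf n H (\<lambda>h i. \<tau> * \<bar>M h i - f h a i\<bar>) \<le> ?w" .
  qed auto
  also have "\<dots> = ?w"
    by (subst distrib_right[symmetric], subst ennreal_plus[symmetric]) auto
  also have "(k + 1) * \<tau> = real (card (insert a F)) * \<tau>"
    using insert.hyps by (simp add: k_def)
  finally show ?case .
qed

text \<open>A sum is at most \<open>card A\<close> times its largest term, and the exponential of
  the largest term is at most the sum of all the exponentials.\<close>

lemma rmgf_sum:
  fixes v :: "'a \<Rightarrow> 'h \<Rightarrow> nat \<Rightarrow> real"
  assumes A: "finite A" "A \<noteq> {}"
  shows "rmgf n H (\<lambda>h i. \<Sum>a\<in>A. v a h i) \<le> (\<Sum>a\<in>A. rmgf n H (\<lambda>h i. real (card A) * v a h i))"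
  unfolding rmgf_def rade_sum[OF A(1), symmetric]
proof (intro rade_mono SUP_least)
  fix \<epsilon> :: "nat \<Rightarrow> real" and h assume h: "h \<in> H"
  define X where "X a = (\<Sum>i<n. \<epsilon> i * v a h i)" for a
  obtain b where b: "b \<in> A" "\<And>a. a \<in> A \<Longrightarrow> X a \<le> X b"
  proof -
    have "Max (X ` A) \<in> X ` A" using A by (intro Max_in) auto
    then obtain b where "b \<in> A" "Max (X ` A) = X b" by (metis imageE)
    moreover have "X a \<le> Max (X ` A)" if "a \<in> A" for a using A that by simp
    ultimately show ?thesis by (intro that[of b]) auto
  qed
  have "(\<Sum>i<n. \<epsilon> i * (\<Sum>a\<in>A. v a h i)) = (\<Sum>a\<in>A. X a)"
    unfolding X_def sum_distrib_left by (rule sum.swap)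
  also have "\<dots> \<le> real (card A) * X b"
    using sum_bounded_above[of A X "X b"] b by simp
  also have "\<dots> = (\<Sum>i<n. \<epsilon> i * (real (card A) * v b h i))"
    by (simp add: X_def sum_distrib_left mult_ac)
  finally have "ennreal (exp (\<Sum>i<n. \<epsilon> i * (\<Sum>a\<in>A. v a h i)))
      \<le> ennreal (exp (\<Sum>i<n. \<epsilon> i * (real (card A) * v b h i)))"
    by (intro ennreal_leI) simp
  also have "\<dots> \<le> (SUP h\<in>H. ennreal (exp (\<Sum>i<n. \<epsilon> i * (real (card A) * v b h i))))"
    using h by (rule SUP_upper)
  also have "\<dots> \<le> (\<Sum>a\<in>A. SUP h\<in>H. ennreal (exp (\<Sum>i<n. \<epsilon> i * (real (card A) * v a h i))))"
    using A b(1) by (intro member_le_sum) auto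
  finally show "ennreal (exp (\<Sum>i<n. \<epsilon> i * (\<Sum>a\<in>A. v a h i)))
      \<le> (\<Sum>a\<in>A. SUP h\<in>H. ennreal (exp (\<Sum>i<n. \<epsilon> i * (real (card A) * v a h i))))" .
qed

text \<open>The distribution lives on \<open>S \<times> UNIV\<close>, but nothing is known of
  \<open>g\<close> for actions outside \<open>A\<close>. The value \<open>0\<close> there keeps the
  function bounded and measurable everywhere.\<close>

definition bellman_lin ::
  "nat set \<Rightarrow> nat \<Rightarrow> nat \<Rightarrow> nat \<Rightarrow> (real^('d::finite) \<Rightarrow> nat \<Rightarrow> real \<Rightarrow> real^'d)
   \<Rightarrow> real \<Rightarrow> real \<Rightarrow> (nat \<Rightarrow> 'd rnparam) \<Rightarrow> (real^'d) \<times> nat \<Rightarrow> real" where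
  "bellman_lin A m D L g \<gamma> dt \<Theta> = (\<lambda>(s, a). if a \<in> A then
     resnet m D L (\<Theta> a) s - \<gamma> * Max ((\<lambda>a'. resnet m D L (\<Theta> a') (g s a dt)) ` A) else 0)"

text \<open>The squared Bellman residual minus \<open>r\<^sup>2\<close>: the dropped part does not depend on the
  network, so it cancels when the two deviations of the argument are added.\<close>
definition bellman_loss ::
  "nat set \<Rightarrow> nat \<Rightarrow> nat \<Rightarrow> nat \<Rightarrow> (real^('d::finite) \<Rightarrow> nat \<Rightarrow> real) \<Rightarrow> (real^'d \<Rightarrow> nat \<Rightarrow> real \<Rightarrow> real^'d)
   \<Rightarrow> real \<Rightarrow> real \<Rightarrow> (nat \<Rightarrow> 'd rnparam) \<Rightarrow> (real^'d) \<times> nat \<Rightarrow> real" where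
  "bellman_loss A m D L r g \<gamma> dt \<Theta> z =
     (bellman_lin A m D L g \<gamma> dt \<Theta> z)\<^sup>2 / 2 - r (fst z) (snd z) * bellman_lin A m D L g \<gamma> dt \<Theta> z"

lemma path_norm_le_family:
  "finite A \<Longrightarrow> a \<in> A \<Longrightarrow> path_norm m D L (\<Theta> a) \<le> family_path_norm A m D L \<Theta>"
  unfolding family_path_norm_def by (rule member_le_sum) (auto simp: path_norm_nonneg)

lemma family_path_norm_nonneg: "0 \<le> family_path_norm A m D L \<Theta>"
  unfolding family_path_norm_def by (intro sum_nonneg path_norm_nonneg)

lemma abs_Max_le:
  fixes f :: "'a \<Rightarrow> real"
  assumes "finite A" "A \<noteq> {}" "\<And>a. a \<in> A \<Longrightarrow> \<bar>f a\<bar> \<le> b"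
  shows "\<bar>Max (f ` A)\<bar> \<le> b"
proof -
  have "Max (f ` A) \<in> f ` A" using assms by (intro Max_in) auto
  then show ?thesis using assms(3) by auto
qed

lemma abs_Max_diff_le:
  fixes f h :: "'a \<Rightarrow> real"
  assumes A: "finite A" "A \<noteq> {}" and le: "\<And>a. a \<in> A \<Longrightarrow> \<bar>f a - h a\<bar> \<le> b"
  shows "\<bar>Max (f ` A) - Max (h ` A)\<bar> \<le> b"
proof -
  have *: "Max (f ` A) \<le> Max (h ` A) + b" if "\<And>a. a \<in> A \<Longrightarrow> f a \<le> h a + b" for f h :: "'a \<Rightarrow> real"
  proof (rule Max.boundedI)
    fix x assume "x \<in> f ` A"
    then obtain a where "a \<in> A" "x = f a" by auto
    then show "x \<le> Max (h ` A) + b"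
      using that[of a] Max_ge[of "h ` A" "h a"] A by (simp add: order.trans)
  qed (use A in auto)
  have "f a \<le> h a + b" "h a \<le> f a + b" if "a \<in> A" for a using le[OF that] by auto
  then have "Max (f ` A) \<le> Max (h ` A) + b" "Max (h ` A) \<le> Max (f ` A) + b"
    by (auto intro!: *)
  then show ?thesis by linarith
qed

lemma bellman_lin_bound:
  fixes z :: "(real^'d::finite) \<times> nat"
  assumes A: "finite A" "A \<noteq> {}" and \<gamma>: "0 \<le> \<gamma>" "\<gamma> \<le> 1"
    and s: "snd z \<in> A \<Longrightarrow> (\<forall>q. \<bar>fst z $ q\<bar> \<le> 1) \<and> (\<forall>q. \<bar>g (fst z) (snd z) dt $ q\<bar> \<le> 1)"
    and Q: "family_path_norm A m D L \<Theta> \<le> Q"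
  shows "\<bar>bellman_lin A m D L g \<gamma> dt \<Theta> z\<bar> \<le> 2 * Q"
proof (cases "snd z \<in> A")
  case True
  have p: "path_norm m D L (\<Theta> a) \<le> Q" if "a \<in> A" for a
    using path_norm_le_family[OF A(1) that, of m D L \<Theta>] Q by linarith
  let ?M = "Max ((\<lambda>a'. resnet m D L (\<Theta> a') (g (fst z) (snd z) dt)) ` A)"
  have "\<bar>resnet m D L (\<Theta> (snd z)) (fst z)\<bar> \<le> Q"
    using order.trans[OF resnet_bound p[OF True]] s[OF True] by blast
  moreover have "\<bar>?M\<bar> \<le> Q"
    using order.trans[OF resnet_bound p] s[OF True] A by (intro abs_Max_le) blast+
  then have "\<bar>\<gamma> * ?M\<bar> \<le> 1 * Q"
    unfolding abs_mult using \<gamma> by (intro mult_mono) auto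
  ultimately show ?thesis using True by (simp add: bellman_lin_def split_beta)
next
  case False
  then show ?thesis using Q family_path_norm_nonneg[of A m D L \<Theta>] by (simp add: bellman_lin_def split_beta)
qed

lemma quadratic_loss_lipschitz:
  fixes x y r Q :: real
  assumes "\<bar>x\<bar> \<le> 2 * Q" "\<bar>y\<bar> \<le> 2 * Q" "\<bar>r\<bar> \<le> 1"
  shows "\<bar>(x\<^sup>2 / 2 - r * x) - (y\<^sup>2 / 2 - r * y)\<bar> \<le> (2 * Q + 1) * \<bar>x - y\<bar>"
proof -
  have "(x\<^sup>2 / 2 - r * x) - (y\<^sup>2 / 2 - r * y) = ((x + y) / 2 - r) * (x - y)"
    by (simp add: power2_eq_square field_simps)
  moreover have "\<bar>(x + y) / 2 - r\<bar> \<le> 2 * Q + 1" using assms by (auto simp: abs_le_iff field_simps)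
  ultimately show ?thesis by (simp add: abs_mult mult_right_mono)
qed

text \<open>Which network is evaluated depends on the sampled action. Feeding the input
  \<open>0\<close> to all the others turns this selection into a sum over the actions, since
  networks vanish at \<open>0\<close>. In the scale \<open>2 * card A\<close>, the 2 comes from
  separating the value from the maximum and \<open>card A\<close> from the sum and the maximum
  themselves.\<close>

lemma rmgf_bellman_lin:
  fixes Z :: "nat \<Rightarrow> (real^'d::finite) \<times> nat"
  assumes A: "finite A" "A \<noteq> {}" and \<gamma>: "0 \<le> \<gamma>" "\<gamma> \<le> 1"
    and s: "\<And>i. i < n \<Longrightarrow> snd (Z i) \<in> A \<Longrightarrow>
        (\<forall>q. \<bar>fst (Z i) $ q\<bar> \<le> 1) \<and> (\<forall>q. \<bar>g (fst (Z i)) (snd (Z i)) dt $ q\<bar> \<le> 1)"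
    and Q: "0 < Q" and \<tau>: "0 \<le> \<tau>"
  shows "rmgf n {\<Theta>. family_path_norm A m D L \<Theta> \<le> Q} (\<lambda>\<Theta> i. \<tau> * bellman_lin A m D L g \<gamma> dt \<Theta> (Z i))
    \<le> ennreal (real (card A) * 3 ^ L * (2 * real CARD('d)) * exp (real n * (2 * real (card A) * \<tau> * Q)\<^sup>2 / 2))"
proof -
  let ?H = "{\<Theta> :: nat \<Rightarrow> 'd rnparam. family_path_norm A m D L \<Theta> \<le> Q}"
  define W where "W t = ennreal (3 ^ L * (2 * real CARD('d)) * exp (real n * (t * Q)\<^sup>2 / 2))" for t
  define N where "N = real (card A)"
  have N: "N \<ge> 1" using A by (simp add: N_def Suc_le_eq card_gt_0_iff)
  have single: "rmgf n ?H (\<lambda>\<Theta> i. t * resnet m D L (\<Theta> a) (x i)) \<le> W t"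
    if "a \<in> A" "0 \<le> t" "\<And>i q. i < n \<Longrightarrow> \<bar>x i $ q\<bar> \<le> 1" for a t and x :: "nat \<Rightarrow> real^'d"
  proof -
    have "rmgf n ?H (\<lambda>\<Theta> i. t * resnet m D L (\<Theta> a) (x i))
        \<le> rmgf n {\<theta>. path_norm m D L \<theta> \<le> Q} (\<lambda>\<theta> i. t * resnet m D L \<theta> (x i))"
      using path_norm_le_family[OF A(1) that(1), of m D L]
      by (intro rmgf_image_le[where f = "\<lambda>\<Theta>. \<Theta> a"]) (auto intro: order.trans)
    also have "\<dots> \<le> W t" unfolding W_def using that Q by (intro rmgf_resnet)
    finally show ?thesis .
  qed
  define x where "x a i = (if snd (Z i) = a then fst (Z i) else 0)" for a i
  define x' where "x' i = (if snd (Z i) \<in> A then g (fst (Z i)) (snd (Z i)) dt else 0)" for i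
  have x: "\<bar>x a i $ q\<bar> \<le> 1" if "a \<in> A" "i < n" for a i q using s[of i] that by (auto simp: x_def)
  have x': "\<bar>x' i $ q\<bar> \<le> 1" if "i < n" for i q using s[of i] that by (auto simp: x'_def)
  let ?M = "\<lambda>\<Theta> i. Max ((\<lambda>a. resnet m D L (\<Theta> a) (x' i)) ` A)"
  have lin: "bellman_lin A m D L g \<gamma> dt \<Theta> (Z i) = (\<Sum>a\<in>A. resnet m D L (\<Theta> a) (x a i)) - \<gamma> * ?M \<Theta> i" for \<Theta> i
  proof (cases "snd (Z i) \<in> A")
    case True
    have "(\<Sum>a\<in>A. resnet m D L (\<Theta> a) (x a i)) = (\<Sum>a\<in>A. if snd (Z i) = a then resnet m D L (\<Theta> a) (fst (Z i)) else 0)"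
      by (intro sum.cong) (auto simp: x_def)
    then show ?thesis using True A by (simp add: bellman_lin_def x'_def split_beta)
  next
    case False
    have "(\<Sum>a\<in>A. resnet m D L (\<Theta> a) (x a i)) = 0"
      using False by (intro sum.neutral) (auto simp: x_def)
    moreover have "(\<lambda>a. resnet m D L (\<Theta> a) (x' i)) ` A = {0}"
      using A False by (auto simp: x'_def image_iff)
    ultimately show ?thesis using False by (simp add: bellman_lin_def split_beta)
  qed
  have "rmgf n ?H (\<lambda>\<Theta> i. \<tau> * bellman_lin A m D L g \<gamma> dt \<Theta> (Z i))
      = rmgf n ?H (\<lambda>\<Theta> i. \<tau> * (\<Sum>a\<in>A. resnet m D L (\<Theta> a) (x a i)) + - (\<tau> * \<gamma> * ?M \<Theta> i))"
    by (simp add: lin right_diff_distrib mult.assoc)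
  also have "\<dots> \<le> ennreal (1/2) * rmgf n ?H (\<lambda>\<Theta> i. \<tau> * (\<Sum>a\<in>A. resnet m D L (\<Theta> a) (x a i)) / (1/2))
      + ennreal (1/2) * rmgf n ?H (\<lambda>\<Theta> i. - (\<tau> * \<gamma> * ?M \<Theta> i) / (1/2))"
    by (rule rmgf_convex) auto
  also have "\<dots> \<le> ennreal (1/2) * (ennreal N * W (N * (2 * \<tau>))) + ennreal (1/2) * W (N * (2 * \<tau>))"
  proof (intro add_mono mult_left_mono)
    have "rmgf n ?H (\<lambda>\<Theta> i. \<tau> * (\<Sum>a\<in>A. resnet m D L (\<Theta> a) (x a i)) / (1/2))
        = rmgf n ?H (\<lambda>\<Theta> i. \<Sum>a\<in>A. 2 * \<tau> * resnet m D L (\<Theta> a) (x a i))"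
      by (simp add: sum_distrib_left mult_ac)
    also have "\<dots> \<le> (\<Sum>a\<in>A. rmgf n ?H (\<lambda>\<Theta> i. N * (2 * \<tau> * resnet m D L (\<Theta> a) (x a i))))"
      unfolding N_def by (rule rmgf_sum[OF A])
    also have "\<dots> \<le> (\<Sum>a\<in>A. W (N * (2 * \<tau>)))"
    proof (intro sum_mono)
      fix a assume "a \<in> A"
      then show "rmgf n ?H (\<lambda>\<Theta> i. N * (2 * \<tau> * resnet m D L (\<Theta> a) (x a i))) \<le> W (N * (2 * \<tau>))"
        using single[of a "N * (2 * \<tau>)" "x a"] x N \<tau> by (simp add: mult.assoc)
    qed
    also have "\<dots> = ennreal N * W (N * (2 * \<tau>))"
      by (simp add: N_def ennreal_of_nat_eq_real_of_nat)
    finally show "rmgf n ?H (\<lambda>\<Theta> i. \<tau> * (\<Sum>a\<in>A. resnet m D L (\<Theta> a) (x a i)) / (1/2)) \<le> ennreal N * W (N * (2 * \<tau>))" .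
    have "rmgf n ?H (\<lambda>\<Theta> i. - (\<tau> * \<gamma> * ?M \<Theta> i) / (1/2)) \<le> rmgf n ?H (\<lambda>\<Theta> i. 2 * \<tau> * ?M \<Theta> i)"
    proof (rule rmgf_contraction)
      fix \<Theta> \<Theta>' :: "nat \<Rightarrow> 'd rnparam" and i
      have *: "\<bar>2 * \<tau> * \<gamma> * b\<bar> \<le> \<bar>2 * \<tau> * b\<bar>" for b
      proof -
        have "\<gamma> * \<bar>2 * \<tau> * b\<bar> \<le> 1 * \<bar>2 * \<tau> * b\<bar>" using \<gamma> by (intro mult_right_mono) auto
        then show ?thesis using \<gamma> by (simp add: abs_mult mult_ac)
      qed
      show "\<bar>- (\<tau> * \<gamma> * ?M \<Theta> i) / (1/2)\<bar> \<le> \<bar>2 * \<tau> * ?M \<Theta> i\<bar>"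
        using *[of "?M \<Theta> i"] by (simp add: mult_ac)
      have "- (\<tau> * \<gamma> * ?M \<Theta> i) / (1/2) - - (\<tau> * \<gamma> * ?M \<Theta>' i) / (1/2) = - (2 * \<tau> * \<gamma> * (?M \<Theta> i - ?M \<Theta>' i))"
        by (simp add: algebra_simps)
      moreover have "2 * \<tau> * ?M \<Theta> i - 2 * \<tau> * ?M \<Theta>' i = 2 * \<tau> * (?M \<Theta> i - ?M \<Theta>' i)"
        by (simp add: algebra_simps)
      ultimately show "\<bar>- (\<tau> * \<gamma> * ?M \<Theta> i) / (1/2) - - (\<tau> * \<gamma> * ?M \<Theta>' i) / (1/2)\<bar>
        \<le> \<bar>2 * \<tau> * ?M \<Theta> i - 2 * \<tau> * ?M \<Theta>' i\<bar>"
        using *[of "?M \<Theta> i - ?M \<Theta>' i"] by (simp only: abs_minus_cancel)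
    qed
    also have "\<dots> \<le> W (real (card A) * (2 * \<tau>))"
      using A \<tau> x' by (intro rmgf_Max single) auto
    finally show "rmgf n ?H (\<lambda>\<Theta> i. - (\<tau> * \<gamma> * ?M \<Theta> i) / (1/2)) \<le> W (N * (2 * \<tau>))"
      by (simp add: N_def)
  qed auto
  also have "\<dots> \<le> ennreal (1/2) * (ennreal N * W (N * (2 * \<tau>))) + ennreal (1/2) * (ennreal N * W (N * (2 * \<tau>)))"
  proof (intro add_mono mult_left_mono order.refl)
    have "1 * W (N * (2 * \<tau>)) \<le> ennreal N * W (N * (2 * \<tau>))"
      using N by (intro mult_right_mono) (simp_all add: ennreal_leI flip: ennreal_1)
    then show "W (N * (2 * \<tau>)) \<le> ennreal N * W (N * (2 * \<tau>))" by simp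
  qed auto
  also have "\<dots> = ennreal N * W (N * (2 * \<tau>))"
    by (subst distrib_right[symmetric], subst ennreal_plus[symmetric]) auto
  also have "\<dots> = ennreal (real (card A) * 3 ^ L * (2 * real CARD('d)) * exp (real n * (2 * real (card A) * \<tau> * Q)\<^sup>2 / 2))"
    unfolding W_def N_def by (subst ennreal_mult[symmetric]) (auto simp: mult_ac)
  finally show ?thesis .
qed

text \<open>Contraction from the loss to \<open>bellman_lin\<close>: with \<open>r\<^sup>2\<close>
  subtracted the loss vanishes together with \<open>bellman_lin\<close>, and on the ball of radius
  \<open>Q\<close> its slope is at most \<open>2 * Q + 1\<close>. The 2 in front of \<open>t\<close>
  is the one produced by symmetrization.\<close>

lemma rmgf_bellman_loss:
  fixes Z :: "nat \<Rightarrow> (real^'d::finite) \<times> nat"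
  assumes A: "finite A" "A \<noteq> {}" and \<gamma>: "0 \<le> \<gamma>" "\<gamma> \<le> 1"
    and s: "\<And>i. i < n \<Longrightarrow> snd (Z i) \<in> A \<Longrightarrow>
        (\<forall>q. \<bar>fst (Z i) $ q\<bar> \<le> 1) \<and> (\<forall>q. \<bar>g (fst (Z i)) (snd (Z i)) dt $ q\<bar> \<le> 1)"
    and r: "\<And>i. i < n \<Longrightarrow> snd (Z i) \<in> A \<Longrightarrow> \<bar>r (fst (Z i)) (snd (Z i))\<bar> \<le> 1"
    and Q: "0 < Q" and t: "0 \<le> t" and H: "H \<subseteq> {\<Theta>. family_path_norm A m D L \<Theta> \<le> Q}"
  shows "rmgf n H (\<lambda>\<Theta> i. 2 * t * bellman_loss A m D L r g \<gamma> dt \<Theta> (Z i))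
    \<le> ennreal (real (card A) * 3 ^ L * (2 * real CARD('d))
         * exp (real n * (t * (4 * real (card A) * (2 * Q + 1) * Q))\<^sup>2 / 2))"
proof -
  let ?b = "\<lambda>\<Theta> i. bellman_lin A m D L g \<gamma> dt \<Theta> (Z i)"
  define \<tau> where "\<tau> = 2 * t * (2 * Q + 1)"
  have \<tau>: "0 \<le> \<tau>" using t Q by (simp add: \<tau>_def)
  \<comment> \<open>Taking \<open>y = 0\<close> gives the first hypothesis of the contraction, and
    taking the value of a second family gives the other one.\<close>
  have lip: "\<bar>2 * t * bellman_loss A m D L r g \<gamma> dt \<Theta> (Z i) - 2 * t * (y\<^sup>2 / 2 - r (fst (Z i)) (snd (Z i)) * y)\<bar>
      \<le> \<bar>\<tau> * ?b \<Theta> i - \<tau> * y\<bar>" if "\<Theta> \<in> H" "i < n" "\<bar>y\<bar> \<le> 2 * Q" "snd (Z i) \<notin> A \<Longrightarrow> y = 0" for \<Theta> i y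
  proof (cases "snd (Z i) \<in> A")
    case True
    have "\<bar>?b \<Theta> i\<bar> \<le> 2 * Q"
      using that H s by (intro bellman_lin_bound[OF A \<gamma>]) auto
    then have "2 * t * \<bar>bellman_loss A m D L r g \<gamma> dt \<Theta> (Z i) - (y\<^sup>2 / 2 - r (fst (Z i)) (snd (Z i)) * y)\<bar>
       \<le> 2 * t * ((2 * Q + 1) * \<bar>?b \<Theta> i - y\<bar>)"
      unfolding bellman_loss_def using that r True t
      by (intro mult_left_mono quadratic_loss_lipschitz) auto
    then show ?thesis
      using t Q unfolding \<tau>_def right_diff_distrib[symmetric] by (simp add: abs_mult mult.assoc)
  next
    case False
    then show ?thesis using that(4) by (simp add: bellman_loss_def bellman_lin_def split_beta)
  qed
  have "rmgf n H (\<lambda>\<Theta> i. 2 * t * bellman_loss A m D L r g \<gamma> dt \<Theta> (Z i)) \<le> rmgf n H (\<lambda>\<Theta> i. \<tau> * ?b \<Theta> i)"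
  proof (rule rmgf_contraction)
    fix \<Theta> i assume "\<Theta> \<in> H" "i < n"
    then show "\<bar>2 * t * bellman_loss A m D L r g \<gamma> dt \<Theta> (Z i)\<bar> \<le> \<bar>\<tau> * ?b \<Theta> i\<bar>"
      using lip[of \<Theta> i 0] Q by simp
  next
    fix \<Theta> \<Theta>' i assume *: "\<Theta> \<in> H" "\<Theta>' \<in> H" "i < n"
    have "\<bar>?b \<Theta>' i\<bar> \<le> 2 * Q"
      using * H s by (intro bellman_lin_bound[OF A \<gamma>]) auto
    with * show "\<bar>2 * t * bellman_loss A m D L r g \<gamma> dt \<Theta> (Z i) - 2 * t * bellman_loss A m D L r g \<gamma> dt \<Theta>' (Z i)\<bar>
      \<le> \<bar>\<tau> * ?b \<Theta> i - \<tau> * ?b \<Theta>' i\<bar>"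
      using lip[of \<Theta> i "?b \<Theta>' i"] by (simp add: bellman_loss_def[of _ _ _ _ _ _ _ _ \<Theta>'] bellman_lin_def[of _ _ _ _ _ _ _ \<Theta>'] split_beta)
  qed
  also have "\<dots> \<le> rmgf n {\<Theta>. family_path_norm A m D L \<Theta> \<le> Q} (\<lambda>\<Theta> i. \<tau> * ?b \<Theta> i)"
    using H by (intro rmgf_image_le[where f = id]) auto
  also have "\<dots> \<le> ennreal (real (card A) * 3 ^ L * (2 * real CARD('d)) * exp (real n * (2 * real (card A) * \<tau> * Q)\<^sup>2 / 2))"
    using s by (intro rmgf_bellman_lin[OF A \<gamma> _ Q \<tau>])
  also have "2 * real (card A) * \<tau> * Q = t * (4 * real (card A) * (2 * Q + 1) * Q)"
    by (simp add: \<tau>_def)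
  finally show ?thesis .
qed

section \<open>Uniform deviation of the Bellman loss\<close>

lemma borel_measurable_Max_image:
  fixes f :: "'i \<Rightarrow> 'a \<Rightarrow> real"
  assumes "finite A" "A \<noteq> {}" "\<And>i. i \<in> A \<Longrightarrow> f i \<in> borel_measurable M"
  shows "(\<lambda>x. Max ((\<lambda>i. f i x) ` A)) \<in> borel_measurable M"
  using assms
proof (induction A rule: finite_ne_induct)
  case (insert i F)
  have "Max ((\<lambda>i. f i x) ` insert i F) = max (f i x) (Max ((\<lambda>i. f i x) ` F))" for x
    using insert.hyps by simp
  then show ?case using insert by simp
qed simp

lemma continuous_rn_hidden: "continuous_on UNIV (\<lambda>x. rn_hidden m D \<theta> x l j)"
  by (induction l arbitrary: j)
     (auto simp: relu_def intro!: continuous_intros)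

lemma continuous_resnet: "continuous_on UNIV (resnet m D L \<theta>)"
  unfolding resnet_def by (intro continuous_intros continuous_rn_hidden)

lemma resnet_measurable [measurable]: "resnet m D L \<theta> \<in> borel_measurable borel"
  by (intro borel_measurable_continuous_onI continuous_resnet)

text \<open>A bounded path norm does not bound the parameters, so the net is built from function
  values: families are identified when their values at finitely many states agree after rounding to
  multiples of \<open>e\<close>. Boundedness leaves finitely many classes, and the common Lipschitz
  constant extends the agreement to all of \<open>S\<close>.\<close>

lemma resnet_family_finite_net:
  fixes S :: "(real^'d::finite) set"
  assumes S: "compact S" "\<And>s i. s \<in> S \<Longrightarrow> \<bar>s $ i\<bar> \<le> 1" and A: "finite A" and Q: "0 \<le> Q" and \<eta>: "0 < \<eta>"
  obtains N :: "(nat \<Rightarrow> 'd rnparam) set" where "finite N" "N \<subseteq> {\<Theta>. family_path_norm A m D L \<Theta> \<le> Q}"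
    "\<And>\<Theta>. family_path_norm A m D L \<Theta> \<le> Q \<Longrightarrow>
       \<exists>\<Theta>'\<in>N. \<forall>a\<in>A. \<forall>s\<in>S. \<bar>resnet m D L (\<Theta> a) s - resnet m D L (\<Theta>' a) s\<bar> \<le> \<eta>"
proof -
  \<comment> \<open>Passing to a grid point costs \<open>e * Q\<close> for each of the two families
    and rounding costs \<open>e\<close>; the total is \<open>\<eta>\<close>.\<close>
  define e where "e = \<eta> / (2 * Q + 1)"
  have "(2 * Q + 1) * e = \<eta>" using Q by (simp add: e_def)
  then have "2 * Q * e + e = \<eta>" by (simp only: distrib_right mult_1)
  moreover have "0 < e" using Q \<eta> by (simp add: e_def)
  ultimately have e: "0 < e" "2 * Q * e + e = \<eta>" by auto
  obtain P where P: "finite P" "P \<subseteq> S" "S \<subseteq> (\<Union>x\<in>P. ball x e)"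
    using seq_compact_imp_totally_bounded[OF compact_imp_seq_compact[OF S(1)], rule_format, OF e(1)] by blast
  let ?B = "{\<Theta> :: nat \<Rightarrow> 'd rnparam. family_path_norm A m D L \<Theta> \<le> Q}"
  define \<phi> where "\<phi> \<Theta> = (\<lambda>(a, p)\<in>A \<times> P. \<lfloor>resnet m D L (\<Theta> a) p / e\<rfloor>)" for \<Theta> :: "nat \<Rightarrow> 'd rnparam"
  have pn: "path_norm m D L (\<Theta> a) \<le> Q" if "\<Theta> \<in> ?B" "a \<in> A" for \<Theta> a
    using path_norm_le_family[OF A that(2), of m D L \<Theta>] that(1) by simp
  have "\<phi> ` ?B \<subseteq> PiE (A \<times> P) (\<lambda>_. {\<lfloor>- Q / e\<rfloor>..\<lfloor>Q / e\<rfloor>})"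
  proof (intro image_subsetI)
    fix \<Theta> assume \<Theta>: "\<Theta> \<in> ?B"
    have "- Q \<le> resnet m D L (\<Theta> a) p \<and> resnet m D L (\<Theta> a) p \<le> Q" if "a \<in> A" "p \<in> P" for a p
      using order.trans[OF resnet_bound pn[OF \<Theta> that(1)], of p] S(2) P(2) that(2) by (auto simp: abs_le_iff subset_iff)
    then have "- Q / e \<le> resnet m D L (\<Theta> a) p / e \<and> resnet m D L (\<Theta> a) p / e \<le> Q / e"
      if "a \<in> A" "p \<in> P" for a p
      using that e(1) by (intro conjI divide_right_mono) auto
    then show "\<phi> \<Theta> \<in> PiE (A \<times> P) (\<lambda>_. {\<lfloor>- Q / e\<rfloor>..\<lfloor>Q / e\<rfloor>})"
      by (auto simp: \<phi>_def intro!: floor_mono simp del: minus_divide_left[symmetric] minus_divide_left)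
  qed
  then have "finite (\<phi> ` ?B)"
    by (rule finite_subset) (intro finite_PiE finite_cartesian_product A P(1), auto)
  then obtain N where N: "N \<subseteq> ?B" "finite N" "\<phi> ` ?B = \<phi> ` N"
    using finite_subset_image[of "\<phi> ` ?B" \<phi> ?B] by auto
  show ?thesis
  proof (rule that[OF N(2,1)])
    fix \<Theta> :: "nat \<Rightarrow> 'd rnparam" assume \<Theta>: "family_path_norm A m D L \<Theta> \<le> Q"
    then obtain \<Theta>' where \<Theta>': "\<Theta>' \<in> N" "\<phi> \<Theta> = \<phi> \<Theta>'" using N(3) by blast
    have "\<bar>resnet m D L (\<Theta> a) s - resnet m D L (\<Theta>' a) s\<bar> \<le> \<eta>" if a: "a \<in> A" and s: "s \<in> S" for a s
    proof -
      obtain p where p: "p \<in> P" "dist p s < e" using P(3) s by auto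
      have lip: "\<bar>resnet m D L (\<Psi> a) s - resnet m D L (\<Psi> a) p\<bar> \<le> e * Q" if "\<Psi> \<in> ?B" for \<Psi>
      proof -
        have "\<bar>s $ i - p $ i\<bar> \<le> e" for i
          using component_le_norm_cart[of "s - p" i] p(2) by (simp add: dist_norm norm_minus_commute)
        then have "\<bar>resnet m D L (\<Psi> a) s - resnet m D L (\<Psi> a) p\<bar> \<le> e * path_norm m D L (\<Psi> a)"
          by (rule resnet_lipschitz)
        also have "\<dots> \<le> e * Q" using pn[OF that a] e by (intro mult_left_mono) auto
        finally show ?thesis .
      qed
      have "\<phi> \<Theta> (a, p) = \<phi> \<Theta>' (a, p)" using \<Theta>'(2) by simp
      then have "\<lfloor>resnet m D L (\<Theta> a) p / e\<rfloor> = \<lfloor>resnet m D L (\<Theta>' a) p / e\<rfloor>"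
        using a p(1) by (simp add: \<phi>_def)
      then have "\<bar>resnet m D L (\<Theta> a) p / e - resnet m D L (\<Theta>' a) p / e\<bar> \<le> 1"
        by linarith
      then have "\<bar>resnet m D L (\<Theta> a) p - resnet m D L (\<Theta>' a) p\<bar> \<le> e"
        using e(1) by (simp add: diff_divide_distrib[symmetric])
      moreover have "\<Theta>' \<in> ?B" using \<Theta>'(1) N(1) by blast
      ultimately show ?thesis
        using lip[of \<Theta>] lip[of \<Theta>'] \<Theta> e(2) by (simp add: algebra_simps)
    qed
    then show "\<exists>\<Theta>'\<in>N. \<forall>a\<in>A. \<forall>s\<in>S. \<bar>resnet m D L (\<Theta> a) s - resnet m D L (\<Theta>' a) s\<bar> \<le> \<eta>"
      using \<Theta>'(1) by blast
  qed
qed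

locale bellman_setting =
  fixes S :: "(real^'d::finite) set" and A :: "nat set" and r :: "real^'d \<Rightarrow> nat \<Rightarrow> real"
    and g :: "real^'d \<Rightarrow> nat \<Rightarrow> real \<Rightarrow> real^'d" and \<gamma> dt :: real
  assumes S_compact: "compact S" and S_cube: "\<And>s i. s \<in> S \<Longrightarrow> 0 \<le> s $ i \<and> s $ i \<le> 1"
    and S_pos: "0 < emeasure lborel S"
    and A: "finite A" "A \<noteq> {}"
    and r_cont: "\<And>a. a \<in> A \<Longrightarrow> continuous_on S (\<lambda>s. r s a)"
    and r_bound: "\<And>s a. s \<in> S \<Longrightarrow> a \<in> A \<Longrightarrow> \<bar>r s a\<bar> \<le> 1"
    and g_in: "\<And>s a. s \<in> S \<Longrightarrow> a \<in> A \<Longrightarrow> g s a dt \<in> S"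
    and g_meas: "\<And>a. a \<in> A \<Longrightarrow> (\<lambda>s. g s a dt) \<in> borel_measurable (restrict_space lborel S)"
    and \<gamma>: "0 < \<gamma>" "\<gamma> < 1"
begin

section \<open>Measurability and boundedness over states and actions\<close>

lemma S_abs: "s \<in> S \<Longrightarrow> \<bar>s $ i\<bar> \<le> 1"
  using S_cube[of s i] by auto

lemma S_sets: "S \<in> sets borel"
  using S_compact by (simp add: borel_compact)

lemma S_finite: "emeasure lborel S < \<infinity>"
  using S_compact emeasure_bounded_finite compact_imp_bounded by blast

lemma space_state_dist: "space (state_dist S) = S"
  by (simp add: state_dist_def space_restrict_space)

lemma sets_state_dist: "sets (state_dist S) = sets (restrict_space borel S)"
  by (simp add: state_dist_def sets_restrict_space)

lemma prob_space_state_dist: "prob_space (state_dist S)"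
proof -
  have "emeasure (restrict_space lborel S) S = emeasure lborel S"
    using S_sets by (subst emeasure_restrict_space) auto
  then show ?thesis
    unfolding state_dist_def using S_pos S_finite by (intro prob_space_uniform_measure) auto
qed

lemma space_sa_dist: "space (sa_dist S A) = S \<times> UNIV"
  by (simp add: sa_dist_def space_pair_measure space_state_dist)

lemma prob_space_sa_dist: "prob_space (sa_dist S A)"
proof -
  have "pair_prob_space (state_dist S) (measure_pmf (pmf_of_set A))"
    using prob_space_state_dist prob_space_measure_pmf[of "pmf_of_set A"]
    by (simp add: pair_prob_space_def pair_sigma_finite_def prob_space_imp_sigma_finite)
  then interpret pair_prob_space "state_dist S" "measure_pmf (pmf_of_set A)" .
  show ?thesis unfolding sa_dist_def by (rule P.prob_space_axioms)
qed

text \<open>The actions form a countable discrete space, so measurability can be checked action by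
  action.\<close>

lemma sa_dist_measurable:
  fixes f :: "(real^'d) \<times> nat \<Rightarrow> real"
  assumes "\<And>a. (\<lambda>s. f (s, a)) \<in> borel_measurable (state_dist S)"
  shows "f \<in> borel_measurable (sa_dist S A)"
proof -
  have "(\<lambda>z. f (fst z, snd z)) \<in> borel_measurable (sa_dist S A)"
  proof (rule measurable_compose_countable'[where f = "\<lambda>a z. f (fst z, a)" and g = snd and I = UNIV])
    show "(\<lambda>z. f (fst z, a)) \<in> borel_measurable (sa_dist S A)" if "a \<in> UNIV" for a
      unfolding sa_dist_def by (rule measurable_compose[OF measurable_fst assms])
    show "snd \<in> measurable (sa_dist S A) (count_space UNIV)"
      unfolding sa_dist_def using measurable_snd[of "state_dist S" "measure_pmf (pmf_of_set A)"] by simp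
  qed auto
  then show ?thesis by simp
qed

lemma AE_sa_dist: "emeasure (sa_dist S A) (S \<times> A) = 1" "S \<times> A \<in> sets (sa_dist S A)"
proof -
  interpret P: prob_space "state_dist S" by (rule prob_space_state_dist)
  have S: "S \<in> sets (state_dist S)" using sets.top[of "state_dist S"] by (simp add: space_state_dist)
  have "emeasure (measure_pmf (pmf_of_set A)) A = 1"
    using A by (simp add: emeasure_pmf_of_set)
  then show "emeasure (sa_dist S A) (S \<times> A) = 1"
    unfolding sa_dist_def using S P.emeasure_space_1
    by (subst measure_pmf.emeasure_pair_measure_Times) (auto simp: space_state_dist)
  show "S \<times> A \<in> sets (sa_dist S A)"
    unfolding sa_dist_def using S by (intro pair_measureI) auto
qed

lemma AE_in_A: "AE z in sa_dist S A. snd z \<in> A"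
proof -
  interpret P: prob_space "sa_dist S A" by (rule prob_space_sa_dist)
  have "P.prob (S \<times> A) = 1" using AE_sa_dist by (simp add: P.emeasure_eq_measure)
  then have "AE z in sa_dist S A. z \<in> S \<times> A" using AE_sa_dist(2) P.prob_eq_1 by blast
  then show ?thesis by eventually_elim auto
qed

lemma measurable_state_dist_cong: "measurable (state_dist S) N = measurable (restrict_space borel S) N"
  by (rule measurable_cong_sets) (auto simp: sets_state_dist)

lemma r_measurable: "a \<in> A \<Longrightarrow> (\<lambda>s. r s a) \<in> borel_measurable (state_dist S)"
  unfolding measurable_state_dist_cong by (intro borel_measurable_continuous_on_restrict r_cont)

lemma g_measurable: "a \<in> A \<Longrightarrow> (\<lambda>s. g s a dt) \<in> borel_measurable (state_dist S)"
proof -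
  assume "a \<in> A"
  have "measurable (state_dist S) (borel :: (real^'d) measure) = measurable (restrict_space lborel S) borel"
    by (rule measurable_cong_sets) (auto simp: sets_state_dist sets_restrict_space)
  then show ?thesis using g_meas[OF \<open>a \<in> A\<close>] by simp
qed

lemma resnet_measurable_state: "resnet m D L \<theta> \<in> borel_measurable (state_dist S)"
  unfolding measurable_state_dist_cong by (intro measurable_restrict_space1) simp

lemma bellman_lin_measurable: "bellman_lin A m D L g \<gamma> dt \<Theta> \<in> borel_measurable (sa_dist S A)"
proof (rule sa_dist_measurable)
  fix a
  show "(\<lambda>s. bellman_lin A m D L g \<gamma> dt \<Theta> (s, a)) \<in> borel_measurable (state_dist S)"
  proof (cases "a \<in> A")
    case True
    have "(\<lambda>s. resnet m D L (\<Theta> a') (g s a dt)) \<in> borel_measurable (state_dist S)" for a'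
      by (rule measurable_compose[OF g_measurable[OF True] resnet_measurable])
    then have "(\<lambda>s. Max ((\<lambda>a'. resnet m D L (\<Theta> a') (g s a dt)) ` A)) \<in> borel_measurable (state_dist S)"
      using A by (intro borel_measurable_Max_image) auto
    then show ?thesis
      using True resnet_measurable_state by (simp add: bellman_lin_def)
  qed (simp add: bellman_lin_def)
qed

lemma bellman_loss_measurable: "bellman_loss A m D L r g \<gamma> dt \<Theta> \<in> borel_measurable (sa_dist S A)"
proof (rule sa_dist_measurable)
  fix a
  have *: "(\<lambda>s. bellman_lin A m D L g \<gamma> dt \<Theta> (s, a)) \<in> borel_measurable (state_dist S)"
  proof -
    have "(\<lambda>s. (s, a)) \<in> measurable (state_dist S) (sa_dist S A)"
      unfolding sa_dist_def by (intro measurable_Pair) auto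
    then show ?thesis by (rule measurable_compose[OF _ bellman_lin_measurable])
  qed
  show "(\<lambda>s. bellman_loss A m D L r g \<gamma> dt \<Theta> (s, a)) \<in> borel_measurable (state_dist S)"
  proof (cases "a \<in> A")
    case True
    then show ?thesis using * r_measurable unfolding bellman_loss_def by auto
  qed (simp add: bellman_loss_def bellman_lin_def)
qed

lemma bellman_lin_bounded:
  assumes "z \<in> space (sa_dist S A)" "family_path_norm A m D L \<Theta> \<le> Q"
  shows "\<bar>bellman_lin A m D L g \<gamma> dt \<Theta> z\<bar> \<le> 2 * Q"
  using assms \<gamma> S_abs g_in by (intro bellman_lin_bound A) (auto simp: space_sa_dist)

lemma bellman_loss_bounded:
  assumes z: "z \<in> space (sa_dist S A)" and Q: "family_path_norm A m D L \<Theta> \<le> Q"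
  shows "\<bar>bellman_loss A m D L r g \<gamma> dt \<Theta> z\<bar> \<le> (2 * Q + 1) * (2 * Q)"
proof (cases "snd z \<in> A")
  case True
  have Q0: "0 \<le> Q" using Q family_path_norm_nonneg[of A m D L \<Theta>] by linarith
  have "\<bar>bellman_loss A m D L r g \<gamma> dt \<Theta> z - (0\<^sup>2 / 2 - r (fst z) (snd z) * 0)\<bar>
      \<le> (2 * Q + 1) * \<bar>bellman_lin A m D L g \<gamma> dt \<Theta> z - 0\<bar>"
    unfolding bellman_loss_def using True z Q0 bellman_lin_bounded[OF z Q]
    by (intro quadratic_loss_lipschitz r_bound) (auto simp: space_sa_dist)
  also have "\<dots> \<le> (2 * Q + 1) * (2 * Q)"
    using bellman_lin_bounded[OF z Q] Q0 by (intro mult_left_mono) auto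
  finally show ?thesis by simp
next
  case False
  have Q0: "0 \<le> Q" using Q family_path_norm_nonneg[of A m D L \<Theta>] by linarith
  then show ?thesis using False by (simp add: bellman_loss_def bellman_lin_def split_beta)
qed

lemma bellman_loss_integrable: "integrable (sa_dist S A) (bellman_loss A m D L r g \<gamma> dt \<Theta>)"
proof -
  interpret P: prob_space "sa_dist S A" by (rule prob_space_sa_dist)
  show ?thesis
    using bellman_loss_bounded[OF _ order.refl, of _ m D L \<Theta>] bellman_loss_measurable
    by (intro P.integrable_const_bound[where B = "(2 * family_path_norm A m D L \<Theta> + 1) * (2 * family_path_norm A m D L \<Theta>)"]) auto
qed

lemma bellman_loss_close:
  assumes z: "z \<in> space (sa_dist S A)"
    and Q: "family_path_norm A m D L \<Theta> \<le> Q" "family_path_norm A m D L \<Theta>' \<le> Q"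
    and close: "\<And>a s. a \<in> A \<Longrightarrow> s \<in> S \<Longrightarrow> \<bar>resnet m D L (\<Theta> a) s - resnet m D L (\<Theta>' a) s\<bar> \<le> \<eta>"
    and \<eta>: "0 \<le> \<eta>"
  shows "\<bar>bellman_loss A m D L r g \<gamma> dt \<Theta> z - bellman_loss A m D L r g \<gamma> dt \<Theta>' z\<bar> \<le> (2 * Q + 1) * (2 * \<eta>)"
proof (cases "snd z \<in> A")
  case True
  have Q0: "0 \<le> Q" using Q family_path_norm_nonneg[of A m D L \<Theta>] by linarith
  obtain s a where za: "z = (s, a)" "s \<in> S" "a \<in> A" using z True by (cases z) (auto simp: space_sa_dist)
  let ?M = "\<lambda>\<Theta>. Max ((\<lambda>a'. resnet m D L (\<Theta> a') (g s a dt)) ` A)"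
  have "\<bar>?M \<Theta> - ?M \<Theta>'\<bar> \<le> \<eta>"
    using za g_in by (intro abs_Max_diff_le A close) auto
  then have "\<bar>\<gamma> * (?M \<Theta> - ?M \<Theta>')\<bar> \<le> 1 * \<eta>"
    unfolding abs_mult using \<gamma> by (intro mult_mono) auto
  then have lin: "\<bar>bellman_lin A m D L g \<gamma> dt \<Theta> z - bellman_lin A m D L g \<gamma> dt \<Theta>' z\<bar> \<le> 2 * \<eta>"
    using za close[of a s] by (simp add: bellman_lin_def right_diff_distrib)
  have "\<bar>bellman_loss A m D L r g \<gamma> dt \<Theta> z - bellman_loss A m D L r g \<gamma> dt \<Theta>' z\<bar>
      \<le> (2 * Q + 1) * \<bar>bellman_lin A m D L g \<gamma> dt \<Theta> z - bellman_lin A m D L g \<gamma> dt \<Theta>' z\<bar>"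
    unfolding bellman_loss_def using bellman_lin_bounded[OF z Q(1)] bellman_lin_bounded[OF z Q(2)] za
    by (intro quadratic_loss_lipschitz r_bound) auto
  also have "\<dots> \<le> (2 * Q + 1) * (2 * \<eta>)"
    using lin Q0 by (intro mult_left_mono) auto
  finally show ?thesis .
next
  case False
  have Q0: "0 \<le> Q" using Q family_path_norm_nonneg[of A m D L \<Theta>] by linarith
  then show ?thesis using False \<eta> by (simp add: bellman_loss_def bellman_lin_def split_beta)
qed

section \<open>Deviation at one level and at all levels\<close>

abbreviation (input) "mean_loss m D L \<Theta> \<equiv> integral\<^sup>L (sa_dist S A) (bellman_loss A m D L r g \<gamma> dt \<Theta>)"

text \<open>The tail bound is applied on a finite net to the loss and to its negative. Each gets
  failure probability \<open>\<delta> / 2\<close>, whence \<open>2 * K / \<delta>\<close> under the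
  logarithm; the passage from the net to the whole ball is the \<open>+ 1\<close>.\<close>

lemma bellman_deviation_level:
  fixes m D L n :: nat and Q \<delta> :: real
  defines "K \<equiv> real (card A) * 3 ^ L * (2 * real CARD('d))"
  assumes n: "0 < n" and Q: "0 < Q" and \<delta>: "0 < \<delta>" "\<delta> < 2 * K"
  shows "\<exists>B\<in>sets (sample_dist S A n). emeasure (sample_dist S A n) B \<le> ennreal \<delta> \<and>
    (\<forall>Z\<in>space (sample_dist S A n) - B. \<forall>\<Theta>. family_path_norm A m D L \<Theta> \<le> Q \<longrightarrow>
      \<bar>mean_loss m D L \<Theta> - (\<Sum>i<n. bellman_loss A m D L r g \<gamma> dt \<Theta> (Z i)) / real n\<bar>
        \<le> (4 * real (card A) * (2 * Q + 1) * Q * sqrt (2 * ln (2 * K / \<delta>)) + 1) / sqrt (real n))"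
proof -
  interpret P: prob_space "sa_dist S A" by (rule prob_space_sa_dist)
  let ?P = "sample_dist S A n"
  let ?l = "bellman_loss A m D L r g \<gamma> dt"
  have P_def: "?P = PiM {..<n} (\<lambda>_. sa_dist S A)" by (simp add: sample_dist_def)
  define c where "c = 4 * real (card A) * (2 * Q + 1) * Q"
  have c: "c > 0" using A Q by (simp add: c_def card_gt_0_iff)
  have K: "0 < K" using \<delta> by linarith
  \<comment> \<open>The solution of \<open>K * exp (- (real n * t\<^sup>2 / (2 * c\<^sup>2))) =
    \<delta> / 2\<close>.\<close>
  define t where "t = c * sqrt (2 * ln (2 * K / \<delta>)) / sqrt (real n)"
  have lnpos: "0 < ln (2 * K / \<delta>)" using \<delta> by simp
  then have t: "t > 0" using c n by (simp add: t_def)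
  \<comment> \<open>With this mesh the loss changes by at most \<open>u / 2\<close> when a family is
    replaced by its neighbour in the net. The replacement happens twice, in the mean and in the
    empirical average.\<close>
  define \<eta> where "\<eta> = 1 / (4 * (2 * Q + 1) * sqrt (real n))"
  have \<eta>: "\<eta> > 0" using Q n by (simp add: \<eta>_def)
  define u where "u = 1 / sqrt (real n)"
  have \<eta>2: "(2 * Q + 1) * (2 * \<eta>) = u / 2"
    using Q n by (simp add: \<eta>_def u_def divide_simps)
  obtain N :: "(nat \<Rightarrow> 'd rnparam) set"
    where N: "finite N" "N \<subseteq> {\<Theta>. family_path_norm A m D L \<Theta> \<le> Q}"
    and net: "\<And>\<Theta>. family_path_norm A m D L \<Theta> \<le> Q \<Longrightarrow>
       \<exists>\<Theta>'\<in>N. \<forall>a\<in>A. \<forall>s\<in>S. \<bar>resnet m D L (\<Theta> a) s - resnet m D L (\<Theta>' a) s\<bar> \<le> \<eta>"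
    using resnet_family_finite_net[OF S_compact S_abs A(1) less_imp_le[OF Q] \<eta>, of m D L] by metis
  define B where "B \<sigma> = {Z \<in> space ?P. \<exists>h\<in>N. real n * t \<le> (\<Sum>i<n. P.expectation (\<lambda>z. \<sigma> * ?l h z) - \<sigma> * ?l h (Z i))}" for \<sigma>
  have meas: "(\<lambda>z. \<sigma> * ?l h z) \<in> borel_measurable (sa_dist S A)" for \<sigma> h
    using bellman_loss_measurable by simp
  have Bsets: "B \<sigma> \<in> sets ?P" for \<sigma>
    unfolding B_def P_def using N(1) by (intro P.deviation_event_sets meas countable_finite)
  have Bprob: "emeasure ?P (B \<sigma>) \<le> ennreal (\<delta> / 2)" if \<sigma>: "\<sigma> = 1 \<or> \<sigma> = -1" for \<sigma>
  proof -
    have "emeasure ?P (B \<sigma>) \<le> ennreal (K * exp (- (real n * t\<^sup>2 / (2 * c\<^sup>2))))"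
      unfolding B_def P_def
    proof (rule P.uniform_deviation_tail[OF countable_finite[OF N(1)] meas _ _ less_imp_le[OF K] c t])
      fix h z assume "h \<in> N" "z \<in> space (sa_dist S A)"
      then show "\<bar>\<sigma> * ?l h z\<bar> \<le> (2 * Q + 1) * (2 * Q)"
        using \<sigma> N(2) bellman_loss_bounded[of z m D L h Q] by auto
    next
      fix Z :: "nat \<Rightarrow> (real^'d) \<times> nat" and s :: real
      assume Z: "Z \<in> space (PiM {..<n} (\<lambda>_. sa_dist S A))" and s: "0 < s"
      have Zi: "fst (Z i) \<in> S" if "i < n" for i
        using Z that by (auto simp: space_PiM PiE_iff space_sa_dist dest: bspec[of _ _ i])
      have "rmgf n N (\<lambda>h i. 2 * s * ?l h (Z i)) \<le> ennreal (K * exp (real n * (s * c)\<^sup>2 / 2))"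
        unfolding K_def c_def using Zi N(2) s Q \<gamma> S_abs g_in r_bound
        by (intro rmgf_bellman_loss A) auto
      then show "rmgf n N (\<lambda>h i. 2 * s * (\<sigma> * ?l h (Z i))) \<le> ennreal (K * exp (real n * (s * c)\<^sup>2 / 2))"
        using \<sigma> rmgf_minus[of n N "\<lambda>h i. 2 * s * ?l h (Z i)"] by auto
    qed
    also have "real n * t\<^sup>2 / (2 * c\<^sup>2) = ln (2 * K / \<delta>)"
      using c n lnpos by (simp add: t_def power_divide power_mult_distrib)
    also have "K * exp (- ln (2 * K / \<delta>)) = \<delta> / 2"
      using K \<delta> by (simp add: exp_minus)
    finally show ?thesis .
  qed
  show ?thesis
  proof (intro bexI[of _ "B 1 \<union> B (-1)"] conjI ballI allI impI)
    have "emeasure ?P (B 1 \<union> B (-1)) \<le> emeasure ?P (B 1) + emeasure ?P (B (-1))"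
      using Bsets by (intro emeasure_subadditive) auto
    also have "\<dots> \<le> ennreal (\<delta> / 2) + ennreal (\<delta> / 2)"
      using Bprob by (intro add_mono) auto
    also have "\<dots> = ennreal \<delta>" using \<delta> by (simp flip: ennreal_plus)
    finally show "emeasure ?P (B 1 \<union> B (-1)) \<le> ennreal \<delta>" .
    fix Z and \<Theta> :: "nat \<Rightarrow> 'd rnparam"
    assume Z: "Z \<in> space ?P - (B 1 \<union> B (-1))" and \<Theta>: "family_path_norm A m D L \<Theta> \<le> Q"
    obtain \<Theta>' where \<Theta>': "\<Theta>' \<in> N" and close: "\<And>a s. a \<in> A \<Longrightarrow> s \<in> S \<Longrightarrow> \<bar>resnet m D L (\<Theta> a) s - resnet m D L (\<Theta>' a) s\<bar> \<le> \<eta>"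
      using net[OF \<Theta>] by blast
    have Q': "family_path_norm A m D L \<Theta>' \<le> Q" using \<Theta>' N(2) by blast
    have lclose: "\<bar>?l \<Theta> z - ?l \<Theta>' z\<bar> \<le> u / 2" if "z \<in> space (sa_dist S A)" for z
      using bellman_loss_close[OF that \<Theta> Q' close less_imp_le[OF \<eta>]] by (simp add: \<eta>2)
    have Zi: "Z i \<in> space (sa_dist S A)" if "i < n" for i
      using Z that by (auto simp: P_def space_PiM PiE_iff)
    have "mean_loss m D L \<Theta> - mean_loss m D L \<Theta>' = P.expectation (\<lambda>z. ?l \<Theta> z - ?l \<Theta>' z)"
      by (intro Bochner_Integration.integral_diff[symmetric] bellman_loss_integrable)
    moreover have "\<bar>P.expectation (\<lambda>z. ?l \<Theta> z - ?l \<Theta>' z)\<bar> \<le> P.expectation (\<lambda>z. \<bar>?l \<Theta> z - ?l \<Theta>' z\<bar>)"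
      by (rule integral_abs_bound)
    moreover have "P.expectation (\<lambda>z. \<bar>?l \<Theta> z - ?l \<Theta>' z\<bar>) \<le> P.expectation (\<lambda>z. u / 2)"
      using lclose by (intro integral_mono integrable_abs Bochner_Integration.integrable_diff bellman_loss_integrable) auto
    moreover have "P.expectation (\<lambda>z. u / 2) = u / 2"
      by (simp add: P.prob_space)
    ultimately have d1: "\<bar>mean_loss m D L \<Theta> - mean_loss m D L \<Theta>'\<bar> \<le> u / 2"
      by linarith
    have "\<bar>(\<Sum>i<n. ?l \<Theta> (Z i)) - (\<Sum>i<n. ?l \<Theta>' (Z i))\<bar> \<le> (\<Sum>i<n. u / 2)"
      unfolding sum_subtractf[symmetric] using lclose Zi by (intro order.trans[OF sum_abs] sum_mono) auto
    then have "\<bar>(\<Sum>i<n. ?l \<Theta> (Z i)) - (\<Sum>i<n. ?l \<Theta>' (Z i))\<bar> \<le> real n * (u / 2)" by simp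
    then have "\<bar>(\<Sum>i<n. ?l \<Theta> (Z i)) - (\<Sum>i<n. ?l \<Theta>' (Z i))\<bar> / real n \<le> u / 2"
      using n by (simp add: pos_divide_le_eq mult.commute)
    then have d2: "\<bar>(\<Sum>i<n. ?l \<Theta> (Z i)) / real n - (\<Sum>i<n. ?l \<Theta>' (Z i)) / real n\<bar> \<le> u / 2"
      using n by (simp add: diff_divide_distrib[symmetric])
    have "(\<Sum>i<n. P.expectation (\<lambda>z. \<sigma> * ?l \<Theta>' z) - \<sigma> * ?l \<Theta>' (Z i)) < real n * t" if "\<sigma> = 1 \<or> \<sigma> = -1" for \<sigma>
      using Z \<Theta>' that by (auto simp: B_def not_le)
    from this[of 1] this[of "-1"]
    have "\<bar>real n * mean_loss m D L \<Theta>' - (\<Sum>i<n. ?l \<Theta>' (Z i))\<bar> \<le> real n * t"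
      by (simp add: sum_subtractf sum_negf)
    then have "\<bar>real n * mean_loss m D L \<Theta>' - (\<Sum>i<n. ?l \<Theta>' (Z i))\<bar> / real n \<le> t"
      using n by (simp add: pos_divide_le_eq mult.commute)
    then have "\<bar>(real n * mean_loss m D L \<Theta>' - (\<Sum>i<n. ?l \<Theta>' (Z i))) / real n\<bar> \<le> t"
      using n by simp
    then have "\<bar>mean_loss m D L \<Theta>' - (\<Sum>i<n. ?l \<Theta>' (Z i)) / real n\<bar> \<le> t"
      using n by (simp add: diff_divide_distrib)
    with d1 d2 have "\<bar>mean_loss m D L \<Theta> - (\<Sum>i<n. ?l \<Theta> (Z i)) / real n\<bar> \<le> t + u"
      by linarith
    then show "\<bar>mean_loss m D L \<Theta> - (\<Sum>i<n. ?l \<Theta> (Z i)) / real n\<bar>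
        \<le> (4 * real (card A) * (2 * Q + 1) * Q * sqrt (2 * ln (2 * K / \<delta>)) + 1) / sqrt (real n)"
      by (simp add: t_def c_def u_def add_divide_distrib)
  qed (use Bsets in auto)
qed

text \<open>Level \<open>Q = k + 1\<close> receives the share
  \<open>\<delta> / ((k + 1) * (k + 2))\<close>, and the shares telescope to
  \<open>\<delta>\<close>. The event is also intersected with the samples in
  \<open>S \<times> A\<close>, which have probability one, so that later the facts about actions in
  \<open>A\<close> hold pointwise.\<close>

lemma bellman_deviation_event:
  fixes m D L n :: nat and \<delta> :: real
  defines "K \<equiv> real (card A) * 3 ^ L * (2 * real CARD('d))"
  assumes n: "0 < n" and \<delta>: "0 < \<delta>" "\<delta> < 1"
  shows "\<exists>E\<in>sets (sample_dist S A n). measure (sample_dist S A n) E \<ge> 1 - \<delta> \<and>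
    (\<forall>Z\<in>E. (\<forall>i<n. fst (Z i) \<in> S \<and> snd (Z i) \<in> A) \<and>
      (\<forall>k::nat. \<forall>\<Theta>. family_path_norm A m D L \<Theta> \<le> real k + 1 \<longrightarrow>
      \<bar>mean_loss m D L \<Theta> - (\<Sum>i<n. bellman_loss A m D L r g \<gamma> dt \<Theta> (Z i)) / real n\<bar>
        \<le> (4 * real (card A) * (2 * (real k + 1) + 1) * (real k + 1)
             * sqrt (2 * ln (2 * K * ((real k + 1) * (real k + 2)) / \<delta>)) + 1) / sqrt (real n)))"
proof -
  interpret P: prob_space "sa_dist S A" by (rule prob_space_sa_dist)
  interpret PS: product_sigma_finite "\<lambda>_ :: nat. sa_dist S A" by standard
  let ?P = "sample_dist S A n"
  have P_def: "?P = PiM {..<n} (\<lambda>_. sa_dist S A)" by (simp add: sample_dist_def)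
  interpret PP: prob_space ?P unfolding P_def by (intro prob_space_PiM prob_space_sa_dist)
  have "1 * 1 * (2 * 1) \<le> real (card A) * 3 ^ L * (2 * real CARD('d))"
    using A by (intro mult_mono) (auto simp: Suc_le_eq card_gt_0_iff)
  then have K: "2 \<le> K" by (simp add: K_def)
  define d where "d k = \<delta> / ((real k + 1) * (real k + 2))" for k :: nat
  have d: "0 < d k" "d k < 2 * K" for k
  proof -
    show "0 < d k" using \<delta> by (simp add: d_def)
    have "1 * 1 \<le> (real k + 1) * (real k + 2)" by (intro mult_mono) auto
    then have "d k \<le> \<delta>" using \<delta> by (simp add: d_def pos_divide_le_eq mult_le_cancel_left1)
    then show "d k < 2 * K" using \<delta> K by linarith
  qed
  have "\<forall>k::nat. \<exists>B. B \<in> sets ?P \<and> emeasure ?P B \<le> ennreal (d k) \<and>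
    (\<forall>Z\<in>space ?P - B. \<forall>\<Theta>. family_path_norm A m D L \<Theta> \<le> real k + 1 \<longrightarrow>
      \<bar>mean_loss m D L \<Theta> - (\<Sum>i<n. bellman_loss A m D L r g \<gamma> dt \<Theta> (Z i)) / real n\<bar>
        \<le> (4 * real (card A) * (2 * (real k + 1) + 1) * (real k + 1) * sqrt (2 * ln (2 * K / d k)) + 1) / sqrt (real n))"
  proof
    fix k :: nat
    have pos: "0 < real k + 1" by simp
    show "\<exists>B. B \<in> sets ?P \<and> emeasure ?P B \<le> ennreal (d k) \<and>
      (\<forall>Z\<in>space ?P - B. \<forall>\<Theta>. family_path_norm A m D L \<Theta> \<le> real k + 1 \<longrightarrow>
        \<bar>mean_loss m D L \<Theta> - (\<Sum>i<n. bellman_loss A m D L r g \<gamma> dt \<Theta> (Z i)) / real n\<bar>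
          \<le> (4 * real (card A) * (2 * (real k + 1) + 1) * (real k + 1) * sqrt (2 * ln (2 * K / d k)) + 1) / sqrt (real n))"
      unfolding Bex_def[symmetric]
      by (rule bellman_deviation_level[OF n pos d(1) d(2)[unfolded K_def], folded K_def])
  qed
  from choice[OF this] obtain B where B: "\<And>k. B k \<in> sets ?P" "\<And>k. emeasure ?P (B k) \<le> ennreal (d k)"
    and dev: "\<And>k Z \<Theta>. Z \<in> space ?P - B k \<Longrightarrow> family_path_norm A m D L \<Theta> \<le> real k + 1 \<Longrightarrow>
      \<bar>mean_loss m D L \<Theta> - (\<Sum>i<n. bellman_loss A m D L r g \<gamma> dt \<Theta> (Z i)) / real n\<bar>
        \<le> (4 * real (card A) * (2 * (real k + 1) + 1) * (real k + 1) * sqrt (2 * ln (2 * K / d k)) + 1) / sqrt (real n)"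
    by blast
  have "(\<lambda>k. 1 / (real k + 1) - 1 / (real (Suc k) + 1)) sums (1 / (real 0 + 1) - 0)"
    by (rule telescope_sums') real_asymp
  then have "(\<lambda>k. \<delta> * (1 / (real k + 1) - 1 / (real (Suc k) + 1))) sums (\<delta> * 1)"
    by (intro sums_mult) simp
  moreover have "\<delta> * (1 / (real k + 1) - 1 / (real (Suc k) + 1)) = d k" for k
    unfolding d_def by (simp add: divide_simps)
  ultimately have sums: "d sums \<delta>" by simp
  have "emeasure ?P (\<Union>k. B k) \<le> (\<Sum>k. emeasure ?P (B k))"
    using B(1) by (intro emeasure_subadditive_countably) auto
  also have "\<dots> \<le> (\<Sum>k. ennreal (d k))"
    using B(2) by (intro suminf_le) auto
  also have "\<dots> = ennreal \<delta>"
    using sums d(1) by (subst suminf_ennreal2) (auto simp: sums_iff less_imp_le)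
  finally have prob_B: "PP.prob (\<Union>k. B k) \<le> \<delta>"
    using \<delta> by (simp add: PP.emeasure_eq_measure ennreal_le_iff)
  define G where "G = PiE {..<n} (\<lambda>_. S \<times> A)"
  have G: "G \<in> sets ?P" unfolding G_def P_def by (intro sets_PiM_I_finite AE_sa_dist) auto
  have "emeasure ?P G = 1"
    unfolding G_def P_def using AE_sa_dist by (subst PS.emeasure_PiM) auto
  then have prob_G: "PP.prob G = 1" by (simp add: PP.emeasure_eq_measure)
  show ?thesis
  proof (intro bexI[of _ "G - (\<Union>k. B k)"] conjI ballI allI impI)
    show sets: "G - (\<Union>k. B k) \<in> sets ?P" using G B(1) by auto
    have "1 \<le> PP.prob ((G - (\<Union>k. B k)) \<union> (\<Union>k. B k))"
      unfolding prob_G[symmetric] using sets G B(1) by (intro PP.finite_measure_mono sets.Un sets.countable_UN) auto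
    also have "\<dots> \<le> PP.prob (G - (\<Union>k. B k)) + PP.prob (\<Union>k. B k)"
      using sets B(1) by (intro measure_Un_le) auto
    finally show "1 - \<delta> \<le> measure ?P (G - (\<Union>k. B k))" using prob_B by linarith
    fix Z assume Z: "Z \<in> G - (\<Union>k. B k)"
    {
      fix i assume "i < n"
      then have "Z i \<in> S \<times> A" using Z by (auto simp: G_def PiE_iff)
      then show "fst (Z i) \<in> S" "snd (Z i) \<in> A" by auto
    }
    fix k and \<Theta> :: "nat \<Rightarrow> 'd rnparam"
    assume "family_path_norm A m D L \<Theta> \<le> real k + 1"
    moreover have "Z \<in> space ?P - B k" using Z sets.sets_into_space[OF G] by auto
    moreover have "2 * K / d k = 2 * K * ((real k + 1) * (real k + 2)) / \<delta>"
      by (simp add: d_def)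
    ultimately show "\<bar>mean_loss m D L \<Theta> - (\<Sum>i<n. bellman_loss A m D L r g \<gamma> dt \<Theta> (Z i)) / real n\<bar>
        \<le> (4 * real (card A) * (2 * (real k + 1) + 1) * (real k + 1)
             * sqrt (2 * ln (2 * K * ((real k + 1) * (real k + 2)) / \<delta>)) + 1) / sqrt (real n)"
      using dev[of Z k \<Theta>] by simp
  qed
qed

end

section \<open>Approximation of Barron functions by two-layer networks\<close>

lemma abs_inner_le_l1norm:
  fixes w x :: "real^'d::finite"
  assumes "\<And>i. \<bar>x $ i\<bar> \<le> M"
  shows "\<bar>w \<bullet> x\<bar> \<le> M * l1norm w"
proof -
  have "0 \<le> M" using assms[of undefined] by linarith
  then have "\<bar>\<Sum>i\<in>UNIV. w $ i * x $ i\<bar> \<le> M * (\<Sum>i\<in>UNIV. \<bar>w $ i\<bar> * 1)"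
    using assms by (intro sum_mult_le_bound) auto
  then show ?thesis by (simp add: inner_vec_def l1norm_def)
qed

lemma l1norm_nonneg: "0 \<le> l1norm w"
  unfolding l1norm_def by (intro sum_nonneg) auto

lemma relu_measurable [measurable]: "relu \<in> borel_measurable borel"
  unfolding relu_def[abs_def] by measurable

lemma abs_neuron_le:
  fixes w x :: "real^'d::finite"
  assumes "\<And>i. \<bar>x $ i\<bar> \<le> 1"
  shows "\<bar>u * relu (w \<bullet> x)\<bar> \<le> \<bar>u\<bar> * l1norm w"
proof -
  have "\<bar>relu (w \<bullet> x)\<bar> \<le> l1norm w"
    using order.trans[OF relu_abs_le abs_inner_le_l1norm[of x 1 w]] assms by simp
  then show ?thesis by (simp add: abs_mult mult_left_mono)
qed

text \<open>The bound on \<open>(h x)\<^sup>2\<close>, which is nonnegativity of the variance,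
  settles the case of Barron norm \<open>0\<close>; the other moments feed the greedy
  construction.\<close>

lemma barron_rep_moments:
  fixes \<rho> :: "(real \<times> (real^'d::finite)) measure"
  assumes rep: "barron_rep X h \<rho>"
    and V: "(\<integral>\<^sup>+ p. ennreal ((fst p)\<^sup>2 * (l1norm (snd p))\<^sup>2) \<partial>\<rho>) \<le> ennreal V" "0 \<le> V"
  shows "integrable \<rho> (\<lambda>p. (fst p)\<^sup>2 * (l1norm (snd p))\<^sup>2)"
    and "(\<integral>p. (fst p)\<^sup>2 * (l1norm (snd p))\<^sup>2 \<partial>\<rho>) \<le> V"
    and "\<And>x. x \<in> X \<Longrightarrow> (\<And>i. \<bar>x $ i\<bar> \<le> 1) \<Longrightarrow> integrable \<rho> (\<lambda>p. (fst p * relu (snd p \<bullet> x))\<^sup>2)"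
    and "\<And>x. x \<in> X \<Longrightarrow> (\<And>i. \<bar>x $ i\<bar> \<le> 1) \<Longrightarrow> (\<integral>p. (fst p * relu (snd p \<bullet> x))\<^sup>2 \<partial>\<rho>) \<le> V"
    and "\<And>x. x \<in> X \<Longrightarrow> (\<And>i. \<bar>x $ i\<bar> \<le> 1) \<Longrightarrow> (h x)\<^sup>2 \<le> V"
proof -
  let ?P = "\<lambda>p :: real \<times> (real^'d). (fst p)\<^sup>2 * (l1norm (snd p))\<^sup>2"
  have \<rho>: "prob_space \<rho>" "sets \<rho> = sets borel" using rep by (auto simp: barron_rep_def)
  interpret R: prob_space \<rho> by fact
  have "?P \<in> borel_measurable borel"
    unfolding l1norm_def by (intro borel_measurable_continuous_onI continuous_intros)
  then have P_meas: "?P \<in> borel_measurable \<rho>"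
    using measurable_cong_sets[OF \<rho>(2) refl] by blast
  show intP: "integrable \<rho> ?P"
    using V(1) P_meas by (intro integrableI_bounded) (auto intro: le_less_trans)
  have "(\<integral>\<^sup>+ p. ennreal (?P p) \<partial>\<rho>) = ennreal (R.expectation ?P)"
    using intP by (intro nn_integral_eq_integral) auto
  then show EP: "R.expectation ?P \<le> V" using V ennreal_le_iff[OF V(2)] by metis
  fix x assume x: "x \<in> X" "\<And>i. \<bar>x $ i\<bar> \<le> 1"
  let ?G = "\<lambda>p. fst p * relu (snd p \<bullet> x)"
  have iG: "integrable \<rho> ?G" "h x = R.expectation ?G"
    using rep x(1) by (simp_all add: barron_rep_def split_beta')
  have G2: "(?G p)\<^sup>2 \<le> ?P p" for p
  proof -
    have "\<bar>?G p\<bar>\<^sup>2 \<le> (\<bar>fst p\<bar> * l1norm (snd p))\<^sup>2"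
      using abs_neuron_le x(2) by (intro power_mono) auto
    then show ?thesis by (simp add: power_mult_distrib)
  qed
  show iG2: "integrable \<rho> (\<lambda>p. (?G p)\<^sup>2)"
    using intP
  proof (rule Bochner_Integration.integrable_bound)
    show "AE p in \<rho>. norm ((?G p)\<^sup>2) \<le> norm (?P p)" using G2 by auto
    show "(\<lambda>p. (?G p)\<^sup>2) \<in> borel_measurable \<rho>"
      using borel_measurable_integrable[OF iG(1)] by measurable
  qed
  have "R.expectation (\<lambda>p. (?G p)\<^sup>2) \<le> R.expectation ?P"
    using G2 by (intro integral_mono iG2 intP) auto
  then show EG2: "R.expectation (\<lambda>p. (?G p)\<^sup>2) \<le> V" using EP by linarith
  have "0 \<le> R.variance ?G" by (intro integral_nonneg_AE) auto
  also have "R.variance ?G = R.expectation (\<lambda>p. (?G p)\<^sup>2) - (h x)\<^sup>2"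
    unfolding iG(2) by (rule R.variance_eq[OF iG(1) iG2])
  finally show "(h x)\<^sup>2 \<le> V" using EG2 by linarith
qed

text \<open>One step of the greedy (Maurey--Jones--Barron) construction: averaging over \<open>\<rho>\<close>
  shows that some neuron increases the squared error of the running sum by at most \<open>2 V\<close>,
  penalty included.\<close>

lemma barron_greedy_step:
  fixes M :: "(real^'d::finite) measure" and \<rho> :: "(real \<times> (real^'d)) measure"
  assumes M: "prob_space M" and id_meas: "(\<lambda>s. s) \<in> measurable M borel"
    and cube: "\<And>s i. s \<in> space M \<Longrightarrow> \<bar>s $ i\<bar> \<le> 1"
    and rep: "barron_rep (space M) h \<rho>"
    and V: "(\<integral>\<^sup>+ p. ennreal ((fst p)\<^sup>2 * (l1norm (snd p))\<^sup>2) \<partial>\<rho>) \<le> ennreal V" "0 \<le> V"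
    and h: "h \<in> borel_measurable M" "\<And>s. s \<in> space M \<Longrightarrow> \<bar>h s\<bar> \<le> C"
    and e: "e \<in> borel_measurable M" "\<And>s. s \<in> space M \<Longrightarrow> \<bar>e s\<bar> \<le> C"
  shows "\<exists>u w. (\<integral>s. (e s + u * relu (w \<bullet> s) - h s)\<^sup>2 \<partial>M) + u\<^sup>2 * (l1norm w)\<^sup>2 \<le> (\<integral>s. (e s)\<^sup>2 \<partial>M) + 2 * V"
proof -
  interpret M: prob_space M by fact
  have \<rho>: "prob_space \<rho>" "sets \<rho> = sets borel"
    and rep_int: "\<And>x. x \<in> space M \<Longrightarrow> integrable \<rho> (\<lambda>(u, w). u * relu (w \<bullet> x))"
    and rep_eq: "\<And>x. x \<in> space M \<Longrightarrow> h x = integral\<^sup>L \<rho> (\<lambda>(u, w). u * relu (w \<bullet> x))"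
    using rep by (auto simp: barron_rep_def)
  interpret R: prob_space \<rho> by fact
  interpret pair_sigma_finite \<rho> M by unfold_locales
  note [measurable_cong] = \<rho>(2)
  note [measurable] = id_meas h(1) e(1)
  obtain s0 where "s0 \<in> space M" using M.not_empty by blast
  then have C: "0 \<le> C" using h(2)[of s0] by linarith
  define P where "P p = (fst p)\<^sup>2 * (l1norm (snd p))\<^sup>2" for p :: "real \<times> (real^'d)"
  define G where "G p s = fst p * relu (snd p \<bullet> s)" for p :: "real \<times> (real^'d)" and s
  \<comment> \<open>The change in the squared error caused by adding the neuron \<open>p\<close>,
    plus the penalty of that neuron.\<close>
  define F where "F p s = 2 * e s * (G p s - h s) + (G p s - h s)\<^sup>2 + P p" for p s
  have intP: "integrable \<rho> P" and EP: "R.expectation P \<le> V"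
    using barron_rep_moments(1,2)[OF rep V] by (simp_all add: P_def[abs_def])
  have [measurable]: "P \<in> borel_measurable \<rho>" using intP by (rule borel_measurable_integrable)
  have "(\<lambda>z :: (real \<times> (real^'d)) \<times> (real^'d). fst (fst z) * relu (snd (fst z) \<bullet> snd z)) \<in> borel_measurable borel"
    unfolding relu_def by (intro borel_measurable_continuous_onI continuous_intros)
  moreover have "(\<lambda>z. (fst z, snd z)) \<in> measurable (\<rho> \<Otimes>\<^sub>M M) (borel :: ((real \<times> (real^'d)) \<times> (real^'d)) measure)"
  proof -
    have "(\<lambda>p. p) \<in> measurable \<rho> (borel :: (real \<times> (real^'d)) measure)"
      by (rule measurable_ident_sets[OF \<rho>(2)])
    then have "(\<lambda>z. (fst z, snd z)) \<in> measurable (\<rho> \<Otimes>\<^sub>M M) ((borel :: (real \<times> (real^'d)) measure) \<Otimes>\<^sub>M borel)"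
      using id_meas by (intro measurable_Pair measurable_compose[OF measurable_fst] measurable_compose[OF measurable_snd])
    then show ?thesis unfolding borel_prod .
  qed
  ultimately have "(\<lambda>z. fst (fst z) * relu (snd (fst z) \<bullet> snd z)) \<in> borel_measurable (\<rho> \<Otimes>\<^sub>M M)"
    using measurable_compose by fastforce
  then have [measurable]: "case_prod G \<in> borel_measurable (\<rho> \<Otimes>\<^sub>M M)"
    by (simp add: G_def split_beta')
  have [measurable]: "case_prod F \<in> borel_measurable (\<rho> \<Otimes>\<^sub>M M)" unfolding F_def by measurable
  have P0: "0 \<le> P p" for p by (simp add: P_def)
  have G2: "(G p s)\<^sup>2 \<le> P p" if "s \<in> space M" for p s
  proof -
    have "\<bar>G p s\<bar>\<^sup>2 \<le> (\<bar>fst p\<bar> * l1norm (snd p))\<^sup>2"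
      unfolding G_def using abs_neuron_le cube[OF that] by (intro power_mono) auto
    then show ?thesis by (simp add: P_def power_mult_distrib)
  qed
  have Fbound: "\<bar>F p s\<bar> \<le> 5 * P p + 6 * C\<^sup>2" if s: "s \<in> space M" for p s
  proof -
    have sq: "(e s)\<^sup>2 \<le> C\<^sup>2" "(h s)\<^sup>2 \<le> C\<^sup>2"
      using e(2)[OF s] h(2)[OF s] power_mono[of "\<bar>e s\<bar>" C 2] power_mono[of "\<bar>h s\<bar>" C 2] by auto
    have "\<bar>2 * e s * (G p s - h s)\<bar> \<le> (e s)\<^sup>2 + (G p s - h s)\<^sup>2"
    proof -
      have "0 \<le> (e s - (G p s - h s))\<^sup>2" "0 \<le> (e s + (G p s - h s))\<^sup>2" by auto
      then show ?thesis unfolding power2_diff[of "e s"] power2_sum[of "e s"] by linarith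
    qed
    moreover have "(G p s - h s)\<^sup>2 \<le> 2 * (G p s)\<^sup>2 + 2 * (h s)\<^sup>2"
    proof -
      have "0 \<le> (G p s + h s)\<^sup>2" by auto
      then show ?thesis unfolding power2_diff power2_sum by linarith
    qed
    moreover have "\<bar>F p s\<bar> \<le> \<bar>2 * e s * (G p s - h s)\<bar> + (G p s - h s)\<^sup>2 + P p"
      unfolding F_def using P0[of p] zero_le_power2[of "G p s - h s"] by linarith
    ultimately show ?thesis using sq G2[OF s, of p] zero_le_power2[of C] P0[of p] by linarith
  qed
  have intF: "integrable (\<rho> \<Otimes>\<^sub>M M) (case_prod F)"
  proof (rule Bochner_Integration.integrable_bound)
    have "integrable (distr (\<rho> \<Otimes>\<^sub>M M) \<rho> fst) (\<lambda>p. 5 * P p + 6 * C\<^sup>2)"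
      unfolding M.distr_pair_fst using intP by simp
    then show "integrable (\<rho> \<Otimes>\<^sub>M M) (\<lambda>z. 5 * P (fst z) + 6 * C\<^sup>2)"
      by (subst (asm) integrable_distr_eq) auto
    show "AE z in \<rho> \<Otimes>\<^sub>M M. norm (case_prod F z) \<le> norm (5 * P (fst z) + 6 * C\<^sup>2)"
    proof (rule AE_I2)
      fix z assume "z \<in> space (\<rho> \<Otimes>\<^sub>M M)"
      then have "\<bar>F (fst z) (snd z)\<bar> \<le> 5 * P (fst z) + 6 * C\<^sup>2"
        by (intro Fbound) (auto simp: space_pair_measure)
      then show "norm (case_prod F z) \<le> norm (5 * P (fst z) + 6 * C\<^sup>2)"
        using P0[of "fst z"] by (simp add: split_beta)
    qed
  qed measurable
  \<comment> \<open>The neuron has mean \<open>h s\<close>, which removes the term linear in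
    \<open>e s\<close>. What remains is a variance plus the mean penalty, each at most
    \<open>V\<close>.\<close>
  have inner: "(\<integral>p. F p s \<partial>\<rho>) \<le> 2 * V" if s: "s \<in> space M" for s
  proof -
    have iG: "integrable \<rho> (\<lambda>p. G p s)" "R.expectation (\<lambda>p. G p s) = h s"
      using rep_int[OF s] rep_eq[OF s] by (simp_all add: G_def split_beta')
    have iG2: "integrable \<rho> (\<lambda>p. (G p s)\<^sup>2)" "R.expectation (\<lambda>p. (G p s)\<^sup>2) \<le> V"
      using barron_rep_moments(3,4)[OF rep V s cube[OF s]] by (simp_all add: G_def)
    have "F p s = (2 * e s - 2 * h s) * G p s + (G p s)\<^sup>2 + P p + ((h s)\<^sup>2 - 2 * e s * h s)" for p
      by (simp add: F_def power2_eq_square algebra_simps)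
    then have "(\<integral>p. F p s \<partial>\<rho>) = (2 * e s - 2 * h s) * h s + R.expectation (\<lambda>p. (G p s)\<^sup>2) + R.expectation P + ((h s)\<^sup>2 - 2 * e s * h s)"
      using iG iG2(1) intP by (simp add: R.prob_space)
    also have "\<dots> = R.expectation (\<lambda>p. (G p s)\<^sup>2) + R.expectation P - (h s)\<^sup>2"
      by (simp add: power2_eq_square algebra_simps)
    finally show ?thesis using EP iG2(2) zero_le_power2[of "h s"] by linarith
  qed
  have "(\<integral>p. (\<integral>s. F p s \<partial>M) \<partial>\<rho>) = (\<integral>s. (\<integral>p. F p s \<partial>\<rho>) \<partial>M)"
    by (rule Fubini_integral[OF intF, symmetric])
  also have "\<dots> \<le> (\<integral>s. 2 * V \<partial>M)"
  proof (rule integral_mono)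
    show "integrable M (\<lambda>s. \<integral>p. F p s \<partial>\<rho>)" by (rule integrable_snd[OF intF])
  qed (use inner in auto)
  also have "\<dots> = 2 * V" by (simp add: M.prob_space)
  finally have EF: "(\<integral>p. (\<integral>s. F p s \<partial>M) \<partial>\<rho>) \<le> 2 * V" .
  have "\<exists>p\<in>space \<rho>. (\<integral>s. F p s \<partial>M) \<le> 2 * V"
  proof (rule ccontr)
    assume "\<not> ?thesis"
    then have "(\<integral>p. 2 * V \<partial>\<rho>) < (\<integral>p. (\<integral>s. F p s \<partial>M) \<partial>\<rho>)"
      using integrable_fst[OF intF]
      by (intro R.integral_less_AE_space) (auto simp: not_le R.emeasure_space_1)
    then show False using EF by (simp add: R.prob_space)
  qed
  then obtain p where p: "(\<integral>s. F p s \<partial>M) \<le> 2 * V" by blast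
  have bd: "integrable M f" if "f \<in> borel_measurable M" "\<And>s. s \<in> space M \<Longrightarrow> \<bar>f s\<bar> \<le> B" for f :: "real^'d \<Rightarrow> real" and B
    using that by (intro M.integrable_const_bound[of _ B]) auto
  have [measurable]: "G p \<in> borel_measurable M" unfolding G_def by measurable
  have iF: "integrable M (\<lambda>s. F p s)"
    using Fbound by (intro bd[of _ "5 * P p + 6 * C\<^sup>2"]) (auto simp: F_def)
  have ie: "integrable M (\<lambda>s. (e s)\<^sup>2)"
    using e(2) C by (intro bd[of _ "C\<^sup>2"]) (auto simp: abs_le_square_iff[symmetric] abs_of_nonneg[OF C])
  have "(\<integral>s. (e s + G p s - h s)\<^sup>2 \<partial>M) + P p = (\<integral>s. (e s)\<^sup>2 + F p s \<partial>M)"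
  proof -
    have eq: "(e s + G p s - h s)\<^sup>2 = (e s)\<^sup>2 + F p s - P p" for s
      by (simp add: F_def power2_eq_square algebra_simps)
    show ?thesis unfolding eq using iF ie by (simp add: M.prob_space)
  qed
  also have "\<dots> \<le> (\<integral>s. (e s)\<^sup>2 \<partial>M) + 2 * V"
    using iF ie p by simp
  finally show ?thesis
    unfolding G_def P_def by (intro exI[of _ "fst p"] exI[of _ "snd p"]) simp
qed

text \<open>The running sum is compared with \<open>real m * h\<close> and not normalized. Its
  squared error then grows only linearly in \<open>m\<close>, so a final division by the square of
  \<open>m\<close> gives the rate \<open>1 / m\<close>.\<close>

lemma barron_greedy:
  fixes M :: "(real^'d::finite) measure" and \<rho> :: "(real \<times> (real^'d)) measure"
  assumes M: "prob_space M" and id_meas: "(\<lambda>s. s) \<in> measurable M borel"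
    and cube: "\<And>s i. s \<in> space M \<Longrightarrow> \<bar>s $ i\<bar> \<le> 1"
    and rep: "barron_rep (space M) h \<rho>"
    and V: "(\<integral>\<^sup>+ p. ennreal ((fst p)\<^sup>2 * (l1norm (snd p))\<^sup>2) \<partial>\<rho>) \<le> ennreal V" "0 \<le> V"
    and h: "h \<in> borel_measurable M" "\<And>s. s \<in> space M \<Longrightarrow> \<bar>h s\<bar> \<le> C"
  shows "\<exists>u w. (\<integral>s. ((\<Sum>k<m. u k * relu (w k \<bullet> s)) - real m * h s)\<^sup>2 \<partial>M)
      + (\<Sum>k<m. (u k)\<^sup>2 * (l1norm (w k))\<^sup>2) \<le> 2 * real m * V"
proof (induction m)
  case (Suc m)
  then obtain u w where uw: "(\<integral>s. ((\<Sum>k<m. u k * relu (w k \<bullet> s)) - real m * h s)\<^sup>2 \<partial>M)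
      + (\<Sum>k<m. (u k)\<^sup>2 * (l1norm (w k))\<^sup>2) \<le> 2 * real m * V" by blast
  define e where "e s = (\<Sum>k<m. u k * relu (w k \<bullet> s)) - real m * h s" for s
  note [measurable] = id_meas h(1)
  have e_meas: "e \<in> borel_measurable M" unfolding e_def[abs_def] by measurable
  define C' where "C' = max C ((\<Sum>k<m. \<bar>u k\<bar> * l1norm (w k)) + real m * C)"
  have e_bd: "\<bar>e s\<bar> \<le> C'" if "s \<in> space M" for s
  proof -
    have "\<bar>\<Sum>k<m. u k * relu (w k \<bullet> s)\<bar> \<le> (\<Sum>k<m. \<bar>u k\<bar> * l1norm (w k))"
      using cube[OF that] by (intro order.trans[OF sum_abs] sum_mono abs_neuron_le) auto
    moreover have "\<bar>real m * h s\<bar> \<le> real m * C"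
      using h(2)[OF that] by (simp add: abs_mult mult_left_mono)
    ultimately show ?thesis by (simp add: e_def C'_def)
  qed
  have h_bd: "\<bar>h s\<bar> \<le> C'" if "s \<in> space M" for s using h(2)[OF that] by (simp add: C'_def)
  obtain u' w' where step: "(\<integral>s. (e s + u' * relu (w' \<bullet> s) - h s)\<^sup>2 \<partial>M) + u'\<^sup>2 * (l1norm w')\<^sup>2 \<le> (\<integral>s. (e s)\<^sup>2 \<partial>M) + 2 * V"
    using barron_greedy_step[OF M id_meas cube rep V h(1) h_bd e_meas e_bd] by blast
  have "(\<Sum>k<Suc m. (u(m := u')) k * relu ((w(m := w')) k \<bullet> s)) - real (Suc m) * h s
      = e s + u' * relu (w' \<bullet> s) - h s" for s
    by (simp add: e_def algebra_simps)
  then show ?case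
    using step uw unfolding e_def[symmetric]
    by (intro exI[of _ "u(m := u')"] exI[of _ "w(m := w')"]) (simp add: algebra_simps)
qed simp

text \<open>The accumulated penalty of the greedy steps bounds the sum of the weights by the
  Cauchy-Schwarz inequality, so one network has both small error and small norm.\<close>

lemma barron_approximation:
  fixes M :: "(real^'d::finite) measure"
  assumes M: "prob_space M" and id_meas: "(\<lambda>s. s) \<in> measurable M borel"
    and cube: "\<And>s i. s \<in> space M \<Longrightarrow> \<bar>s $ i\<bar> \<le> 1"
    and h: "h \<in> borel_measurable M" "\<And>s. s \<in> space M \<Longrightarrow> \<bar>h s\<bar> \<le> C"
    and fin: "barron_norm_sq (space M) h < \<infinity>" and m: "0 < m"
  shows "\<exists>c w. (\<integral>s. ((\<Sum>k<m. c k * relu (w k \<bullet> s)) - h s)\<^sup>2 \<partial>M) \<le> 4 * (barron_norm (space M) h)\<^sup>2 / real m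
    \<and> (\<Sum>k<m. \<bar>c k\<bar> * l1norm (w k)) \<le> 2 * barron_norm (space M) h"
proof -
  interpret M: prob_space M by fact
  define b where "b = barron_norm (space M) h"
  have b0: "0 \<le> b" by (simp add: b_def barron_norm_def)
  have b2: "barron_norm_sq (space M) h = ennreal (b\<^sup>2)"
    using fin unfolding b_def barron_norm_def by (simp add: less_top)
  have rep: "\<exists>\<rho>. barron_rep (space M) h \<rho> \<and> (\<integral>\<^sup>+ p. ennreal ((fst p)\<^sup>2 * (l1norm (snd p))\<^sup>2) \<partial>\<rho>) \<le> ennreal V"
    if "b\<^sup>2 < V" for V
  proof -
    have "barron_norm_sq (space M) h < ennreal V"
      unfolding b2 using that by (simp add: ennreal_less_iff)
    then show ?thesis unfolding barron_norm_sq_def INF_less_iff by (auto intro: less_imp_le)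
  qed
  show ?thesis
  \<comment> \<open>The infimum in the Barron norm need not be attained. For \<open>b > 0\<close> a
    representation with second moment at most \<open>2 * b\<^sup>2\<close> is taken, which is the
    origin of the constants 4 and 2. For \<open>b = 0\<close> all positive levels are available,
    \<open>h\<close> has mean square \<open>0\<close>, and the zero network will do.\<close>
  proof (cases "b = 0")
    case True
    have "(\<integral>s. (h s)\<^sup>2 \<partial>M) \<le> \<epsilon>" if \<epsilon>: "0 < \<epsilon>" for \<epsilon>
    proof -
      obtain \<rho> where \<rho>: "barron_rep (space M) h \<rho>"
        "(\<integral>\<^sup>+ p. ennreal ((fst p)\<^sup>2 * (l1norm (snd p))\<^sup>2) \<partial>\<rho>) \<le> ennreal (\<epsilon> / 4)"
        using rep[of "\<epsilon> / 4"] \<epsilon> True by auto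
      have sq: "(h s)\<^sup>2 \<le> \<epsilon>" if s: "s \<in> space M" for s
        using barron_rep_moments(5)[OF \<rho> _ s cube[OF s]] \<epsilon> by simp
      have "integrable M (\<lambda>s. (h s)\<^sup>2)"
        using sq h(1) by (intro M.integrable_const_bound[of _ \<epsilon>]) auto
      then have "(\<integral>s. (h s)\<^sup>2 \<partial>M) \<le> (\<integral>s. \<epsilon> \<partial>M)"
        using sq by (intro integral_mono) auto
      then show ?thesis by (simp add: M.prob_space)
    qed
    then have "(\<integral>s. (h s)\<^sup>2 \<partial>M) \<le> 0" by (metis dense_ge)
    then show ?thesis
      using True unfolding b_def[symmetric]
      by (intro exI[of _ "\<lambda>_. 0"] exI[of _ "\<lambda>_. 0"]) simp
  next
    case False
    then have "b\<^sup>2 < 2 * b\<^sup>2" by simp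
    from rep[OF this] obtain \<rho> where \<rho>: "barron_rep (space M) h \<rho>"
        "(\<integral>\<^sup>+ p. ennreal ((fst p)\<^sup>2 * (l1norm (snd p))\<^sup>2) \<partial>\<rho>) \<le> ennreal (2 * b\<^sup>2)" by auto
    obtain u w where uw: "(\<integral>s. ((\<Sum>k<m. u k * relu (w k \<bullet> s)) - real m * h s)\<^sup>2 \<partial>M)
        + (\<Sum>k<m. (u k)\<^sup>2 * (l1norm (w k))\<^sup>2) \<le> 2 * real m * (2 * b\<^sup>2)"
      using barron_greedy[OF M id_meas cube \<rho>(1,2) _ h, of m] by auto
    define c where "c k = u k / real m" for k
    have nn: "0 \<le> (\<integral>s. ((\<Sum>k<m. u k * relu (w k \<bullet> s)) - real m * h s)\<^sup>2 \<partial>M)"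
      "0 \<le> (\<Sum>k<m. (u k)\<^sup>2 * (l1norm (w k))\<^sup>2)"
      by (auto intro!: integral_nonneg_AE sum_nonneg)
    have sumle: "(\<Sum>k<m. (u k)\<^sup>2 * (l1norm (w k))\<^sup>2) \<le> 2 * real m * (2 * b\<^sup>2)"
      using uw nn by linarith
    have "((\<Sum>k<m. c k * relu (w k \<bullet> s)) - h s)\<^sup>2 = ((\<Sum>k<m. u k * relu (w k \<bullet> s)) - real m * h s)\<^sup>2 / (real m)\<^sup>2" for s
    proof -
      have "(\<Sum>k<m. c k * relu (w k \<bullet> s)) - h s = ((\<Sum>k<m. u k * relu (w k \<bullet> s)) - real m * h s) / real m"
        using m by (simp add: c_def diff_divide_distrib sum_divide_distrib)
      then show ?thesis by (simp add: power_divide)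
    qed
    then have "(\<integral>s. ((\<Sum>k<m. c k * relu (w k \<bullet> s)) - h s)\<^sup>2 \<partial>M)
        = (\<integral>s. ((\<Sum>k<m. u k * relu (w k \<bullet> s)) - real m * h s)\<^sup>2 \<partial>M) / (real m)\<^sup>2" by simp
    also have "\<dots> \<le> (2 * real m * (2 * b\<^sup>2)) / (real m)\<^sup>2"
      using uw nn by (intro divide_right_mono) auto
    also have "\<dots> = 4 * b\<^sup>2 / real m" using m by (simp add: power2_eq_square)
    finally have err: "(\<integral>s. ((\<Sum>k<m. c k * relu (w k \<bullet> s)) - h s)\<^sup>2 \<partial>M) \<le> 4 * b\<^sup>2 / real m" .
    have "(\<Sum>k<m. \<bar>u k\<bar> * l1norm (w k))\<^sup>2 \<le> (\<Sum>k<m. (\<bar>u k\<bar> * l1norm (w k))\<^sup>2) * real (card {..<m})"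
      by (rule sum_squared_le_sum_of_squares)
    also have "\<dots> \<le> (2 * real m * (2 * b\<^sup>2)) * real m"
      using sumle by (intro mult_mono) (auto simp: power_mult_distrib)
    also have "\<dots> = (2 * b * real m)\<^sup>2" by (simp add: power2_eq_square)
    finally have "(\<Sum>k<m. \<bar>u k\<bar> * l1norm (w k)) \<le> 2 * b * real m"
      by (rule power2_le_imp_le) (use b0 in simp)
    moreover have "(\<Sum>k<m. \<bar>c k\<bar> * l1norm (w k)) = (\<Sum>k<m. \<bar>u k\<bar> * l1norm (w k)) / real m"
      by (simp add: c_def sum_divide_distrib)
    ultimately have "(\<Sum>k<m. \<bar>c k\<bar> * l1norm (w k)) \<le> 2 * b"
      using m by (simp add: pos_divide_le_eq)
    with err show ?thesis unfolding b_def[symmetric] by blast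
  qed
qed

section \<open>A residual network computing a maximum\<close>

definition two_layer :: "nat \<Rightarrow> (nat \<Rightarrow> real) \<Rightarrow> (nat \<Rightarrow> real^('d::finite)) \<Rightarrow> real^'d \<Rightarrow> real" where
  "two_layer m c w x = (\<Sum>k<m. c k * relu (w k \<bullet> x))"

text \<open>Channels \<open>0, \<dots>, d - 1\<close> carry the input, channels \<open>d + i\<close> with \<open>i < 2\<^sup>\<alpha>\<close> carry the
  \<open>2\<^sup>\<alpha>\<close> two-layer networks computed in layer 1, and channel \<open>d + 2\<^sup>\<alpha>\<close> keeps a copy of network
  \<open>a\<close>. Layer \<open>t + 1\<close> with \<open>t \<ge> 1\<close> replaces channel \<open>d + i\<close>, \<open>i < 2\<^bsup>\<alpha> - t\<^esup>\<close>, by the maximum of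
  the channels \<open>d + i\<close> and \<open>d + i + 2\<^bsup>\<alpha> - t\<^esup>\<close>, using \<open>max x y = x + \<sigma>(y - x)\<close>.\<close>

definition max_net ::
  "nat \<Rightarrow> nat \<Rightarrow> (nat \<Rightarrow> 'd::finite) \<Rightarrow> (nat \<Rightarrow> nat \<Rightarrow> real) \<Rightarrow> (nat \<Rightarrow> nat \<Rightarrow> real^'d) \<Rightarrow> real \<Rightarrow> nat \<Rightarrow> 'd rnparam" where
  "max_net \<alpha> m e c w \<beta> a = \<lparr>
     pu = (\<lambda>j. if j = CARD('d) + 2 ^ \<alpha> then 1 else if j = CARD('d) then \<beta> else 0),
     pV = (\<lambda>j i. if j < CARD('d) \<and> e j = i then 1 else 0),
     pW = (\<lambda>l k q. if l = 1
       then (if q < CARD('d) \<and> k < 2 ^ \<alpha> * m then w (k div m) (k mod m) $ e q else 0)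
       else (if k < 2 ^ (\<alpha> + 1 - l)
         then (if q = CARD('d) + k + 2 ^ (\<alpha> + 1 - l) then 1 else 0) - (if q = CARD('d) + k then 1 else 0)
         else 0)),
     pU = (\<lambda>l j k. if l = 1
       then (if k < 2 ^ \<alpha> * m \<and> k div m = (if j = CARD('d) + 2 ^ \<alpha> then a else j - CARD('d)) \<and> CARD('d) \<le> j
         then c (k div m) (k mod m) else 0)
       else (if k < 2 ^ (\<alpha> + 1 - l) \<and> j = CARD('d) + k then 1 else 0)) \<rparr>"

text \<open>Neuron \<open>k\<close> of the first layer is neuron \<open>k mod m\<close> of the
  two-layer network number \<open>k div m\<close>; the condition selects one such block.\<close>

lemma sum_div_block:
  fixes F :: "nat \<Rightarrow> real"
  assumes "0 < m" "i < N" "N * m \<le> M"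
  shows "(\<Sum>k<M. if k < N * m \<and> k div m = i then F k else 0) = (\<Sum>k<m. F (i * m + k))"
proof -
  have inj: "inj_on (\<lambda>k. i * m + k) {..<m}" by (auto intro: inj_onI)
  have "i * m + m \<le> N * m"
    using assms(2) mult_le_mono1[of "Suc i" N m] by (simp add: algebra_simps)
  then have img: "(\<lambda>k. i * m + k) ` {..<m} = {k\<in>{..<M}. k < N * m \<and> k div m = i}"
  proof (intro equalityI subsetI)
    fix k assume "k \<in> {k\<in>{..<M}. k < N * m \<and> k div m = i}"
    then have "k = i * m + k mod m" "k mod m < m" using assms(1) by auto
    then show "k \<in> (\<lambda>k. i * m + k) ` {..<m}" by blast
  next
    fix k assume "k \<in> (\<lambda>k. i * m + k) ` {..<m}"
    then obtain k' where k': "k' < m" "k = i * m + k'" by auto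
    then have "k < N * m" "k div m = i" using \<open>i * m + m \<le> N * m\<close> by simp_all
    then show "k \<in> {k\<in>{..<M}. k < N * m \<and> k div m = i}" using assms(3) by simp
  qed
  have "(\<Sum>k<M. if k < N * m \<and> k div m = i then F k else 0) = (\<Sum>k\<in>{k\<in>{..<M}. k < N * m \<and> k div m = i}. F k)"
    by (simp add: sum.If_cases Int_def)
  also have "\<dots> = (\<Sum>k<m. F (i * m + k))"
    unfolding img[symmetric] using inj by (simp add: sum.reindex)
  finally show ?thesis .
qed

text \<open>One round of the tournament, in which entry \<open>i\<close> meets entry
  \<open>i + h\<close>.\<close>

lemma Max_pairs:
  fixes f :: "nat \<Rightarrow> real"
  assumes "0 < h"
  shows "Max ((\<lambda>i. max (f i) (f (i + h))) ` {..<h}) = Max (f ` {..<2 * h})"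
proof (rule antisym)
  show "Max ((\<lambda>i. max (f i) (f (i + h))) ` {..<h}) \<le> Max (f ` {..<2 * h})"
    using assms by (intro Max.boundedI) auto
  show "Max (f ` {..<2 * h}) \<le> Max ((\<lambda>i. max (f i) (f (i + h))) ` {..<h})"
  proof (rule Max.boundedI)
    fix y assume "y \<in> f ` {..<2 * h}"
    then obtain i where i: "i < 2 * h" "y = f i" by auto
    define i' where "i' = (if i < h then i else i - h)"
    have "y \<le> max (f i') (f (i' + h))" using i by (auto simp: i'_def)
    also have "\<dots> \<le> Max ((\<lambda>i. max (f i) (f (i + h))) ` {..<h})"
      using i assms by (intro Max_ge finite_imageI imageI) (auto simp: i'_def)
    finally show "y \<le> Max ((\<lambda>i. max (f i) (f (i + h))) ` {..<h})" .
  qed (use assms in \<open>auto simp: lessThan_empty_iff\<close>)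
qed

lemma sum_split_half:
  fixes f :: "nat \<Rightarrow> real"
  shows "(\<Sum>i<2 * h. f i) = (\<Sum>i<h. f i + f (i + h))"
proof -
  have "{..<2 * h} = {..<h} \<union> (\<lambda>i. i + h) ` {..<h}"
  proof (intro equalityI subsetI)
    fix i assume "i \<in> {..<2 * h}"
    then have "i < h \<or> i = (i - h) + h \<and> i - h < h" by auto
    then show "i \<in> {..<h} \<union> (\<lambda>i. i + h) ` {..<h}" by blast
  qed auto
  then have "(\<Sum>i<2 * h. f i) = sum f {..<h} + sum f ((\<lambda>i. i + h) ` {..<h})"
    by (simp only:) (rule sum.union_disjoint, auto)
  also have "sum f ((\<lambda>i. i + h) ` {..<h}) = (\<Sum>i<h. f (i + h))"
    by (subst sum.reindex) (auto simp: inj_on_def)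
  finally show ?thesis by (simp add: sum.distrib)
qed

context
  fixes \<alpha> m M D a :: nat and e :: "nat \<Rightarrow> 'd::finite" and c :: "nat \<Rightarrow> nat \<Rightarrow> real"
    and w :: "nat \<Rightarrow> nat \<Rightarrow> real^'d" and \<beta> :: real and \<theta> :: "'d rnparam"
  assumes e: "bij_betw e {..<CARD('d)} UNIV" and m: "0 < m" and M: "2 ^ \<alpha> * m \<le> M"
    and D: "D = CARD('d) + 2 ^ \<alpha> + 1" and a: "a < 2 ^ \<alpha>"
    and \<theta>: "\<theta> = max_net \<alpha> m e c w \<beta> a"
begin

section \<open>The layers of the tournament network\<close>

lemma net_simps:
  "pu \<theta> j = (if j = CARD('d) + 2 ^ \<alpha> then 1 else if j = CARD('d) then \<beta> else 0)"
  "pV \<theta> j i = (if j < CARD('d) \<and> e j = i then 1 else 0)"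
  "pW \<theta> 1 k q = (if q < CARD('d) \<and> k < 2 ^ \<alpha> * m then w (k div m) (k mod m) $ e q else 0)"
  "pW \<theta> (Suc 0) k q = (if q < CARD('d) \<and> k < 2 ^ \<alpha> * m then w (k div m) (k mod m) $ e q else 0)"
  "1 \<le> t \<Longrightarrow> pW \<theta> (Suc t) k q = (if k < 2 ^ (\<alpha> - t)
     then (if q = CARD('d) + k + 2 ^ (\<alpha> - t) then 1 else 0) - (if q = CARD('d) + k then 1 else 0) else 0)"
  "pU \<theta> 1 j k = (if k < 2 ^ \<alpha> * m \<and> k div m = (if j = CARD('d) + 2 ^ \<alpha> then a else j - CARD('d)) \<and> CARD('d) \<le> j
     then c (k div m) (k mod m) else 0)"
  "pU \<theta> (Suc 0) j k = (if k < 2 ^ \<alpha> * m \<and> k div m = (if j = CARD('d) + 2 ^ \<alpha> then a else j - CARD('d)) \<and> CARD('d) \<le> j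
     then c (k div m) (k mod m) else 0)"
  "1 \<le> t \<Longrightarrow> pU \<theta> (Suc t) j k = (if k < 2 ^ (\<alpha> - t) \<and> j = CARD('d) + k then 1 else 0)"
  by (auto simp: \<theta> max_net_def)

lemma sum_enc: "(\<Sum>q<D. if q < CARD('d) then f (e q) else 0) = (\<Sum>i\<in>UNIV. f i :: real)"
proof -
  have "(\<Sum>q<D. if q < CARD('d) then f (e q) else 0) = (\<Sum>q<CARD('d). f (e q))"
    using D by (intro sum.mono_neutral_cong_right) auto
  also have "\<dots> = (\<Sum>i\<in>UNIV. f i)" by (rule sum.reindex_bij_betw[OF e])
  finally show ?thesis .
qed

lemma hidden_0: "rn_hidden M D \<theta> x 0 j = (if j < CARD('d) then x $ e j else 0)"
  by (simp add: net_simps if_distrib[of "\<lambda>z. z * _"] cong: if_cong)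

lemma path_0: "rn_path M D \<theta> 0 j i = (if j < CARD('d) \<and> e j = i then 1 else 0)"
  by (simp add: net_simps)

text \<open>A general \<open>f\<close> serves the values, where it is the identity, and the path
  norm, where it is \<open>abs\<close>; likewise in \<open>upper_layer_U\<close>.\<close>

lemma layer_1_sum:
  assumes i: "i \<le> 2 ^ \<alpha>" and f0: "f 0 = 0"
  shows "(\<Sum>k<M. f (pU \<theta> 1 (CARD('d) + i) k) * G (k div m) (k mod m) :: real)
     = (\<Sum>k<m. f (c (if i = 2 ^ \<alpha> then a else i) k) * G (if i = 2 ^ \<alpha> then a else i) k)" (is "_ = ?R")
proof -
  let ?i = "if i = 2 ^ \<alpha> then a else i"
  have "(\<Sum>k<M. f (pU \<theta> 1 (CARD('d) + i) k) * G (k div m) (k mod m))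
     = (\<Sum>k<M. if k < 2 ^ \<alpha> * m \<and> k div m = ?i then f (c (k div m) (k mod m)) * G (k div m) (k mod m) else 0)"
    using f0 by (intro sum.cong refl) (simp add: net_simps)
  also have "\<dots> = (\<Sum>k<m. f (c ((?i * m + k) div m) ((?i * m + k) mod m)) * G ((?i * m + k) div m) ((?i * m + k) mod m))"
    using i a by (intro sum_div_block m M) auto
  also have "\<dots> = ?R" using m by (intro sum.cong refl) simp
  finally show ?thesis .
qed

lemma hidden_1:
  assumes i: "i \<le> 2 ^ \<alpha>"
  shows "rn_hidden M D \<theta> x 1 (CARD('d) + i)
    = two_layer m (c (if i = 2 ^ \<alpha> then a else i)) (w (if i = 2 ^ \<alpha> then a else i)) x"
proof -
  have inner: "(\<Sum>q<D. pW \<theta> 1 k q * rn_hidden M D \<theta> x 0 q) = w (k div m) (k mod m) \<bullet> x" if "k < 2 ^ \<alpha> * m" for k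
  proof -
    have "(\<Sum>q<D. pW \<theta> 1 k q * rn_hidden M D \<theta> x 0 q)
        = (\<Sum>q<D. if q < CARD('d) then w (k div m) (k mod m) $ e q * x $ e q else 0)"
      unfolding hidden_0 using that by (intro sum.cong refl) (simp add: net_simps)
    also have "\<dots> = w (k div m) (k mod m) \<bullet> x"
      using sum_enc[of "\<lambda>i. w (k div m) (k mod m) $ i * x $ i"] by (simp add: inner_vec_def)
    finally show ?thesis .
  qed
  have "pU \<theta> 1 j k * relu (\<Sum>q<D. pW \<theta> 1 k q * rn_hidden M D \<theta> x 0 q)
      = pU \<theta> 1 j k * relu (w (k div m) (k mod m) \<bullet> x)" for j k
  proof (cases "k < 2 ^ \<alpha> * m")
    case False
    then have "pU \<theta> 1 j k = 0" by (simp add: net_simps)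
    then show ?thesis by simp
  next
    case True
    show ?thesis by (simp only: inner[OF True])
  qed
  note eq = this
  have "rn_hidden M D \<theta> x 1 j = rn_hidden M D \<theta> x 0 j
      + (\<Sum>k<M. pU \<theta> 1 j k * relu (\<Sum>q<D. pW \<theta> 1 k q * rn_hidden M D \<theta> x 0 q))" for j
    by simp
  then have "rn_hidden M D \<theta> x 1 (CARD('d) + i)
      = (\<Sum>k<M. pU \<theta> 1 (CARD('d) + i) k * relu (w (k div m) (k mod m) \<bullet> x))"
    by (simp only: eq hidden_0[of x "CARD('d) + i"]) simp
  also have "\<dots> = two_layer m (c (if i = 2 ^ \<alpha> then a else i)) (w (if i = 2 ^ \<alpha> then a else i)) x"
    using layer_1_sum[OF i, of "\<lambda>z. z" "\<lambda>i k. relu (w i k \<bullet> x)"] by (simp add: two_layer_def)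
  finally show ?thesis .
qed

lemma path_1:
  assumes i: "i \<le> 2 ^ \<alpha>"
  shows "(\<Sum>p\<in>UNIV. rn_path M D \<theta> 1 (CARD('d) + i) p)
    = 3 * (\<Sum>k<m. \<bar>c (if i = 2 ^ \<alpha> then a else i) k\<bar> * l1norm (w (if i = 2 ^ \<alpha> then a else i) k))"
proof -
  have inner: "(\<Sum>q<D. \<bar>pW \<theta> 1 k q\<bar> * rn_path M D \<theta> 0 q p) = \<bar>w (k div m) (k mod m) $ p\<bar>" if "k < 2 ^ \<alpha> * m" for k p
  proof -
    have "(\<Sum>q<D. \<bar>pW \<theta> 1 k q\<bar> * rn_path M D \<theta> 0 q p)
        = (\<Sum>q<D. if q < CARD('d) then (if e q = p then \<bar>w (k div m) (k mod m) $ p\<bar> else 0) else 0)"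
      unfolding path_0 using that by (intro sum.cong refl) (simp add: net_simps)
    also have "\<dots> = \<bar>w (k div m) (k mod m) $ p\<bar>"
      using sum_enc[of "\<lambda>i. if i = p then \<bar>w (k div m) (k mod m) $ p\<bar> else 0"] by simp
    finally show ?thesis .
  qed
  have "\<bar>pU \<theta> 1 j k\<bar> * (\<Sum>q<D. \<bar>pW \<theta> 1 k q\<bar> * rn_path M D \<theta> 0 q p)
      = \<bar>pU \<theta> 1 j k\<bar> * \<bar>w (k div m) (k mod m) $ p\<bar>" for j k p
  proof (cases "k < 2 ^ \<alpha> * m")
    case False
    then have "pU \<theta> 1 j k = 0" by (simp add: net_simps)
    then show ?thesis by simp
  next
    case True
    show ?thesis by (simp only: inner[OF True])
  qed
  note eq = this
  have "rn_path M D \<theta> 1 j p = rn_path M D \<theta> 0 j p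
      + 3 * (\<Sum>k<M. \<bar>pU \<theta> 1 j k\<bar> * (\<Sum>q<D. \<bar>pW \<theta> 1 k q\<bar> * rn_path M D \<theta> 0 q p))" for j p
    by simp
  then have "rn_path M D \<theta> 1 (CARD('d) + i) p
      = 3 * (\<Sum>k<M. \<bar>pU \<theta> 1 (CARD('d) + i) k\<bar> * \<bar>w (k div m) (k mod m) $ p\<bar>)" for p
    by (simp only: eq path_0[of "CARD('d) + i"]) simp
  note row = this
  have col: "(\<Sum>k<M. \<bar>pU \<theta> 1 (CARD('d) + i) k\<bar> * \<bar>w (k div m) (k mod m) $ p\<bar>)
      = (\<Sum>k<m. \<bar>c (if i = 2 ^ \<alpha> then a else i) k\<bar> * \<bar>w (if i = 2 ^ \<alpha> then a else i) k $ p\<bar>)" for p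
    using layer_1_sum[OF i, of abs "\<lambda>i k. \<bar>w i k $ p\<bar>"] by simp
  have "(\<Sum>p\<in>UNIV. rn_path M D \<theta> 1 (CARD('d) + i) p)
      = 3 * (\<Sum>p\<in>UNIV. \<Sum>k<m. \<bar>c (if i = 2 ^ \<alpha> then a else i) k\<bar> * \<bar>w (if i = 2 ^ \<alpha> then a else i) k $ p\<bar>)"
    by (simp only: row col sum_distrib_left)
  also have "(\<Sum>p\<in>UNIV. \<Sum>k<m. \<bar>c (if i = 2 ^ \<alpha> then a else i) k\<bar> * \<bar>w (if i = 2 ^ \<alpha> then a else i) k $ p\<bar>)
      = (\<Sum>k<m. \<bar>c (if i = 2 ^ \<alpha> then a else i) k\<bar> * l1norm (w (if i = 2 ^ \<alpha> then a else i) k))"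
    unfolding l1norm_def sum_distrib_left by (rule sum.swap)
  finally show ?thesis .
qed

lemma upper_layer_U:
  assumes t: "1 \<le> t" "t \<le> \<alpha>" and f: "f 0 = 0" "f 1 = 1"
  shows "(\<Sum>k<M. f (pU \<theta> (Suc t) j k) * G k :: real)
    = (if CARD('d) \<le> j \<and> j < CARD('d) + 2 ^ (\<alpha> - t) then G (j - CARD('d)) else 0)"
proof -
  have "(2::nat) ^ (\<alpha> - t) \<le> 2 ^ \<alpha>" by (intro power_increasing) auto
  also have "\<dots> \<le> 2 ^ \<alpha> * m" using m by simp
  finally have hM: "2 ^ (\<alpha> - t) \<le> M" using M by linarith
  have "(\<Sum>k<M. f (pU \<theta> (Suc t) j k) * G k)
      = (\<Sum>k<M. if k = j - CARD('d) then (if CARD('d) \<le> j \<and> j < CARD('d) + 2 ^ (\<alpha> - t) then G k else 0) else 0)"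
    using t f by (intro sum.cong refl) (auto simp: net_simps)
  also have "\<dots> = (if CARD('d) \<le> j \<and> j < CARD('d) + 2 ^ (\<alpha> - t) then G (j - CARD('d)) else 0)"
    using hM by (simp add: sum.delta) linarith
  finally show ?thesis .
qed

lemma half_lt: "1 \<le> t \<Longrightarrow> t \<le> \<alpha> \<Longrightarrow> 2 * 2 ^ (\<alpha> - t) \<le> (2::nat) ^ \<alpha>"
  unfolding power_Suc[symmetric] by (intro power_increasing) auto

lemma hidden_Suc:
  assumes t: "1 \<le> t" "t \<le> \<alpha>"
  shows "rn_hidden M D \<theta> x (Suc t) (CARD('d) + 2 ^ \<alpha>) = rn_hidden M D \<theta> x t (CARD('d) + 2 ^ \<alpha>)"
    and "i < 2 ^ (\<alpha> - t) \<Longrightarrow> rn_hidden M D \<theta> x (Suc t) (CARD('d) + i)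
       = max (rn_hidden M D \<theta> x t (CARD('d) + i)) (rn_hidden M D \<theta> x t (CARD('d) + (i + 2 ^ (\<alpha> - t))))"
proof -
  let ?H = "rn_hidden M D \<theta> x t"
  note h = half_lt[OF t]
  have Suc: "rn_hidden M D \<theta> x (Suc t) j = ?H j + (if CARD('d) \<le> j \<and> j < CARD('d) + 2 ^ (\<alpha> - t)
      then relu (\<Sum>q<D. pW \<theta> (Suc t) (j - CARD('d)) q * ?H q) else 0)" for j
    using upper_layer_U[OF t, of "\<lambda>z. z" j "\<lambda>k. relu (\<Sum>q<D. pW \<theta> (Suc t) k q * ?H q)"] by simp
  show "rn_hidden M D \<theta> x (Suc t) (CARD('d) + 2 ^ \<alpha>) = ?H (CARD('d) + 2 ^ \<alpha>)"
    unfolding Suc using h by simp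
  assume i: "i < 2 ^ (\<alpha> - t)"
  have "(\<Sum>q<D. pW \<theta> (Suc t) i q * ?H q)
      = (\<Sum>q<D. (if q = CARD('d) + i + 2 ^ (\<alpha> - t) then ?H q else 0) - (if q = CARD('d) + i then ?H q else 0))"
    using t i by (intro sum.cong refl) (auto simp: net_simps)
  also have "\<dots> = ?H (CARD('d) + i + 2 ^ (\<alpha> - t)) - ?H (CARD('d) + i)"
    using i h D by (simp add: sum_subtractf sum.delta)
  finally show "rn_hidden M D \<theta> x (Suc t) (CARD('d) + i)
       = max (?H (CARD('d) + i)) (?H (CARD('d) + (i + 2 ^ (\<alpha> - t))))"
    unfolding Suc using i by (simp add: relu_def add.assoc max_def)
qed

text \<open>Channel \<open>i\<close> is carried over with weight 1 and enters the comparing neuron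
  with weight 3, its opponent enters with weight 3. The bound rounds \<open>4\<close> and
  \<open>3\<close> up to a common \<open>4\<close>.\<close>

lemma path_Suc:
  assumes t: "1 \<le> t" "t \<le> \<alpha>"
  shows "rn_path M D \<theta> (Suc t) (CARD('d) + 2 ^ \<alpha>) p = rn_path M D \<theta> t (CARD('d) + 2 ^ \<alpha>) p"
    and "i < 2 ^ (\<alpha> - t) \<Longrightarrow> rn_path M D \<theta> (Suc t) (CARD('d) + i) p
       \<le> 4 * (rn_path M D \<theta> t (CARD('d) + i) p + rn_path M D \<theta> t (CARD('d) + (i + 2 ^ (\<alpha> - t))) p)"
proof -
  let ?H = "\<lambda>j. rn_path M D \<theta> t j p"
  note h = half_lt[OF t]
  have Suc: "rn_path M D \<theta> (Suc t) j p = ?H j + 3 * (if CARD('d) \<le> j \<and> j < CARD('d) + 2 ^ (\<alpha> - t)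
      then \<Sum>q<D. \<bar>pW \<theta> (Suc t) (j - CARD('d)) q\<bar> * ?H q else 0)" for j
    using upper_layer_U[OF t, of abs j "\<lambda>k. \<Sum>q<D. \<bar>pW \<theta> (Suc t) k q\<bar> * ?H q"] by simp
  show "rn_path M D \<theta> (Suc t) (CARD('d) + 2 ^ \<alpha>) p = ?H (CARD('d) + 2 ^ \<alpha>)"
    unfolding Suc using h by simp
  assume i: "i < 2 ^ (\<alpha> - t)"
  have "(\<Sum>q<D. \<bar>pW \<theta> (Suc t) i q\<bar> * ?H q)
      = (\<Sum>q<D. (if q = CARD('d) + i + 2 ^ (\<alpha> - t) then ?H q else 0) + (if q = CARD('d) + i then ?H q else 0))"
    using t i by (intro sum.cong refl) (auto simp: net_simps)
  also have "\<dots> = ?H (CARD('d) + i + 2 ^ (\<alpha> - t)) + ?H (CARD('d) + i)"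
    using i h D by (simp add: sum.distrib sum.delta)
  finally show "rn_path M D \<theta> (Suc t) (CARD('d) + i) p
       \<le> 4 * (?H (CARD('d) + i) + ?H (CARD('d) + (i + 2 ^ (\<alpha> - t))))"
    unfolding Suc using i rn_path_nonneg[of M D \<theta> t "CARD('d) + (i + 2 ^ (\<alpha> - t))" p]
    by (simp add: add.assoc)
qed

lemma hidden_copy: "t \<le> \<alpha> \<Longrightarrow> rn_hidden M D \<theta> x (Suc t) (CARD('d) + 2 ^ \<alpha>) = two_layer m (c a) (w a) x"
proof (induction t)
  case 0
  show ?case using hidden_1[of "2 ^ \<alpha>" x] by simp
next
  case (Suc t)
  then show ?case using hidden_Suc(1)[of "Suc t" x] by simp
qed

lemma path_copy: "t \<le> \<alpha> \<Longrightarrow> (\<Sum>p\<in>UNIV. rn_path M D \<theta> (Suc t) (CARD('d) + 2 ^ \<alpha>) p)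
   = 3 * (\<Sum>k<m. \<bar>c a k\<bar> * l1norm (w a k))"
proof (induction t)
  case 0
  show ?case using path_1[of "2 ^ \<alpha>"] by simp
next
  case (Suc t)
  then show ?case using path_Suc(1)[of "Suc t"] by simp
qed

text \<open>A round halves the contestants and preserves their maximum; the losing channels keep
  stale values that are no longer read. After \<open>\<alpha>\<close> rounds only channel
  \<open>CARD('d)\<close> remains.\<close>

lemma hidden_Max: "t \<le> \<alpha> \<Longrightarrow> Max ((\<lambda>i. rn_hidden M D \<theta> x (Suc t) (CARD('d) + i)) ` {..<2 ^ (\<alpha> - t)})
   = Max ((\<lambda>i. two_layer m (c i) (w i) x) ` {..<2 ^ \<alpha>})"
proof (induction t)
  case 0
  have "(\<lambda>i. rn_hidden M D \<theta> x (Suc 0) (CARD('d) + i)) ` {..<2 ^ \<alpha>} = (\<lambda>i. two_layer m (c i) (w i) x) ` {..<2 ^ \<alpha>}"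
    using hidden_1[of _ x] by (intro image_cong refl) simp
  then show ?case by simp
next
  case (Suc t)
  let ?h = "2 ^ (\<alpha> - Suc t) :: nat"
  let ?f = "\<lambda>i. rn_hidden M D \<theta> x (Suc t) (CARD('d) + i)"
  have h2: "2 * ?h = 2 ^ (\<alpha> - t)" using Suc.prems by (simp add: Suc_diff_Suc flip: power_Suc)
  have "(\<lambda>i. rn_hidden M D \<theta> x (Suc (Suc t)) (CARD('d) + i)) ` {..<?h} = (\<lambda>i. max (?f i) (?f (i + ?h))) ` {..<?h}"
    using hidden_Suc(2)[of "Suc t" _ x] Suc.prems by (intro image_cong refl) simp
  then have "Max ((\<lambda>i. rn_hidden M D \<theta> x (Suc (Suc t)) (CARD('d) + i)) ` {..<?h}) = Max (?f ` {..<2 * ?h})"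
    using Max_pairs[of ?h ?f] by simp
  then show ?case using Suc unfolding h2 by simp
qed

text \<open>Each contestant of a round meets exactly one opponent, so the norms summed over the
  remaining contestants grow by no more than 4 per round.\<close>

lemma path_Max_le: "t \<le> \<alpha> \<Longrightarrow> (\<Sum>i<2 ^ (\<alpha> - t). \<Sum>p\<in>UNIV. rn_path M D \<theta> (Suc t) (CARD('d) + i) p)
   \<le> 4 ^ t * (3 * (\<Sum>i<2 ^ \<alpha>. \<Sum>k<m. \<bar>c i k\<bar> * l1norm (w i k)))"
proof (induction t)
  case 0
  have "(\<Sum>i<2 ^ \<alpha>. \<Sum>p\<in>UNIV. rn_path M D \<theta> (Suc 0) (CARD('d) + i) p)
      = (\<Sum>i<2 ^ \<alpha>. 3 * (\<Sum>k<m. \<bar>c i k\<bar> * l1norm (w i k)))"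
    using path_1 by (intro sum.cong refl) simp
  then show ?case by (simp add: sum_distrib_left)
next
  case (Suc t)
  let ?h = "2 ^ (\<alpha> - Suc t) :: nat"
  let ?f = "\<lambda>i. \<Sum>p\<in>UNIV. rn_path M D \<theta> (Suc t) (CARD('d) + i) p"
  have h2: "2 * ?h = 2 ^ (\<alpha> - t)" using Suc.prems by (simp add: Suc_diff_Suc flip: power_Suc)
  have "(\<Sum>i<?h. \<Sum>p\<in>UNIV. rn_path M D \<theta> (Suc (Suc t)) (CARD('d) + i) p) \<le> (\<Sum>i<?h. 4 * (?f i + ?f (i + ?h)))"
  proof (intro sum_mono)
    fix i assume "i \<in> {..<?h}"
    then have "(\<Sum>p\<in>UNIV. rn_path M D \<theta> (Suc (Suc t)) (CARD('d) + i) p)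
      \<le> (\<Sum>p\<in>UNIV. 4 * (rn_path M D \<theta> (Suc t) (CARD('d) + i) p + rn_path M D \<theta> (Suc t) (CARD('d) + (i + ?h)) p))"
      using Suc.prems by (intro sum_mono path_Suc(2)) auto
    then show "(\<Sum>p\<in>UNIV. rn_path M D \<theta> (Suc (Suc t)) (CARD('d) + i) p) \<le> 4 * (?f i + ?f (i + ?h))"
      by (simp only: sum_distrib_left[symmetric] sum.distrib)
  qed
  also have "\<dots> = 4 * (\<Sum>i<2 * ?h. ?f i)" by (simp only: sum_split_half sum_distrib_left)
  also have "\<dots> \<le> 4 * (4 ^ t * (3 * (\<Sum>i<2 ^ \<alpha>. \<Sum>k<m. \<bar>c i k\<bar> * l1norm (w i k))))"
    unfolding h2 using Suc by (intro mult_left_mono) auto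
  finally show ?case by simp
qed

lemma resnet_max_net:
  "resnet M D (\<alpha> + 1) \<theta> x = two_layer m (c a) (w a) x + \<beta> * Max ((\<lambda>i. two_layer m (c i) (w i) x) ` {..<2 ^ \<alpha>})"
proof -
  let ?H = "rn_hidden M D \<theta> x (Suc \<alpha>)"
  have "resnet M D (\<alpha> + 1) \<theta> x
      = (\<Sum>j<D. (if j = CARD('d) + 2 ^ \<alpha> then ?H j else 0) + (if j = CARD('d) then \<beta> * ?H j else 0))"
    unfolding resnet_def Suc_eq_plus1[symmetric] by (intro sum.cong refl) (simp add: net_simps)
  also have "\<dots> = ?H (CARD('d) + 2 ^ \<alpha>) + \<beta> * ?H (CARD('d))"
    using D by (simp add: sum.distrib sum.delta)
  also have "?H (CARD('d)) = Max ((\<lambda>i. two_layer m (c i) (w i) x) ` {..<2 ^ \<alpha>})"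
    using hidden_Max[of \<alpha> x] by (simp add: lessThan_Suc del: rn_hidden.simps)
  finally show ?thesis unfolding hidden_copy[OF order.refl] .
qed

lemma path_norm_max_net_le:
  assumes "0 \<le> \<beta>"
  shows "path_norm M D (\<alpha> + 1) \<theta> \<le> 3 * (\<Sum>k<m. \<bar>c a k\<bar> * l1norm (w a k))
    + \<beta> * (4 ^ \<alpha> * (3 * (\<Sum>i<2 ^ \<alpha>. \<Sum>k<m. \<bar>c i k\<bar> * l1norm (w i k))))"
proof -
  let ?P = "rn_path M D \<theta> (Suc \<alpha>)"
  have row: "(\<Sum>j<D. \<bar>pu \<theta> j\<bar> * ?P j p) = ?P (CARD('d) + 2 ^ \<alpha>) p + \<beta> * ?P (CARD('d)) p" for p
  proof -
    have "(\<Sum>j<D. \<bar>pu \<theta> j\<bar> * ?P j p)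
      = (\<Sum>j<D. (if j = CARD('d) + 2 ^ \<alpha> then ?P j p else 0) + (if j = CARD('d) then \<beta> * ?P j p else 0))"
      using assms by (intro sum.cong refl) (simp add: net_simps)
    also have "\<dots> = ?P (CARD('d) + 2 ^ \<alpha>) p + \<beta> * ?P (CARD('d)) p"
      using D by (simp add: sum.distrib sum.delta)
    finally show ?thesis .
  qed
  have "path_norm M D (\<alpha> + 1) \<theta> = (\<Sum>p\<in>UNIV. ?P (CARD('d) + 2 ^ \<alpha>) p + \<beta> * ?P (CARD('d)) p)"
    unfolding path_norm_def Suc_eq_plus1[symmetric] row
    using assms by (intro sum.cong refl abs_of_nonneg add_nonneg_nonneg mult_nonneg_nonneg rn_path_nonneg)
  also have "\<dots> = 3 * (\<Sum>k<m. \<bar>c a k\<bar> * l1norm (w a k)) + \<beta> * (\<Sum>p\<in>UNIV. ?P (CARD('d)) p)"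
    using path_copy[of \<alpha>] by (simp add: sum.distrib sum_distrib_left[symmetric] del: rn_path.simps)
  also have "\<dots> \<le> 3 * (\<Sum>k<m. \<bar>c a k\<bar> * l1norm (w a k))
    + \<beta> * (4 ^ \<alpha> * (3 * (\<Sum>i<2 ^ \<alpha>. \<Sum>k<m. \<bar>c i k\<bar> * l1norm (w i k))))"
    using path_Max_le[of \<alpha>] assms
    by (intro add_left_mono mult_left_mono) (simp_all add: lessThan_Suc del: rn_path.simps)
  finally show ?thesis .
qed

end

section \<open>The oracle inequality and the candidate network\<close>

context bellman_setting
begin

abbreviation (input) "reward_energy \<equiv> integral\<^sup>L (sa_dist S A) (\<lambda>z. if snd z \<in> A then (r (fst z) (snd z))\<^sup>2 / 2 else 0)"

lemma bellman_res_eq: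
  assumes "a \<in> A"
  shows "(bellman_res A m D L r g \<gamma> dt \<Theta> s a)\<^sup>2 = 2 * bellman_loss A m D L r g \<gamma> dt \<Theta> (s, a) + (r s a)\<^sup>2"
proof -
  have res: "bellman_res A m D L r g \<gamma> dt \<Theta> s a = bellman_lin A m D L g \<gamma> dt \<Theta> (s, a) - r s a"
    using assms by (simp add: bellman_res_def bellman_lin_def)
  show ?thesis unfolding res by (simp add: bellman_loss_def power2_eq_square algebra_simps)
qed

lemma reward_sq_integrable: "integrable (sa_dist S A) (\<lambda>z. if snd z \<in> A then (r (fst z) (snd z))\<^sup>2 / 2 else 0)"
proof -
  interpret P: prob_space "sa_dist S A" by (rule prob_space_sa_dist)
  show ?thesis
  proof (rule P.integrable_const_bound[where B = 1])
    show "(\<lambda>z. if snd z \<in> A then (r (fst z) (snd z))\<^sup>2 / 2 else 0) \<in> borel_measurable (sa_dist S A)"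
    proof (rule sa_dist_measurable)
      fix a show "(\<lambda>s. if snd (s, a) \<in> A then (r (fst (s, a)) (snd (s, a)))\<^sup>2 / 2 else 0) \<in> borel_measurable (state_dist S)"
        using r_measurable[of a] by (cases "a \<in> A") simp_all
    qed
    have "(r s a)\<^sup>2 \<le> 2" if "s \<in> S" "a \<in> A" for s a
      using r_bound[OF that] abs_square_le_1[of "r s a"] by linarith
    then have "norm (if snd z \<in> A then (r (fst z) (snd z))\<^sup>2 / 2 else 0) \<le> 1" if "z \<in> space (sa_dist S A)" for z
      using that by (auto simp: space_sa_dist)
    then show "AE z in sa_dist S A. norm (if snd z \<in> A then (r (fst z) (snd z))\<^sup>2 / 2 else 0) \<le> 1"
      by (rule AE_I2)
  qed
qed

lemma bellman_loss_energy:
  "mean_loss m D L \<Theta> + reward_energy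
    = (\<integral>z. (if snd z \<in> A then (bellman_res A m D L r g \<gamma> dt \<Theta> (fst z) (snd z))\<^sup>2 / 2 else 0) \<partial>sa_dist S A)"
proof -
  have "bellman_loss A m D L r g \<gamma> dt \<Theta> z + (if snd z \<in> A then (r (fst z) (snd z))\<^sup>2 / 2 else 0)
      = (if snd z \<in> A then (bellman_res A m D L r g \<gamma> dt \<Theta> (fst z) (snd z))\<^sup>2 / 2 else 0)" for z
    by (cases "snd z \<in> A") (simp_all add: bellman_res_eq add_divide_distrib bellman_loss_def bellman_lin_def split_beta)
  then show ?thesis
    using bellman_loss_integrable reward_sq_integrable
    by (subst Bochner_Integration.integral_add[symmetric]) auto
qed

text \<open>Outside \<open>A\<close> nothing is assumed about \<open>r\<close> and \<open>g\<close>, so the integrand of \<^const>\<open>pop_loss\<close> may fail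
  to be measurable; the Bochner integral is then \<open>0\<close>, whence only an inequality.\<close>

lemma pop_loss_le: "pop_loss S A m D L r g \<gamma> dt \<Theta> \<le> mean_loss m D L \<Theta> + reward_energy"
proof -
  let ?f = "\<lambda>z. (bellman_res A m D L r g \<gamma> dt \<Theta> (fst z) (snd z))\<^sup>2"
  let ?g = "\<lambda>z. if snd z \<in> A then ?f z / 2 else 0"
  have nonneg: "0 \<le> integral\<^sup>L (sa_dist S A) ?g" by (intro integral_nonneg_AE) auto
  show ?thesis
  proof (cases "integrable (sa_dist S A) ?f")
    case True
    have "(\<integral>z. ?f z / 2 \<partial>sa_dist S A) = integral\<^sup>L (sa_dist S A) ?g"
    proof (rule integral_cong_AE)
      show "(\<lambda>z. ?f z / 2) \<in> borel_measurable (sa_dist S A)"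
        using borel_measurable_integrable[OF True] by simp
      have "{z \<in> space (sa_dist S A). snd z \<in> A} = S \<times> A" by (auto simp: space_sa_dist)
      then show "?g \<in> borel_measurable (sa_dist S A)"
        using borel_measurable_integrable[OF True] AE_sa_dist(2) by (intro measurable_If) simp_all
      show "AE z in sa_dist S A. ?f z / 2 = ?g z" using AE_in_A by eventually_elim simp
    qed
    then show ?thesis unfolding bellman_loss_energy by (simp add: pop_loss_def)
  next
    case False
    then have "pop_loss S A m D L r g \<gamma> dt \<Theta> = 0"
      by (simp add: pop_loss_def not_integrable_integral_eq)
    then show ?thesis unfolding bellman_loss_energy using nonneg by simp
  qed
qed

lemma emp_loss_eq:
  assumes "0 < n" "\<And>i. i < n \<Longrightarrow> snd (Z i) \<in> A"
  shows "emp_loss A m D L r g \<gamma> dt n Z \<Theta>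
    = (\<Sum>i<n. bellman_loss A m D L r g \<gamma> dt \<Theta> (Z i)) / real n + (\<Sum>i<n. (r (fst (Z i)) (snd (Z i)))\<^sup>2) / (2 * real n)"
proof -
  have "(\<Sum>i<n. (bellman_res A m D L r g \<gamma> dt \<Theta> (fst (Z i)) (snd (Z i)))\<^sup>2)
     = 2 * (\<Sum>i<n. bellman_loss A m D L r g \<gamma> dt \<Theta> (Z i)) + (\<Sum>i<n. (r (fst (Z i)) (snd (Z i)))\<^sup>2)"
    using assms(2) by (simp add: bellman_res_eq sum.distrib sum_distrib_left)
  then show ?thesis using assms(1) by (simp add: emp_loss_def add_divide_distrib)
qed

text \<open>The deviation bound is used at the minimizer and at the competitor. The penalty of the
  minimizer cancels against its own deviation, leaving twice the penalty of the competitor; the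
  empirical \<open>r\<^sup>2\<close> term stands on both sides of the minimality and drops
  out.\<close>

lemma oracle_inequality:
  fixes pen :: "(nat \<Rightarrow> 'd rnparam) \<Rightarrow> real"
  assumes n: "0 < n" and ZA: "\<And>i. i < n \<Longrightarrow> snd (Z i) \<in> A"
    and min: "emp_loss A m D L r g \<gamma> dt n Z \<Theta>h + pen \<Theta>h \<le> emp_loss A m D L r g \<gamma> dt n Z \<Theta> + pen \<Theta>"
    and dev: "\<And>\<Theta>. \<bar>mean_loss m D L \<Theta> - (\<Sum>i<n. bellman_loss A m D L r g \<gamma> dt \<Theta> (Z i)) / real n\<bar> \<le> pen \<Theta> + \<kappa>"
  shows "pop_loss S A m D L r g \<gamma> dt \<Theta>h \<le> (mean_loss m D L \<Theta> + reward_energy) + 2 * pen \<Theta> + 2 * \<kappa>"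
proof -
  have emp: "emp_loss A m D L r g \<gamma> dt n Z \<Theta>' = (\<Sum>i<n. bellman_loss A m D L r g \<gamma> dt \<Theta>' (Z i)) / real n
      + (\<Sum>i<n. (r (fst (Z i)) (snd (Z i)))\<^sup>2) / (2 * real n)" for \<Theta>'
    using n ZA by (rule emp_loss_eq)
  have "(\<Sum>i<n. bellman_loss A m D L r g \<gamma> dt \<Theta>h (Z i)) / real n + pen \<Theta>h
      \<le> (\<Sum>i<n. bellman_loss A m D L r g \<gamma> dt \<Theta> (Z i)) / real n + pen \<Theta>"
    using min unfolding emp by simp
  then show ?thesis using dev[of \<Theta>h] dev[of \<Theta>] pop_loss_le[of m D L \<Theta>h] by linarith
qed

section \<open>The Bellman residual of the candidate\<close>

lemma two_layer_lipschitz: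
  fixes x y :: "real^'d"
  assumes "\<And>i. \<bar>x $ i - y $ i\<bar> \<le> \<eta>"
  shows "\<bar>two_layer k c w x - two_layer k c w y\<bar> \<le> \<eta> * (\<Sum>j<k. \<bar>c j\<bar> * l1norm (w j))"
proof -
  have \<eta>: "0 \<le> \<eta>" using assms[of undefined] by linarith
  have "two_layer k c w x - two_layer k c w y = (\<Sum>j<k. c j * (relu (w j \<bullet> x) - relu (w j \<bullet> y)))"
    by (simp add: two_layer_def sum_subtractf right_diff_distrib)
  also have "\<bar>\<dots>\<bar> \<le> \<eta> * (\<Sum>j<k. \<bar>c j\<bar> * l1norm (w j))"
  proof (intro sum_mult_le_bound l1norm_nonneg \<eta>)
    fix j
    have "\<bar>w j \<bullet> x - w j \<bullet> y\<bar> \<le> \<eta> * l1norm (w j)"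
      using abs_inner_le_l1norm[of "x - y" \<eta> "w j"] assms by (simp add: inner_diff_right)
    then show "\<bar>relu (w j \<bullet> x) - relu (w j \<bullet> y)\<bar> \<le> \<eta> * l1norm (w j)"
      by (rule order.trans[OF relu_lipschitz])
  qed simp
  finally show ?thesis .
qed

lemma two_layer_measurable: "two_layer k c w \<in> borel_measurable (state_dist S)"
proof -
  have "two_layer k c w \<in> borel_measurable borel"
    unfolding two_layer_def[abs_def] relu_def
    by (intro borel_measurable_continuous_onI continuous_intros)
  then show ?thesis unfolding measurable_state_dist_cong by (rule measurable_restrict_space1)
qed

lemma id_measurable: "(\<lambda>s. s) \<in> measurable (state_dist S) borel"
  unfolding measurable_state_dist_cong by (rule measurable_restrict_space1) simp

lemma integral_sa_dist_fst:
  assumes "f \<in> borel_measurable (state_dist S)"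
  shows "(\<integral>z. f (fst z) \<partial>sa_dist S A) = (\<integral>s. (f s :: real) \<partial>state_dist S)"
    "integrable (state_dist S) f \<Longrightarrow> integrable (sa_dist S A) (\<lambda>z. f (fst z))"
proof -
  have d: "distr (sa_dist S A) (state_dist S) fst = state_dist S"
    unfolding sa_dist_def by (rule measure_pmf.distr_pair_fst)
  have m: "fst \<in> measurable (sa_dist S A) (state_dist S)"
    unfolding sa_dist_def by simp
  show "(\<integral>z. f (fst z) \<partial>sa_dist S A) = (\<integral>s. f s \<partial>state_dist S)"
    by (subst d[symmetric], subst integral_distr[OF m assms]) simp
  show "integrable (state_dist S) f \<Longrightarrow> integrable (sa_dist S A) (\<lambda>z. f (fst z))"
    using integrable_distr_eq[OF m, of f] assms unfolding d by simp
qed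

text \<open>If \<open>\<beta> = \<gamma> / (1 - \<gamma>)\<close> and \<open>R a\<close> approximates \<open>r(\<sqdot>, a)\<close>, then \<open>f a = R a + \<beta> max R\<close> satisfies
  \<open>max f = max R / (1 - \<gamma>)\<close> and nearly solves the Bellman equation, because \<open>g s a dt\<close> is close to \<open>s\<close>.\<close>

lemma mean_loss_candidate_le:
  fixes k m D L :: nat and c :: "nat \<Rightarrow> nat \<Rightarrow> real" and w :: "nat \<Rightarrow> nat \<Rightarrow> real^'d" and b \<eta> :: real
  defines "R \<equiv> \<lambda>a. two_layer k (c a) (w a)"
  assumes net: "\<And>a x. a \<in> A \<Longrightarrow> resnet m D L (\<Theta> a) x = R a x + \<gamma> / (1 - \<gamma>) * Max ((\<lambda>a'. R a' x) ` A)"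
    and b: "\<And>a. a \<in> A \<Longrightarrow> (\<Sum>j<k. \<bar>c a j\<bar> * l1norm (w a j)) \<le> b"
    and drift: "\<And>s a i. s \<in> S \<Longrightarrow> a \<in> A \<Longrightarrow> \<bar>s $ i - g s a dt $ i\<bar> \<le> \<eta>"
  shows "mean_loss m D L \<Theta> + reward_energy
    \<le> (\<Sum>a\<in>A. \<integral>s. (R a s - r s a)\<^sup>2 \<partial>state_dist S) + (\<gamma> / (1 - \<gamma>) * (\<eta> * b))\<^sup>2"
proof -
  interpret P: prob_space "sa_dist S A" by (rule prob_space_sa_dist)
  interpret SD: prob_space "state_dist S" by (rule prob_space_state_dist)
  let ?\<beta> = "\<gamma> / (1 - \<gamma>)"
  let ?M = "\<lambda>x. Max ((\<lambda>a. R a x) ` A)"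
  \<comment> \<open>Bounding the contribution of one action by the sum over all of them makes the
    integrand depend on the state only.\<close>
  let ?f = "\<lambda>s. (\<Sum>a\<in>A. (R a s - r s a)\<^sup>2) + (?\<beta> * (\<eta> * b))\<^sup>2"
  have \<beta>: "0 \<le> ?\<beta>" "1 + ?\<beta> = 1 / (1 - \<gamma>)" using \<gamma> by (auto simp: field_simps)
  obtain a0 where "a0 \<in> A" using A(2) by blast
  then have b0: "0 \<le> b"
    using b[of a0] sum_nonneg[of "{..<k}" "\<lambda>j. \<bar>c a0 j\<bar> * l1norm (w a0 j)"] by (auto simp: l1norm_nonneg)
  have Rb: "\<bar>R a s\<bar> \<le> b" if "a \<in> A" "s \<in> S" for a s
    using two_layer_lipschitz[of s 0 1 k "c a" "w a"] b[OF that(1)] S_abs[OF that(2)]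
    by (simp add: R_def two_layer_def relu_def)
  have sq_int: "integrable (state_dist S) (\<lambda>s. (R a s - r s a)\<^sup>2)" if a: "a \<in> A" for a
  proof (rule SD.integrable_const_bound[where B = "(b + 1)\<^sup>2"])
    have "\<bar>R a s - r s a\<bar> \<le> b + 1" if "s \<in> S" for s
      using Rb[OF a that] r_bound[OF that a] by linarith
    then have "\<bar>R a s - r s a\<bar>\<^sup>2 \<le> (b + 1)\<^sup>2" if "s \<in> S" for s
      using that by (intro power_mono) auto
    then show "AE s in state_dist S. norm ((R a s - r s a)\<^sup>2) \<le> (b + 1)\<^sup>2"
      by (intro AE_I2) (simp add: space_state_dist)
    show "(\<lambda>s. (R a s - r s a)\<^sup>2) \<in> borel_measurable (state_dist S)"
      using two_layer_measurable r_measurable[OF a] unfolding R_def by simp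
  qed
  have f_int: "integrable (state_dist S) ?f"
    using sq_int by (intro Bochner_Integration.integrable_add Bochner_Integration.integrable_sum) auto
  have pt: "(bellman_res A m D L r g \<gamma> dt \<Theta> s a)\<^sup>2 / 2 \<le> ?f s" if s: "s \<in> S" and a: "a \<in> A" for s a
  proof -
    have "Max ((\<lambda>a'. resnet m D L (\<Theta> a') x) ` A) = ?M x + ?\<beta> * ?M x" for x
    proof -
      have "(\<lambda>a'. resnet m D L (\<Theta> a') x) ` A = (\<lambda>y. y + ?\<beta> * ?M x) ` (\<lambda>a'. R a' x) ` A"
        using net by (auto simp: image_image)
      also have "Max \<dots> = Max ((\<lambda>a'. R a' x) ` A) + ?\<beta> * ?M x"
        using A by (intro mono_Max_commute[symmetric] monoI) auto
      finally show ?thesis .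
    qed
    \<comment> \<open>By \<open>1 + ?\<beta> = 1 / (1 - \<gamma>)\<close> one has
      \<open>\<gamma> * (1 + ?\<beta>) = ?\<beta>\<close>: without drift of the state, the
      discounted maximum would cancel the second summand of the candidate exactly.\<close>
    then have "\<gamma> * Max ((\<lambda>a'. resnet m D L (\<Theta> a') x) ` A) = ?\<beta> * ?M x" for x
      using \<beta>(2) by (simp add: distrib_right[of 1 ?\<beta>, simplified, symmetric])
    then have res: "bellman_res A m D L r g \<gamma> dt \<Theta> s a = (R a s - r s a) + ?\<beta> * (?M s - ?M (g s a dt))"
      using net[OF a] by (simp add: bellman_res_def algebra_simps)
    have "\<bar>?M s - ?M (g s a dt)\<bar> \<le> \<eta> * b"
    proof (rule abs_Max_diff_le[OF A])
      fix a' assume a': "a' \<in> A"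
      have "\<bar>R a' s - R a' (g s a dt)\<bar> \<le> \<eta> * (\<Sum>j<k. \<bar>c a' j\<bar> * l1norm (w a' j))"
        unfolding R_def using drift[OF s a] by (rule two_layer_lipschitz)
      also have "\<dots> \<le> \<eta> * b"
        using b[OF a'] drift[OF s a, of undefined] by (intro mult_left_mono) auto
      finally show "\<bar>R a' s - R a' (g s a dt)\<bar> \<le> \<eta> * b" .
    qed
    then have "\<bar>?\<beta> * (?M s - ?M (g s a dt))\<bar> \<le> ?\<beta> * (\<eta> * b)"
      unfolding abs_mult abs_of_nonneg[OF \<beta>(1)] using \<beta>(1) by (rule mult_left_mono)
    then have "\<bar>?\<beta> * (?M s - ?M (g s a dt))\<bar>\<^sup>2 \<le> (?\<beta> * (\<eta> * b))\<^sup>2"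
      by (intro power_mono) auto
    moreover have "(x + y)\<^sup>2 / 2 \<le> x\<^sup>2 + y\<^sup>2" for x y :: real
      using zero_le_power2[of "x - y"] by (simp add: power2_eq_square algebra_simps)
    from this[of "R a s - r s a" "?\<beta> * (?M s - ?M (g s a dt))"]
    have "(bellman_res A m D L r g \<gamma> dt \<Theta> s a)\<^sup>2 / 2 \<le> (R a s - r s a)\<^sup>2 + (?\<beta> * (?M s - ?M (g s a dt)))\<^sup>2"
      unfolding res .
    ultimately have "(bellman_res A m D L r g \<gamma> dt \<Theta> s a)\<^sup>2 / 2 \<le> (R a s - r s a)\<^sup>2 + (?\<beta> * (\<eta> * b))\<^sup>2"
      unfolding power2_abs by linarith
    moreover have "(R a s - r s a)\<^sup>2 \<le> (\<Sum>a\<in>A. (R a s - r s a)\<^sup>2)"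
      using A a by (intro member_le_sum) auto
    ultimately show ?thesis by linarith
  qed
  have "mean_loss m D L \<Theta> + reward_energy \<le> (\<integral>z. ?f (fst z) \<partial>sa_dist S A)"
    unfolding bellman_loss_energy
  proof (rule integral_mono)
    have "integrable (sa_dist S A) (\<lambda>z. bellman_loss A m D L r g \<gamma> dt \<Theta> z + (if snd z \<in> A then (r (fst z) (snd z))\<^sup>2 / 2 else 0))"
      by (intro Bochner_Integration.integrable_add bellman_loss_integrable reward_sq_integrable)
    moreover have "bellman_loss A m D L r g \<gamma> dt \<Theta> z + (if snd z \<in> A then (r (fst z) (snd z))\<^sup>2 / 2 else 0)
        = (if snd z \<in> A then (bellman_res A m D L r g \<gamma> dt \<Theta> (fst z) (snd z))\<^sup>2 / 2 else 0)" for z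
      by (cases "snd z \<in> A") (simp_all add: bellman_res_eq add_divide_distrib bellman_loss_def bellman_lin_def split_beta)
    ultimately show "integrable (sa_dist S A) (\<lambda>z. if snd z \<in> A then (bellman_res A m D L r g \<gamma> dt \<Theta> (fst z) (snd z))\<^sup>2 / 2 else 0)"
      by simp
    show "integrable (sa_dist S A) (\<lambda>z. ?f (fst z))"
      using f_int by (intro integral_sa_dist_fst(2)) (rule borel_measurable_integrable)
    show "(if snd z \<in> A then (bellman_res A m D L r g \<gamma> dt \<Theta> (fst z) (snd z))\<^sup>2 / 2 else 0) \<le> ?f (fst z)"
      if "z \<in> space (sa_dist S A)" for z
      using pt[of "fst z" "snd z"] that by (auto simp: space_sa_dist intro!: add_nonneg_nonneg sum_nonneg)
  qed
  also have "\<dots> = (\<integral>s. ?f s \<partial>state_dist S)"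
    using f_int by (intro integral_sa_dist_fst(1)) (rule borel_measurable_integrable)
  also have "\<dots> = (\<Sum>a\<in>A. \<integral>s. (R a s - r s a)\<^sup>2 \<partial>state_dist S) + (?\<beta> * (\<eta> * b))\<^sup>2"
    using sq_int by (simp add: Bochner_Integration.integral_add Bochner_Integration.integral_sum SD.prob_space)
  finally show ?thesis .
qed

end

section \<open>Deviation against penalty\<close>

text \<open>For \<open>Q \<ge> 2\<close> the penalty alone absorbs the deviation; \<open>10 * lam\<close> is only needed for small \<open>Q\<close>.\<close>

lemma deviation_le_penalty:
  fixes N d \<delta> Q lam \<kappa> :: real and \<alpha> :: nat
  defines "M \<equiv> ln (4 * (Q + 1))" and "x \<equiv> sqrt (2 * ln (2 * d))" and "y \<equiv> ln (N / \<delta>)"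
  assumes N: "N = 2 ^ \<alpha>" and d: "1 \<le> d" and \<delta>: "0 < \<delta>" "\<delta> < 1" and Q: "0 \<le> Q"
    and \<kappa>: "1 \<le> \<kappa>" "\<kappa> \<le> Q + 1" "Q < 2 \<Longrightarrow> \<kappa> \<le> 2"
    and lam: "72 * N ^ 3 * x + 9 * y + 18 \<le> lam"
  shows "4 * N * (2 * \<kappa> + 1) * \<kappa> * sqrt (2 * ln (2 * (N * 3 ^ (\<alpha> + 1) * (2 * d)) * (\<kappa> * (\<kappa> + 1)) / \<delta>)) + 1
    \<le> lam * Q\<^sup>2 * M + 10 * lam + 1"
proof -
  have N1: "1 \<le> N" by (simp add: N)
  have N2: "N \<le> N ^ 3" "N\<^sup>2 \<le> N ^ 3" "1 \<le> N ^ 3"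
    using N1 power_increasing[of 1 3 N] power_increasing[of 2 3 N] power_increasing[of 0 3 N] by auto
  have ln2: "2/3 \<le> ln (2::real)" "ln (2::real) \<le> 25/36"
    by (rule ln2_ge_two_thirds ln2_le_25_over_36)+
  have lnp: "ln (2 ^ n :: real) = real n * ln 2" for n by (rule ln_realpow)
  have "ln 2 \<le> ln (2 * d)" using d by simp
  then have x2: "(11/10)\<^sup>2 \<le> 2 * ln (2 * d)" using ln2 by (simp add: power2_eq_square)
  have x: "11/10 \<le> x" unfolding x_def by (rule real_le_rsqrt[OF x2])
  have y: "0 \<le> y" unfolding y_def using N1 \<delta> by (intro ln_ge_zero) (simp add: pos_le_divide_eq)
  have M0: "2 * ln 2 \<le> M"
  proof -
    have "ln (2 ^ 2) \<le> ln (4 * (Q + 1))" using Q by (subst ln_le_cancel_iff) auto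
    then show ?thesis unfolding M_def lnp by simp
  qed
  let ?Y = "2 * (N * 3 ^ (\<alpha> + 1) * (2 * d)) * (\<kappa> * (\<kappa> + 1)) / \<delta>"
  define T where "T = sqrt (2 * ln ?Y)"
  \<comment> \<open>The factor \<open>3 ^ \<alpha>\<close> is absorbed by the square of
    \<open>N\<close> and the peeling factor by that of \<open>4 * (Q + 1)\<close>. Then
    \<open>ln ?Y\<close> is at most the sum of \<open>ln (2 * d)\<close>, \<open>y\<close>,
    \<open>2 * ln N\<close> and \<open>2 * M\<close>, all of which \<open>lam\<close> and the
    penalty can pay for.\<close>
  have pow: "(3::real) ^ \<alpha> \<le> N\<^sup>2"
  proof -
    have "(3::real) ^ \<alpha> \<le> 4 ^ \<alpha>" by (intro power_mono) auto
    also have "\<dots> = N\<^sup>2" by (simp add: N power_mult_distrib[symmetric] power2_eq_square)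
    finally show ?thesis .
  qed
  have kk: "\<kappa> * (\<kappa> + 1) \<le> 2 * (Q + 1)\<^sup>2"
  proof -
    have "\<kappa> * (\<kappa> + 1) \<le> (Q + 1) * (2 * (Q + 1))" using \<kappa> Q by (intro mult_mono) auto
    then show ?thesis by (simp add: power2_eq_square algebra_simps)
  qed
  have "2 * 3 ^ (\<alpha> + 1) * (\<kappa> * (\<kappa> + 1)) \<le> (6 * N\<^sup>2) * (2 * (Q + 1)\<^sup>2)"
    by (rule mult_mono[OF _ kk]) (use pow \<kappa> in auto)
  also have "\<dots> \<le> N\<^sup>2 * (4\<^sup>2 * (Q + 1)\<^sup>2)"
    using mult_nonneg_nonneg[OF zero_le_power2[of N] zero_le_power2[of "Q + 1"]] by simp
  also have "\<dots> = N\<^sup>2 * (4 * (Q + 1))\<^sup>2" by (simp only: power_mult_distrib)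
  finally have "?Y \<le> (2 * d) * (N / \<delta>) * (N\<^sup>2 * (4 * (Q + 1))\<^sup>2)"
    using mult_left_mono[of "2 * 3 ^ (\<alpha> + 1) * (\<kappa> * (\<kappa> + 1))" "N\<^sup>2 * (4 * (Q + 1))\<^sup>2" "(2 * d) * (N / \<delta>)"] d N1 \<delta>
    by (simp add: mult_ac)
  moreover have "0 < ?Y" using N1 d \<delta> \<kappa> by simp
  ultimately have "ln ?Y \<le> ln ((2 * d) * (N / \<delta>) * (N\<^sup>2 * (4 * (Q + 1))\<^sup>2))"
    by (subst ln_le_cancel_iff) (auto intro: less_le_trans)
  also have "\<dots> = ln (2 * d) + y + (2 * ln N + 2 * M)"
  proof -
    have split: "ln (u * p * (N\<^sup>2 * q\<^sup>2)) = ln u + ln p + (2 * ln N + 2 * ln q)"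
      if "0 < u" "0 < p" "0 < q" for u p q
      using that N1 by (simp add: ln_mult ln_realpow)
    show ?thesis unfolding y_def M_def by (rule split) (use d N1 \<delta> Q in simp_all)
  qed
  also have "\<dots> \<le> ln (2 * d) + y + (2 * N + 2 * M)"
    using ln_le_minus_one[of N] N1 by simp
  finally have "T \<le> sqrt (2 * ln (2 * d) + (4 * (N + M) + 2 * y))"
    unfolding T_def by (intro real_sqrt_le_mono) simp
  also have "\<dots> \<le> x + sqrt (4 * (N + M) + 2 * y)"
    unfolding x_def using d y N1 M0 ln2 by (intro sqrt_add_le_add_sqrt) simp_all
  also have "sqrt (4 * (N + M) + 2 * y) \<le> sqrt (4 * (N + M)) + sqrt (2 * y)"
    using y N1 M0 ln2 by (intro sqrt_add_le_add_sqrt) auto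
  also have "sqrt (4 * (N + M)) \<le> N + M + 1"
  proof (rule real_le_lsqrt)
    have "0 \<le> (N + M - 1)\<^sup>2" by simp
    then show "4 * (N + M) \<le> (N + M + 1)\<^sup>2" by (simp add: power2_eq_square algebra_simps)
  qed (use N1 M0 ln2 in auto)
  finally have T: "T \<le> x + (N + M + 1) + sqrt (2 * y)" by simp
  \<comment> \<open>As \<open>lam\<close> contains \<open>y\<close> linearly, its root is traded for
    \<open>q * y\<close> plus a multiple of \<open>p\<^sup>2\<close>. The weights are chosen to fit:
    \<open>18 * y \<le> 9 * y * M\<close> holds because \<open>M \<ge> 2\<close> in the first case,
    and \<open>80 * y\<close> stays below the \<open>90 * y\<close> contained in
    \<open>10 * lam\<close> in the second.\<close>
  have amgm: "p * sqrt (2 * y) \<le> q * y + p\<^sup>2 / (2 * q)" if "0 < q" for p q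
  proof -
    have "0 \<le> (q * sqrt (2 * y) - p)\<^sup>2" by simp
    then have "2 * q * (p * sqrt (2 * y)) \<le> q\<^sup>2 * (2 * y) + p\<^sup>2"
      using y by (simp add: power2_diff power_mult_distrib mult.assoc mult.commute[of p])
    then have "2 * q * (p * sqrt (2 * y)) / (2 * q) \<le> (q\<^sup>2 * (2 * y) + p\<^sup>2) / (2 * q)"
      using that by (intro divide_right_mono) auto
    then show ?thesis using that by (simp add: add_divide_distrib power2_eq_square)
  qed
  have T0: "0 \<le> T" unfolding T_def
  proof (intro real_sqrt_ge_zero mult_nonneg_nonneg ln_ge_zero)
    have "1 * 1 \<le> N * 3 ^ (\<alpha> + 1)" using N1 by (intro mult_mono one_le_power) auto
    moreover have "1 * 1 \<le> \<kappa> * (\<kappa> + 1)" using \<kappa> by (intro mult_mono) auto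
    ultimately have "1 * 1 * 1 \<le> 2 * (N * 3 ^ (\<alpha> + 1)) * (2 * d) * (\<kappa> * (\<kappa> + 1))"
      using d N1 by (intro mult_mono) auto
    then show "1 \<le> ?Y" using \<delta> by (simp add: pos_le_divide_eq mult_ac)
  qed simp
  have "0 \<le> N ^ 3 * x" using N1 x by simp
  then have lam0: "0 \<le> lam" using lam y by simp
  show ?thesis
  proof (cases "Q < 2")
    case False
    have "ln (2 ^ 3) \<le> ln (4 * (Q + 1))" using False by (subst ln_le_cancel_iff) auto
    then have M: "2 \<le> M" unfolding M_def lnp using ln2 by simp
    have "(2 * \<kappa> + 1) * \<kappa> \<le> (2 * (Q + 1) + 1) * (Q + 1)"
      using \<kappa> Q by (intro mult_mono) auto
    also have "\<dots> = 2 * Q\<^sup>2 + 5 * Q + 3" by (simp add: power2_eq_square algebra_simps)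
    \<comment> \<open>For \<open>Q \<ge> 2\<close>, the term \<open>5 * Q\<close> is at most
      \<open>5/2 * Q\<^sup>2\<close> and \<open>3\<close> is at most
      \<open>3/4 * Q\<^sup>2\<close>.\<close>
    also have "\<dots> \<le> 21/4 * Q\<^sup>2"
    proof -
      have "2 * Q \<le> Q * Q" using False by (intro mult_right_mono) auto
      then show ?thesis using False unfolding power2_eq_square by linarith
    qed
    finally have "4 * N * T * ((2 * \<kappa> + 1) * \<kappa>) \<le> 4 * N * T * (21/4 * Q\<^sup>2)"
      using N1 T0 by (intro mult_left_mono) auto
    then have "4 * N * (2 * \<kappa> + 1) * \<kappa> * T \<le> (21 * N * T) * Q\<^sup>2" by (simp add: mult_ac)
    also have "\<dots> \<le> (lam * M) * Q\<^sup>2"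
    proof (intro mult_right_mono)
      have "21 * N * T \<le> 21 * N * (x + (N + M + 1) + sqrt (2 * y))"
        using T N1 by (intro mult_left_mono) auto
      also have "\<dots> = 21 * N * x + 21 * N\<^sup>2 + 21 * N * M + 21 * N + 21 * N * sqrt (2 * y)"
        by (simp add: algebra_simps power2_eq_square)
      also have "\<dots> \<le> N ^ 3 * (21 * x + 55 + 21 * M) + 18 * y"
      proof -
        have "21 * N * sqrt (2 * y) \<le> 18 * y + 49/4 * N\<^sup>2"
          using amgm[of 18 "21 * N"] by (simp add: power_mult_distrib)
        moreover
        have "N * x \<le> N ^ 3 * x" "N * M \<le> N ^ 3 * M" using N2 x M by (auto intro: mult_right_mono)
        ultimately show ?thesis using N2 by (simp add: algebra_simps)
      qed
      also have "\<dots> \<le> N ^ 3 * (72 * x * M) + 9 * y * M"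
      proof (intro add_mono mult_left_mono)
        have "(11/10) * M \<le> x * M" "x * 2 \<le> x * M" using x M by (auto intro: mult_right_mono)
        moreover have "11/10 * 2 \<le> x * M" using x M by (intro mult_mono) auto
        ultimately show "21 * x + 55 + 21 * M \<le> 72 * x * M" by linarith
        have "y * 2 \<le> y * M" using y M by (intro mult_left_mono) auto
        then show "18 * y \<le> 9 * y * M" by linarith
      qed (use N1 in auto)
      also have "\<dots> \<le> (72 * N ^ 3 * x + 9 * y + 18) * M" using M by (simp add: algebra_simps)
      also have "\<dots> \<le> lam * M" using lam M by (intro mult_right_mono) auto
      finally show "21 * N * T \<le> lam * M" .
    qed simp
    finally show ?thesis using lam0 unfolding T_def by (simp add: mult_ac)
  next
    case True
    have "M \<le> ln (2 ^ 4)" unfolding M_def using True Q by (subst ln_le_cancel_iff) auto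
    then have M: "M \<le> 3" unfolding lnp using ln2 by simp
    have "4 * N * ((2 * \<kappa> + 1) * \<kappa>) * T \<le> 4 * N * (5 * 2) * T"
      using \<kappa>(1) \<kappa>(3)[OF True] N1 T0 by (intro mult_right_mono mult_left_mono mult_mono) auto
    then have "4 * N * (2 * \<kappa> + 1) * \<kappa> * T \<le> 40 * N * T" by (simp add: mult_ac)
    also have "\<dots> \<le> 40 * N * (x + (N + 4) + sqrt (2 * y))"
      using T M N1 by (intro mult_left_mono) auto
    also have "\<dots> = 40 * N * x + 40 * N\<^sup>2 + 160 * N + 40 * N * sqrt (2 * y)"
      by (simp add: algebra_simps power2_eq_square)
    also have "\<dots> \<le> N ^ 3 * (40 * x + 210) + 80 * y"
    proof -
      have "40 * N * sqrt (2 * y) \<le> 80 * y + 10 * N\<^sup>2"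
        using amgm[of 80 "40 * N"] by (simp add: power_mult_distrib)
      moreover
      have "N * x \<le> N ^ 3 * x" using N2 x by (intro mult_right_mono) auto
      ultimately show ?thesis using N2 by (simp add: algebra_simps)
    qed
    also have "\<dots> \<le> N ^ 3 * (720 * x) + 90 * y"
      using x y N1 by (intro add_mono mult_left_mono) auto
    also have "\<dots> \<le> 10 * (72 * N ^ 3 * x + 9 * y + 18)" by simp
    also have "\<dots> \<le> 10 * lam" using lam by simp
    finally have "4 * N * (2 * \<kappa> + 1) * \<kappa> * T \<le> 10 * lam" .
    moreover have "0 \<le> lam * Q\<^sup>2 * M" using lam0 M0 ln2 by (intro mult_nonneg_nonneg) auto
    ultimately show ?thesis unfolding T_def by linarith
  qed
qed

section \<open>The risk bound\<close>

text \<open>The penalty is charged to the summand \<open>576 * B\<^sup>2\<close>, because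
  \<open>P\<^sup>2\<close> equals \<open>576 * B\<^sup>2 * N ^ 7 / (1 - \<gamma>)\<^sup>2\<close>.
  The remainder \<open>10 * lam + 1\<close> is charged to the summand \<open>2\<close>, for which
  \<open>W \<ge> 72\<close> leaves ample room.\<close>

lemma final_risk_bound:
  fixes N B \<gamma> lam x y Q CT dt d \<delta> :: real and n m :: nat
  defines "x \<equiv> sqrt (2 * ln (2 * d))" and "y \<equiv> ln (N / \<delta>)" and "P \<equiv> 24 / (1 - \<gamma>) * N powr (7/2) * B"
  assumes N: "1 \<le> N" and d: "1 \<le> d" and \<delta>: "0 < \<delta>" "\<delta> < 1" and \<gamma>: "0 < \<gamma>" "\<gamma> < 1" and B: "0 \<le> B"
    and lam: "0 \<le> lam" and Q: "0 \<le> Q" "Q \<le> P" and n: "0 < n" and m: "0 < m"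
  shows "4 * B\<^sup>2 / real m + (\<gamma> / (1 - \<gamma>) * (CT * dt * (2 * B)))\<^sup>2
      + 2 * (lam / sqrt (real n) * Q\<^sup>2 * ln (4 * (Q + 1))) + 2 * ((10 * lam + 1) / sqrt (real n))
    \<le> 1 / (1 - \<gamma>)\<^sup>2 * (256 * N ^ 5 * B\<^sup>2 / real m + 576 * \<gamma>\<^sup>2 * CT\<^sup>2 * dt\<^sup>2 * N ^ 7 * B\<^sup>2)
      + (576 * B\<^sup>2 + 2) * N ^ 7 * (lam + 1) / ((1 - \<gamma>)\<^sup>2 * sqrt (real n))
        * (72 * N ^ 3 * x + 9 * ln (4 * (P + 1)) + 9 * y)"
proof -
  define c where "c = 1 / (1 - \<gamma>)\<^sup>2"
  have "(1 - \<gamma>)\<^sup>2 \<le> 1" using \<gamma> by (simp add: power_le_one)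
  then have c: "1 \<le> c" using \<gamma> by (simp add: c_def)
  have Np: "1 \<le> N ^ k" for k using N by (rule one_le_power)
  have "4 * (B\<^sup>2 / real m) \<le> c * (256 * N ^ 5) * (B\<^sup>2 / real m)"
  proof (intro mult_right_mono)
    show "4 \<le> c * (256 * N ^ 5)" using mult_mono[OF c Np[of 5]] c by simp
  qed simp
  moreover have "(\<gamma> / (1 - \<gamma>) * (CT * dt * (2 * B)))\<^sup>2 = c * 4 * (\<gamma>\<^sup>2 * CT\<^sup>2 * dt\<^sup>2 * B\<^sup>2)"
    by (simp add: c_def power_mult_distrib power_divide)
  moreover have "c * 4 * (\<gamma>\<^sup>2 * CT\<^sup>2 * dt\<^sup>2 * B\<^sup>2) \<le> c * (576 * N ^ 7) * (\<gamma>\<^sup>2 * CT\<^sup>2 * dt\<^sup>2 * B\<^sup>2)"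
    using Np[of 7] c by (intro mult_right_mono mult_left_mono) auto
  ultimately have bias: "4 * B\<^sup>2 / real m + (\<gamma> / (1 - \<gamma>) * (CT * dt * (2 * B)))\<^sup>2
      \<le> 1 / (1 - \<gamma>)\<^sup>2 * (256 * N ^ 5 * B\<^sup>2 / real m + 576 * \<gamma>\<^sup>2 * CT\<^sup>2 * dt\<^sup>2 * N ^ 7 * B\<^sup>2)"
    unfolding c_def[symmetric] by (simp add: distrib_left mult_ac)
  have P0: "0 \<le> P" using Q by linarith
  have P2: "P\<^sup>2 = 576 * B\<^sup>2 * (c * N ^ 7)"
  proof -
    have "(N powr (7/2))\<^sup>2 = N powr (7/2 + 7/2)" by (simp only: power2_eq_square powr_add)
    also have "\<dots> = N ^ 7" using N by simp
    finally show ?thesis by (simp add: P_def c_def power_mult_distrib power_divide)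
  qed
  define W where "W = 72 * N ^ 3 * x + 9 * ln (4 * (P + 1)) + 9 * y"
  have lnP: "0 \<le> ln (4 * (P + 1))" using P0 by simp
  have y: "0 \<le> y" unfolding y_def using N \<delta> by (intro ln_ge_zero) (simp add: pos_le_divide_eq)
  have "ln 2 \<le> ln (2 * d)" using d by simp
  then have "1\<^sup>2 \<le> 2 * ln (2 * d)" using ln2_ge_two_thirds by simp
  then have x: "1 \<le> x" unfolding x_def by (rule real_le_rsqrt)
  have Nx: "1 \<le> N ^ 3 * x" using mult_mono[OF Np[of 3] x] N by simp
  have W: "9 * ln (4 * (P + 1)) \<le> W" "72 \<le> W" using Nx lnP y unfolding W_def by linarith+
  have "2 * (lam * Q\<^sup>2 * ln (4 * (Q + 1))) \<le> 2 * (lam * P\<^sup>2 * ln (4 * (P + 1)))"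
    using lam Q by (intro mult_left_mono mult_mono power_mono) auto
  also have "\<dots> \<le> P\<^sup>2 * lam * (9 * ln (4 * (P + 1)))"
    using mult_nonneg_nonneg[OF mult_nonneg_nonneg[OF lam zero_le_power2[of P]] lnP] by (simp add: mult_ac)
  also have "\<dots> \<le> P\<^sup>2 * (lam + 1) * W"
    using W lam lnP by (intro mult_mono) auto
  finally have 1: "2 * (lam * Q\<^sup>2 * ln (4 * (Q + 1))) \<le> P\<^sup>2 * (lam + 1) * W" .
  have "2 * (10 * lam + 1) \<le> 2 * (1 * 1) * (lam + 1) * 72" using lam by simp
  also have "\<dots> \<le> 2 * (c * N ^ 7) * (lam + 1) * W"
  proof (intro mult_mono)
    show "1 \<le> c" "1 \<le> N ^ 7" by (rule c Np)+
    show "0 \<le> 2 * (c * N ^ 7)" "0 \<le> 2 * (c * N ^ 7) * (lam + 1)" using c N lam by simp_all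
  qed (use c lam W in auto)
  finally have 2: "2 * (10 * lam + 1) \<le> 2 * (c * N ^ 7) * (lam + 1) * W" .
  have "2 * (lam * Q\<^sup>2 * ln (4 * (Q + 1))) + 2 * (10 * lam + 1) \<le> (576 * B\<^sup>2 + 2) * N ^ 7 * (lam + 1) * c * W"
    using 1 2 unfolding P2 by (simp add: algebra_simps)
  then have "(2 * (lam * Q\<^sup>2 * ln (4 * (Q + 1))) + 2 * (10 * lam + 1)) / sqrt (real n)
      \<le> (576 * B\<^sup>2 + 2) * N ^ 7 * (lam + 1) * c * W / sqrt (real n)"
    using n by (intro divide_right_mono) auto
  then have "2 * (lam / sqrt (real n) * Q\<^sup>2 * ln (4 * (Q + 1))) + 2 * ((10 * lam + 1) / sqrt (real n))
     \<le> (576 * B\<^sup>2 + 2) * N ^ 7 * (lam + 1) / ((1 - \<gamma>)\<^sup>2 * sqrt (real n)) * W"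
    by (simp add: c_def add_divide_distrib)
  with bias show ?thesis unfolding W_def by linarith
qed

text \<open>The event is chosen before any minimizer is mentioned: on it all families obey the
  deviation bound at once, so a minimizer may depend on the sample in an arbitrary, even
  nonmeasurable, way.\<close>

lemma bellman_estimate:
  fixes S :: "(real^'d::finite) set" and r :: "real^'d \<Rightarrow> nat \<Rightarrow> real" and g :: "real^'d \<Rightarrow> nat \<Rightarrow> real \<Rightarrow> real^'d"
    and \<gamma> CT dt \<delta> lam :: real and \<alpha> m n :: nat
  defines "A \<equiv> {1..(2::nat) ^ \<alpha>}" and "N \<equiv> (2::real) ^ \<alpha>" and "mm \<equiv> (6 ^ \<alpha> + 1) * m"
    and "D \<equiv> CARD('d) + 2 ^ \<alpha> + 1" and "L \<equiv> \<alpha> + 1" and "d \<equiv> real CARD('d)"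
  defines "B \<equiv> reward_barron_norm S A r"
  assumes setting: "bellman_setting S A r g \<gamma> dt" and m: "0 < m" and n: "0 < n" and \<delta>: "0 < \<delta>" "\<delta> < 1"
    and barron: "\<And>a. a \<in> A \<Longrightarrow> barron_norm_sq S (\<lambda>s. r s a) < \<infinity>"
    and drift: "\<And>s a. s \<in> S \<Longrightarrow> a \<in> A \<Longrightarrow> infnorm (s - g s a dt) \<le> CT * dt"
    and lam: "72 * N ^ 3 * sqrt (2 * ln (2 * d)) + 9 * ln (N / \<delta>) + 18 < lam"
  shows "\<exists>E \<in> sets (sample_dist S A n). measure (sample_dist S A n) E \<ge> 1 - \<delta> \<and>
    (\<forall>Z\<in>E. \<forall>\<Theta>h :: nat \<Rightarrow> 'd rnparam.
      (\<forall>\<Theta>. reg_objective A mm D L r g \<gamma> dt lam n Z \<Theta>h \<le> reg_objective A mm D L r g \<gamma> dt lam n Z \<Theta>) \<longrightarrow>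
      pop_loss S A mm D L r g \<gamma> dt \<Theta>h
        \<le> 1 / (1 - \<gamma>)\<^sup>2 * (256 * N ^ 5 * B\<^sup>2 / real m + 576 * \<gamma>\<^sup>2 * CT\<^sup>2 * dt\<^sup>2 * N ^ 7 * B\<^sup>2)
          + (576 * B\<^sup>2 + 2) * N ^ 7 * (lam + 1) / ((1 - \<gamma>)\<^sup>2 * sqrt (real n))
            * (72 * N ^ 3 * sqrt (2 * ln (2 * d)) + 9 * ln (4 * (24 / (1 - \<gamma>) * N powr (7/2) * B + 1)) + 9 * ln (N / \<delta>)))"
proof -
  interpret bellman_setting S A r g \<gamma> dt by (rule setting)
  have cardA: "real (card A) = N" by (simp add: A_def N_def)
  have N1: "1 \<le> N" by (simp add: N_def)
  have d1: "1 \<le> d" by (simp add: d_def Suc_le_eq)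
  have "0 \<le> 72 * N ^ 3 * sqrt (2 * ln (2 * d))" using N1 d1 by simp
  moreover have "0 \<le> ln (N / \<delta>)" using N1 \<delta> by (intro ln_ge_zero) (simp add: pos_le_divide_eq)
  ultimately have lam0: "0 \<le> lam"
    using lam by linarith
  define pen where "pen \<Theta> = lam / sqrt (real n) * (family_path_norm A mm D L \<Theta>)\<^sup>2
      * ln (4 * (family_path_norm A mm D L \<Theta> + 1))" for \<Theta> :: "nat \<Rightarrow> 'd rnparam"
  define \<kappa> where "\<kappa> = (10 * lam + 1) / sqrt (real n)"
  let ?dev = "\<lambda>Z \<Theta>. \<bar>integral\<^sup>L (sa_dist S A) (bellman_loss A mm D L r g \<gamma> dt \<Theta>)
      - (\<Sum>i<n. bellman_loss A mm D L r g \<gamma> dt \<Theta> (Z i)) / real n\<bar>"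
  let ?bound = "\<lambda>k. (4 * N * (2 * (real k + 1) + 1) * (real k + 1)
      * sqrt (2 * ln (2 * (N * 3 ^ L * (2 * d)) * ((real k + 1) * (real k + 2)) / \<delta>)) + 1) / sqrt (real n)"
  obtain E where E: "E \<in> sets (sample_dist S A n)" "measure (sample_dist S A n) E \<ge> 1 - \<delta>"
    and EZ: "\<forall>Z\<in>E. (\<forall>i<n. fst (Z i) \<in> S \<and> snd (Z i) \<in> A)
      \<and> (\<forall>k::nat. \<forall>\<Theta>. family_path_norm A mm D L \<Theta> \<le> real k + 1 \<longrightarrow> ?dev Z \<Theta> \<le> ?bound k)"
    using bellman_deviation_event[OF n \<delta>, where m = mm and D = D and L = L] unfolding cardA d_def[symmetric]
    by (elim bexE conjE) (rule that)
  have ESA: "snd (Z i) \<in> A" if "Z \<in> E" "i < n" for Z i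
    using bspec[OF EZ that(1)] that(2) by simp
  have dev: "?dev Z \<Theta> \<le> ?bound k" if "Z \<in> E" "family_path_norm A mm D L \<Theta> \<le> real k + 1" for Z k \<Theta>
    using conjunct2[OF bspec[OF EZ that(1)]] that(2) by simp
  have pen: "\<bar>integral\<^sup>L (sa_dist S A) (bellman_loss A mm D L r g \<gamma> dt \<Theta>)
          - (\<Sum>i<n. bellman_loss A mm D L r g \<gamma> dt \<Theta> (Z i)) / real n\<bar> \<le> pen \<Theta> + \<kappa>"
    if Z: "Z \<in> E" for Z and \<Theta> :: "nat \<Rightarrow> 'd rnparam"
  proof -
    define Q where "Q = family_path_norm A mm D L \<Theta>"
    have Q0: "0 \<le> Q" by (simp add: Q_def family_path_norm_nonneg)
    \<comment> \<open>The peeling level of \<open>Q\<close>: its radius \<open>k + 1\<close> exceeds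
      \<open>Q\<close> by at most 1, and is at most 2 when \<open>Q < 2\<close>.\<close>
    define k where "k = nat \<lfloor>Q\<rfloor>"
    have k: "real k \<le> Q" "Q \<le> real k + 1" using Q0 unfolding k_def by linarith+
    have k2: "real k + 1 \<le> 2" if "Q < 2"
    proof -
      have "k < 2" using k(1) that by linarith
      then show ?thesis by linarith
    qed
    have "4 * N * (2 * (real k + 1) + 1) * (real k + 1)
        * sqrt (2 * ln (2 * (N * 3 ^ (\<alpha> + 1) * (2 * d)) * ((real k + 1) * ((real k + 1) + 1)) / \<delta>)) + 1
      \<le> lam * Q\<^sup>2 * ln (4 * (Q + 1)) + 10 * lam + 1"
      using k k2 lam by (intro deviation_le_penalty N_def d1 \<delta> Q0) (auto simp: N_def)
    then have "(4 * N * (2 * (real k + 1) + 1) * (real k + 1)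
        * sqrt (2 * ln (2 * (N * 3 ^ L * (2 * d)) * ((real k + 1) * (real k + 2)) / \<delta>)) + 1) / sqrt (real n)
      \<le> (lam * Q\<^sup>2 * ln (4 * (Q + 1)) + 10 * lam + 1) / sqrt (real n)"
      unfolding L_def by (intro divide_right_mono) (simp_all add: add.assoc)
    also have "\<dots> = pen \<Theta> + \<kappa>"
      by (simp add: pen_def \<kappa>_def Q_def[symmetric] add_divide_distrib)
    finally show ?thesis
      using dev[OF Z, of \<Theta> k] k(2) unfolding Q_def by linarith
  qed
  define b where "b a = barron_norm S (\<lambda>s. r s a)" for a
  have b0: "0 \<le> b a" for a by (simp add: b_def barron_norm_def)
  have B2: "B\<^sup>2 = (\<Sum>a\<in>A. (b a)\<^sup>2)" and B0: "0 \<le> B"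
    by (simp_all add: B_def reward_barron_norm_def b_def sum_nonneg)
  have bB: "b a \<le> B" if "a \<in> A" for a
  proof (rule power2_le_imp_le)
    show "(b a)\<^sup>2 \<le> B\<^sup>2" unfolding B2 using A that by (intro member_le_sum) auto
  qed (rule B0)
  define good where "good a c w \<longleftrightarrow> (\<integral>s. (two_layer m c w s - r s a)\<^sup>2 \<partial>state_dist S) \<le> 4 * (b a)\<^sup>2 / real m
      \<and> (\<Sum>k<m. \<bar>c k\<bar> * l1norm (w k)) \<le> 2 * b a" for a c and w :: "nat \<Rightarrow> real^'d"
  have "\<exists>c w. good a c w" if a: "a \<in> A" for a
    unfolding good_def two_layer_def b_def
    by (rule barron_approximation[OF prob_space_state_dist id_measurable _ r_measurable[OF a] _ _ m, unfolded space_state_dist,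
          OF S_abs r_bound[OF _ a] barron[OF a]])
  then obtain c w where "\<And>a. a \<in> A \<Longrightarrow> good a (c a) (w a)" by metis
  then have c: "\<And>a. a \<in> A \<Longrightarrow> (\<integral>s. (two_layer m (c a) (w a) s - r s a)\<^sup>2 \<partial>state_dist S) \<le> 4 * (b a)\<^sup>2 / real m"
    and cw: "\<And>a. a \<in> A \<Longrightarrow> (\<Sum>k<m. \<bar>c a k\<bar> * l1norm (w a k)) \<le> 2 * b a"
    by (simp_all add: good_def)
  obtain e :: "nat \<Rightarrow> 'd" where e: "bij_betw e {..<CARD('d)} UNIV"
    using ex_bij_betw_nat_finite[of "UNIV :: 'd set"] by (auto simp: atLeast0LessThan)
  define \<beta> where "\<beta> = \<gamma> / (1 - \<gamma>)"
  have \<beta>: "0 \<le> \<beta>" "1 + \<beta> = 1 / (1 - \<gamma>)" using \<gamma> by (auto simp: \<beta>_def field_simps)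
  \<comment> \<open>Actions are numbered from 1, tournament entries from 0; hence \<open>Suc\<close>
    in the weights and \<open>a - 1\<close> for the copied network.\<close>
  define \<Theta> where "\<Theta> a = max_net \<alpha> m e (\<lambda>i. c (Suc i)) (\<lambda>i. w (Suc i)) \<beta> (a - 1)" for a
  have "(2::nat) ^ \<alpha> \<le> 6 ^ \<alpha>" by (intro power_mono) auto
  \<comment> \<open>The first layer uses \<open>m\<close> neurons per action,
    \<open>2 ^ \<alpha> * m\<close> in all; the other neurons of the given width have zero
    weights.\<close>
  then have mm: "2 ^ \<alpha> * m \<le> mm" unfolding mm_def by (intro mult_right_mono) auto
  have D: "D = CARD('d) + 2 ^ \<alpha> + 1" by (simp add: D_def)
  have Aim: "A = Suc ` {..<2 ^ \<alpha>}" unfolding A_def by (simp add: image_Suc_lessThan)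
  have a1: "a - 1 < 2 ^ \<alpha>" "Suc (a - 1) = a" if "a \<in> A" for a using that by (auto simp: A_def)
  have net: "resnet mm D L (\<Theta> a) x = two_layer m (c a) (w a) x + \<gamma> / (1 - \<gamma>) * Max ((\<lambda>a. two_layer m (c a) (w a) x) ` A)"
    if "a \<in> A" for a x
  proof -
    have "(\<lambda>i. two_layer m (c (Suc i)) (w (Suc i)) x) ` {..<2 ^ \<alpha>} = (\<lambda>a. two_layer m (c a) (w a) x) ` A"
      unfolding Aim by (simp add: image_image)
    then show ?thesis
      using resnet_max_net[OF e m mm D a1(1)[OF that] refl, of "\<lambda>i. c (Suc i)" "\<lambda>i. w (Suc i)" \<beta> x] a1(2)[OF that]
      unfolding \<Theta>_def L_def \<beta>_def by simp
  qed
  have "\<bar>s $ i - g s a dt $ i\<bar> \<le> CT * dt" if "s \<in> S" "a \<in> A" for s a i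
    using component_le_infnorm_cart[of "s - g s a dt" i] drift[OF that] by simp
  moreover have "(\<Sum>k<m. \<bar>c a k\<bar> * l1norm (w a k)) \<le> 2 * B" if "a \<in> A" for a
    using cw[OF that] bB[OF that] by linarith
  ultimately have risk: "integral\<^sup>L (sa_dist S A) (bellman_loss A mm D L r g \<gamma> dt \<Theta>)
      + integral\<^sup>L (sa_dist S A) (\<lambda>z. if snd z \<in> A then (r (fst z) (snd z))\<^sup>2 / 2 else 0)
    \<le> (\<Sum>a\<in>A. \<integral>s. (two_layer m (c a) (w a) s - r s a)\<^sup>2 \<partial>state_dist S) + (\<gamma> / (1 - \<gamma>) * (CT * dt * (2 * B)))\<^sup>2"
    using net by (intro mean_loss_candidate_le) auto
  also have "(\<Sum>a\<in>A. \<integral>s. (two_layer m (c a) (w a) s - r s a)\<^sup>2 \<partial>state_dist S) \<le> (\<Sum>a\<in>A. 4 * (b a)\<^sup>2 / real m)"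
    using c by (rule sum_mono)
  also have "\<dots> = 4 * B\<^sup>2 / real m"
    unfolding B2 by (simp add: sum_distrib_left sum_divide_distrib)
  finally have risk: "integral\<^sup>L (sa_dist S A) (bellman_loss A mm D L r g \<gamma> dt \<Theta>)
      + integral\<^sup>L (sa_dist S A) (\<lambda>z. if snd z \<in> A then (r (fst z) (snd z))\<^sup>2 / 2 else 0)
    \<le> 4 * B\<^sup>2 / real m + (\<gamma> / (1 - \<gamma>) * (CT * dt * (2 * B)))\<^sup>2" by simp
  have norm: "family_path_norm A mm D L \<Theta> \<le> 24 / (1 - \<gamma>) * N powr (7/2) * B"
  proof -
    define s where "s a = (\<Sum>k<m. \<bar>c a k\<bar> * l1norm (w a k))" for a
    define T where "T = (\<Sum>a\<in>A. s a)"
    have T0: "0 \<le> T" unfolding T_def s_def by (intro sum_nonneg mult_nonneg_nonneg l1norm_nonneg) auto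
    have four: "(4::real) ^ \<alpha> = N\<^sup>2" by (simp add: N_def power_mult_distrib[symmetric] power2_eq_square)
    have shift: "(\<Sum>i<2 ^ \<alpha>. s (Suc i)) = T"
      unfolding T_def Aim by (simp add: sum.reindex)
    have "path_norm mm D L (\<Theta> a) \<le> 3 * s a + \<beta> * (N\<^sup>2 * (3 * T))" if "a \<in> A" for a
      using path_norm_max_net_le[OF e m mm D a1(1)[OF that] refl \<beta>(1), of "\<lambda>i. c (Suc i)" "\<lambda>i. w (Suc i)"] a1(2)[OF that]
      unfolding \<Theta>_def L_def s_def[symmetric] shift four by simp
    then have "family_path_norm A mm D L \<Theta> \<le> (\<Sum>a\<in>A. 3 * s a + \<beta> * (N\<^sup>2 * (3 * T)))"
      unfolding family_path_norm_def by (rule sum_mono)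
    also have "\<dots> = 3 * T + N * (\<beta> * (N\<^sup>2 * (3 * T)))"
      by (simp add: sum.distrib T_def sum_distrib_left[symmetric] cardA)
    also have "\<dots> = (1 + N ^ 3 * \<beta>) * (3 * T)"
      by (simp add: algebra_simps power2_eq_square power3_eq_cube)
    \<comment> \<open>Since \<open>N ^ 3 \<ge> 1\<close>, the bracket becomes a multiple of
      \<open>1 + \<beta>\<close>, which is \<open>1 / (1 - \<gamma>)\<close>.\<close>
    also have "\<dots> \<le> (N ^ 3 * (1 + \<beta>)) * (3 * T)"
      using N1 T0 by (intro mult_right_mono) (auto simp: distrib_left)
    also have "\<dots> \<le> (N ^ 3 * (1 + \<beta>)) * (3 * (2 * (sqrt N * B)))"
    proof (intro mult_left_mono)
      have "T \<le> (\<Sum>a\<in>A. 2 * b a)" unfolding T_def s_def by (intro sum_mono cw)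
      \<comment> \<open>The Cauchy-Schwarz inequality over the actions; its \<open>sqrt N\<close>
        raises \<open>N ^ 3\<close> to the exponent \<open>7/2\<close>.\<close>
      moreover have "(\<Sum>a\<in>A. b a) \<le> sqrt N * B"
      proof (rule power2_le_imp_le)
        have "(\<Sum>a\<in>A. b a)\<^sup>2 \<le> (\<Sum>a\<in>A. (b a)\<^sup>2) * real (card A)"
          by (rule sum_squared_le_sum_of_squares)
        then show "(\<Sum>a\<in>A. b a)\<^sup>2 \<le> (sqrt N * B)\<^sup>2"
          using N1 by (simp add: power_mult_distrib B2 cardA mult.commute)
      qed (use N1 B0 in simp)
      ultimately show "T \<le> 2 * (sqrt N * B)" by (simp add: sum_distrib_left[symmetric])
    qed (use N1 \<beta>(1) in auto)
    also have "\<dots> = 6 / (1 - \<gamma>) * (N ^ 3 * sqrt N) * B" unfolding \<beta>(2) by simp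
    also have "N ^ 3 * sqrt N = N powr (7/2)"
    proof -
      have "N powr (7/2) = N powr (3 + 1/2)" by simp
      also have "\<dots> = N powr 3 * N powr (1/2)" by (rule powr_add)
      also have "\<dots> = N ^ 3 * sqrt N" using N1 by (simp add: powr_numeral powr_half_sqrt)
      finally show ?thesis by simp
    qed
    also have "6 / (1 - \<gamma>) * N powr (7/2) * B \<le> 24 / (1 - \<gamma>) * N powr (7/2) * B"
      using \<gamma> B0 by (intro mult_right_mono divide_right_mono) auto
    finally show ?thesis .
  qed
  show ?thesis
  proof (intro bexI[OF _ E(1)] conjI E(2) ballI allI impI)
    fix Z and \<Theta>h :: "nat \<Rightarrow> 'd rnparam"
    assume Z: "Z \<in> E"
      and min: "\<forall>\<Theta>. reg_objective A mm D L r g \<gamma> dt lam n Z \<Theta>h \<le> reg_objective A mm D L r g \<gamma> dt lam n Z \<Theta>"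
    have "emp_loss A mm D L r g \<gamma> dt n Z \<Theta>h + pen \<Theta>h \<le> emp_loss A mm D L r g \<gamma> dt n Z \<Theta> + pen \<Theta>"
      using min unfolding reg_objective_def pen_def by blast
    from oracle_inequality[OF n ESA[OF Z] this pen[OF Z]]
    have "pop_loss S A mm D L r g \<gamma> dt \<Theta>h
      \<le> 4 * B\<^sup>2 / real m + (\<gamma> / (1 - \<gamma>) * (CT * dt * (2 * B)))\<^sup>2 + 2 * pen \<Theta> + 2 * \<kappa>"
      using risk by linarith
    also have "\<dots> \<le> 1 / (1 - \<gamma>)\<^sup>2 * (256 * N ^ 5 * B\<^sup>2 / real m + 576 * \<gamma>\<^sup>2 * CT\<^sup>2 * dt\<^sup>2 * N ^ 7 * B\<^sup>2)
          + (576 * B\<^sup>2 + 2) * N ^ 7 * (lam + 1) / ((1 - \<gamma>)\<^sup>2 * sqrt (real n))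
            * (72 * N ^ 3 * sqrt (2 * ln (2 * d)) + 9 * ln (4 * (24 / (1 - \<gamma>) * N powr (7/2) * B + 1)) + 9 * ln (N / \<delta>))"
      unfolding pen_def \<kappa>_def
      by (rule final_risk_bound[OF N1 d1 \<delta> \<gamma> B0 lam0 family_path_norm_nonneg norm n m])
    finally show "pop_loss S A mm D L r g \<gamma> dt \<Theta>h \<le> \<dots>" .
  qed
qed

theorem theorem3p1:
  fixes \<alpha> :: nat
  shows "\<exists>D0::nat. D0 > 0 \<and>
   (\<forall>m::nat. m > 0 \<longrightarrow>
    (\<forall>(S :: (real^'d) set) (r :: real^'d \<Rightarrow> nat \<Rightarrow> real) (g :: real^'d \<Rightarrow> nat \<Rightarrow> real \<Rightarrow> real^'d)
       (\<gamma>::real) (CT::real) (dt::real) (\<delta>::real) (n::nat) (lam::real).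
     let A = {1..(2::nat)^\<alpha>}; NA = (2::real)^\<alpha>; d = real CARD('d);
         mm = (6^\<alpha> + 1) * m; L = \<alpha> + 1; B = reward_barron_norm S A r in
     (compact S \<and> (\<forall>s\<in>S. \<forall>i. 0 \<le> s $ i \<and> s $ i \<le> 1) \<and> emeasure lborel S > 0 \<and>
      0 < \<gamma> \<and> \<gamma> < 1 \<and>
      (\<forall>a\<in>A. continuous_on S (\<lambda>s. r s a) \<and> in_barron S (\<lambda>s. r s a)
               \<and> barron_norm_sq S (\<lambda>s. r s a) < \<infinity>) \<and>
      (\<forall>s\<in>S. \<forall>a\<in>A. \<bar>r s a\<bar> \<le> 1) \<and>
      (\<forall>s\<in>S. \<forall>a\<in>A. \<forall>t\<ge>0. g s a t \<in> S) \<and>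
      (\<forall>s\<in>S. \<forall>a\<in>A. g s a 0 = s) \<and>
      (\<forall>s\<in>S. \<forall>a\<in>A. \<forall>t\<ge>0. \<forall>t'\<ge>0. g (g s a t) a t' = g s a (t + t')) \<and>
      CT > 0 \<and>
      (\<forall>s\<in>S. \<forall>a\<in>A. \<forall>t\<ge>0. \<forall>\<Delta>. 0 < \<Delta> \<and> \<Delta> < 1 \<longrightarrow>
          infnorm (g s a t - g s a (t + \<Delta>)) \<le> CT * \<Delta>) \<and>
      0 < dt \<and> dt < 1 \<and>
      (\<forall>a\<in>A. (\<lambda>s. g s a dt) \<in> borel_measurable (restrict_space lborel S)) \<and>
      0 < \<delta> \<and> \<delta> < 1 \<and> n \<ge> 1 \<and>
      lam > 72 * NA^3 * sqrt (2 * ln (2 * d)) + 9 * ln (NA / \<delta>) + 18)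
     \<longrightarrow>
     (\<exists>E \<in> sets (sample_dist S A n).
        measure (sample_dist S A n) E \<ge> 1 - \<delta> \<and>
        (\<forall>smp\<in>E. \<forall>\<Theta>h :: nat \<Rightarrow> 'd rnparam.
           (\<forall>\<Theta>. reg_objective A mm D0 L r g \<gamma> dt lam n smp \<Theta>h
                  \<le> reg_objective A mm D0 L r g \<gamma> dt lam n smp \<Theta>) \<longrightarrow>
           pop_loss S A mm D0 L r g \<gamma> dt \<Theta>h
             \<le> 1 / (1 - \<gamma>)\<^sup>2 * (256 * NA^5 * B\<^sup>2 / real m + 576 * \<gamma>\<^sup>2 * CT\<^sup>2 * dt\<^sup>2 * NA^7 * B\<^sup>2)
               + (576 * B\<^sup>2 + 2) * NA^7 * (lam + 1) / ((1 - \<gamma>)\<^sup>2 * sqrt (real n))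
                 * (72 * NA^3 * sqrt (2 * ln (2 * d))
                    + 9 * ln (4 * (24 / (1 - \<gamma>) * NA powr (7/2) * B + 1))
                    + 9 * ln (NA / \<delta>))))))"
\<comment> \<open>The channels of the candidate: one per input coordinate, one per action, and one
  for the copy that bypasses the tournament.\<close>
proof (intro exI[of _ "CARD('d) + 2 ^ \<alpha> + 1"] conjI allI impI, goal_cases)
  case 1
  show ?case by simp
next
  case (2 m S r g \<gamma> CT dt \<delta> n lam)
  then show ?case
    unfolding Let_def
  proof (intro impI, elim conjE, goal_cases)
    case 1
    let ?A = "{1..(2::nat) ^ \<alpha>}"
    have setting: "bellman_setting S ?A r g \<gamma> dt"
      using 1 by unfold_locales auto
    have g0: "\<forall>s\<in>S. \<forall>a\<in>?A. g s a 0 = s"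
      and lip: "\<forall>s\<in>S. \<forall>a\<in>?A. \<forall>t\<ge>0. \<forall>\<Delta>. 0 < \<Delta> \<and> \<Delta> < 1 \<longrightarrow>
        infnorm (g s a t - g s a (t + \<Delta>)) \<le> CT * \<Delta>" and dt: "0 < dt \<and> dt < 1"
      using 1 by simp_all
    \<comment> \<open>The Lipschitz condition in time, at time \<open>0\<close> with increment
      \<open>dt\<close>, where \<open>g s a 0 = s\<close>.\<close>
    have drift: "infnorm (s - g s a dt) \<le> CT * dt" if "s \<in> S" "a \<in> ?A" for s a
      using lip[rule_format, OF that order.refl dt] g0[rule_format, OF that] by simp
    show ?case
      by (rule bellman_estimate[OF setting _ _ _ _ _ drift]) (use 1 in auto)
  qed
qed

end
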